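(* Let $f:\mathbb{R}^2\to\mathbb{R}$ be a function that is differentiable at every point of $\mathbb{R}^2$ and whose gradient is nowhere zero, and let $c\in\mathbb{R}$ be arbitrary. Then: (1) the set of branching points of $\{f=c\}$ has no point of accumulation in $\mathbb{R}^2$; (2) the level set $\{f=c\}$ is the union of a family of nice curves that are pairwise disjoint except for their endpoints; (3) if $x\in\{f=c\}$ is not a branching point of $\{f=c\}$, then there exists a neighbourhood $U$ of $x$ such that $\{f=c\}\cap U$ is homeomorphic to an open interval; (4) if $x\in\mathbb{R}^2$ is a branching point of $\{f=c\}$, then there exists a neighbourhood $U$ of $x$ such that $\{f=c\}\cap U$ is homeomorphic to the union of finitely many open segments passing through a point.
   Context: Notation: $\{f=c\}=\{x\in\mathbb{R}^2: f(x)=c\}$ and $\{f\neq c\}=\{x\in\mathbb{R}^2: f(x)\neq c\}$. $\mathbb{S}^2=\mathbb{R}^2\cup\{\infty\}$ is the one-point compactification of the plane. Closure and component refer to $\mathbb{R}^2$. Differentiable means (Fréchet) differentiable at every point; the derivative is not assumed continuous. An arc (resp. Jordan curve) in $\mathbb{R}^2$ or $\mathbb{S}^2$ is a continuous injective map from a closed interval (resp. a circle), identified with its image. Contingent: for $H\subset\mathbb{R}^2$ and $x\in H$, the contingent of $H$ at $x$ is the union of all half-lines $L$ starting from $x$ for which there are points $x_n\in H$, $x_n\ne x$, $x_n\to x$, such that the directions of the half-lines $L_n$ starting from $x$ and passing through $x_n$ converge to the direction of $L$. The set $H$ has a tangent (resp. half-tangent) at $x$ if its contingent at $x$ is a line (resp.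 a half-line). Branching point: $x\in\mathbb{R}^2$ is a branching point of $\{f=c\}$ if it lies in the closure of at least three different connected components of $\{f\neq c\}$. Nice curve: a set $H\subset\mathbb{R}^2$ is a nice curve (with respect to $f$ and $c$) if $H=\gamma\setminus\{\infty\}$ where (i) $\gamma$ is either an arc in $\mathbb{R}^2$ between two branching points of $\{f=c\}$, or an arc in $\mathbb{S}^2$ between a branching point of $\{f=c\}$ and $\infty$, or a Jordan curve in $\mathbb{S}^2$ containing $\infty$ (in this last case no point of $\gamma\setminus\{\infty\}$ is an endpoint); (ii) at every $x\in\gamma\setminus\{\infty\}$ that is not an endpoint of $\gamma$, $\gamma\setminus\{\infty\}$ has a tangent, and at every $x\in\gamma\setminus\{\infty\}$ that is an endpoint of $\gamma$, $\gamma\setminus\{\infty\}$ has a half-tangent. *)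

theory Defs
  imports "HOL-Analysis.Analysis"
begin

(* The one-point compactification of the plane: a point x of the plane is Some x, infinity is None. *)
definition S2 :: "(real^2) option topology" where
  "S2 = Alexandroff_compactification euclidean"

definition arc_between :: "'a topology \<Rightarrow> 'a set \<Rightarrow> 'a \<Rightarrow> 'a \<Rightarrow> bool" where
  "arc_between X \<gamma> a b \<longleftrightarrow>
     (\<exists>g. pathin X g \<and> inj_on g {0..1} \<and> \<gamma> = g ` {0..1} \<and> g 0 = a \<and> g 1 = b)"

definition jordan_curve_in :: "'a topology \<Rightarrow> 'a set \<Rightarrow> bool" where
  "jordan_curve_in X \<gamma> \<longleftrightarrow>
     (\<exists>g. continuous_map (top_of_set (sphere (0::complex) 1)) X g \<and>
          inj_on g (sphere 0 1) \<and> \<gamma> = g ` sphere 0 1)"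

definition half_line :: "'a::real_vector \<Rightarrow> 'a \<Rightarrow> 'a set" where
  "half_line x v = {x + t *\<^sub>R v | t. 0 \<le> t}"

definition is_half_line :: "'a::real_vector set \<Rightarrow> bool" where
  "is_half_line L \<longleftrightarrow> (\<exists>x v. v \<noteq> 0 \<and> L = half_line x v)"

definition is_line :: "'a::real_vector set \<Rightarrow> bool" where
  "is_line L \<longleftrightarrow> (\<exists>x v. v \<noteq> 0 \<and> L = {x + t *\<^sub>R v | t. True})"

(* Directions are unit vectors; sgn z is z divided by its norm. *)
definition contingent :: "(real^2) set \<Rightarrow> real^2 \<Rightarrow> (real^2) set" where
  "contingent H x =
     \<Union> {half_line x v | v. norm v = 1 \<and>
          (\<exists>s::nat \<Rightarrow> real^2. (\<forall>n. s n \<in> H \<and> s n \<noteq> x) \<and> s \<longlonglongrightarrow> x \<and>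
               (\<lambda>n. sgn (s n - x)) \<longlonglongrightarrow> v)}"

definition has_tangent_at :: "(real^2) set \<Rightarrow> real^2 \<Rightarrow> bool" where
  "has_tangent_at H x \<longleftrightarrow> is_line (contingent H x)"

definition has_half_tangent_at :: "(real^2) set \<Rightarrow> real^2 \<Rightarrow> bool" where
  "has_half_tangent_at H x \<longleftrightarrow> is_half_line (contingent H x)"

definition branching_point :: "(real^2 \<Rightarrow> real) \<Rightarrow> real \<Rightarrow> real^2 \<Rightarrow> bool" where
  "branching_point f c x \<longleftrightarrow>
     (\<exists>A B C. A \<in> components {y. f y \<noteq> c} \<and> B \<in> components {y. f y \<noteq> c} \<and>
              C \<in> components {y. f y \<noteq> c} \<and> A \<noteq> B \<and> A \<noteq> C \<and> B \<noteq> C \<and>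
              x \<in> closure A \<and> x \<in> closure B \<and> x \<in> closure C)"

(* H is a nice curve, and E is the set of those endpoints of the underlying arc or Jordan
   curve that lie in the plane. The set {y. Some y \<in> \<gamma>} is \<gamma> with infinity removed. *)
definition nice_curve :: "(real^2 \<Rightarrow> real) \<Rightarrow> real \<Rightarrow> (real^2) set \<Rightarrow> (real^2) set \<Rightarrow> bool" where
  "nice_curve f c H E \<longleftrightarrow>
     ((\<exists>a b. branching_point f c a \<and> branching_point f c b \<and>
             arc_between euclidean H a b \<and> E = {a, b}) \<or>
      (\<exists>a \<gamma>. branching_point f c a \<and> arc_between S2 \<gamma> (Some a) None \<and>
             H = {y. Some y \<in> \<gamma>} \<and> E = {a}) \<or>
      (\<exists>\<gamma>. jordan_curve_in S2 \<gamma> \<and> None \<in> \<gamma> \<and>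
             H = {y. Some y \<in> \<gamma>} \<and> E = {})) \<and>
     (\<forall>x \<in> H - E. has_tangent_at H x) \<and>
     (\<forall>x \<in> E. has_half_tangent_at H x)"

end

theory Submission
  imports Defs "HOL-Complex_Analysis.Great_Picard"
begin

text \<open>
  Since the gradient never vanishes, \<open>f\<close> has no local extremum, so no compact subset of the level
  set \<open>Z\<close> separates the plane; by Janiszewski's theorem the intersection of two continua in \<open>Z\<close> is
  connected, so \<open>Z\<close> contains no loops. Near each of its points \<open>Z\<close> lies in a thin double cone around
  the tangent, so a short normal segment meets \<open>Z\<close> only in that point; hence \<open>Z\<close> has no compact
  relatively open part. A limit of disjoint continua in \<open>Z\<close> would be an uncountable continuum at
  almost all of whose points the others are cut by normals, which is impossible; so only finitely
  many disjoint continua of a given size meet a bounded set. This makes \<open>Z\<close> locally connected, its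
  minimal continua arcs, and the number of branches at each point finite. By Jordan curve arguments
  every component of the complement of \<open>Z\<close> with \<open>x\<close> in its closure borders exactly two branches at \<open>x\<close>, so
  there are as many branches as components: branching points are the points with more than two
  branches. The components of \<open>Z\<close> minus the branching points are open arcs whose ends converge to
  branching points or to infinity, and the cone property provides their tangents.
\<close>

section \<open>Plane topology\<close>

text \<open>As the gradient may be discontinuous, no implicit function theorem applies: the radius
  on which \<open>cone\<close> gives the double cone varies with the point without any uniformity,
  and the level set may really branch. Uniformity is recovered only in
  \<open>countable_one_sided\<close>, by sorting points into countably many classes with a common
  radius and nearly a common direction; the rest is plane topology. The central object is
  \<open>seg a b\<close>, the intersection of all continua in \<open>Z\<close> through
  \<open>a\<close> and \<open>b\<close>, which is itself such a continuum. It is ordered by its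
  initial pieces, and a Whitney map, strictly monotone and Lipschitz for the Hausdorff distance,
  turns this order into the continuous parameter \<open>len\<close>. Finiteness always goes back to
  \<open>finite_disjoint_large\<close>: components of \<open>Z - {w}\<close> are unbounded, so each
  one entering a ball contains a continuum of fixed size. The number of branches at a point is even,
  as the local picture by full segments demands, because the faces with \<open>F\<close> positive
  alone already account for all branches, two for each face.\<close>

lemma plane_complex_iso:
  obtains j :: "real^2 \<Rightarrow> complex" and k where "linear j" "linear k" "\<And>x. k (j x) = x" "\<And>y. j (k y) = y"
proof -
  have d: "DIM(real^2) = DIM(complex)" by simp
  show ?thesis by (rule isomorphisms_UNIV_UNIV[OF d]) (rule that)
qed

text \<open>Janiszewski's theorem for sets of complex numbers, carried over by a linear isomorphism,
  which preserves compact, closed and connected sets.\<close>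

lemma Janiszewski_plane:
  fixes a b :: "real^2"
  assumes S: "compact S" and T: "closed T" and conST: "connected (S \<inter> T)"
      and ccS: "connected_component (- S) a b" and ccT: "connected_component (- T) a b"
    shows "connected_component (- (S \<union> T)) a b"
proof -
  obtain j :: "real^2 \<Rightarrow> complex" and k where jk: "linear j" "linear k" "\<And>x. k (j x) = x" "\<And>y. j (k y) = y"
    using plane_complex_iso by blast
  have inj: "inj j" by (metis injI jk(3))
  have bij: "bij j" by (metis bijI' jk(3,4))
  have cj: "continuous_on X j" and ck: "continuous_on Y k" for X Y
    using jk(1,2) by (auto simp: linear_continuous_on linear_conv_bounded_linear)
  have im: "connected_component (- j ` X) (j a) (j b)" if cc: "connected_component (- X) a b" for X
  proof -
    obtain U where "connected U" "U \<subseteq> - X" "a \<in> U" "b \<in> U"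
      using cc unfolding connected_component_def by blast
    then show ?thesis unfolding connected_component_def
      by (intro exI[of _ "j ` U"]) (use inj connected_continuous_image[OF cj] in \<open>auto simp: inj_eq\<close>)
  qed
  have "connected_component (- (j ` S \<union> j ` T)) (j a) (j b)"
  proof (rule Janiszewski)
    show "compact (j ` S)" using S cj compact_continuous_image by blast
    show "closed (j ` T)" using T closed_injective_linear_image[OF _ jk(1) inj] by blast
    show "connected (j ` S \<inter> j ` T)"
      using connected_continuous_image[OF cj conST] inj by (simp add: image_Int)
  qed (use im ccS ccT in auto)
  then obtain U where U: "connected U" "U \<subseteq> - (j ` S \<union> j ` T)" "j a \<in> U" "j b \<in> U"
    unfolding connected_component_def by blast
  show ?thesis unfolding connected_component_def
  proof (intro exI conjI)
    show "connected (k ` U)" using connected_continuous_image[OF ck U(1)] .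
    show "k ` U \<subseteq> - (S \<union> T)" using U(2) jk(4) by (force simp: image_iff)
    show "a \<in> k ` U" "b \<in> k ` U" using U(3,4) jk(3) by (metis imageI)+
  qed
qed

lemma Janiszewski_dual_plane:
  fixes S T :: "(real^2) set"
  assumes "compact S" "compact T" "connected S" "connected T" "connected(- (S \<union> T))"
  shows "connected (S \<inter> T)"
proof -
  obtain j :: "real^2 \<Rightarrow> complex" and k where jk: "linear j" "linear k" "\<And>x. k (j x) = x" "\<And>y. j (k y) = y"
    using plane_complex_iso by blast
  have inj: "inj j" by (metis injI jk(3))
  have bij: "bij j" by (metis bijI' jk(3,4))
  have cj: "continuous_on X j" and ck: "continuous_on Y k" for X Y
    using jk(1,2) by (auto simp: linear_continuous_on linear_conv_bounded_linear)
  have eq: "- (j ` S \<union> j ` T) = j ` (- (S \<union> T))"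
    by (metis bij_image_Compl_eq bij(1) image_Un)
  have "connected (j ` S \<inter> j ` T)"
    apply (rule Janiszewski_dual)
    using assms cj eq by (auto intro: compact_continuous_image connected_continuous_image)
  then have "connected (k ` (j ` S \<inter> j ` T))" using connected_continuous_image[OF ck] by blast
  moreover have "k ` (j ` S \<inter> j ` T) = S \<inter> T"
    using inj jk(3) by (simp add: image_Int[symmetric] image_comp o_def)
  ultimately show ?thesis by simp
qed

text \<open>The two sides from the Jordan curve theorem are transported from the complex plane and
  then identified with \<open>inside\<close> and \<open>outside\<close>, so that later arguments can
  name them.\<close>

lemma Jordan_inside_outside_plane:
  fixes c :: "real \<Rightarrow> real^2"
  assumes "simple_path c" "pathfinish c = pathstart c"
  shows "open (inside (path_image c))" "connected (inside (path_image c))"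
    "open (outside (path_image c))" "connected (outside (path_image c))"
    "bounded (inside (path_image c))" "inside (path_image c) \<noteq> {}"
    "frontier (inside (path_image c)) = path_image c"
    "frontier (outside (path_image c)) = path_image c"
proof -
  obtain j :: "real^2 \<Rightarrow> complex" and k where jk: "linear j" "linear k" "\<And>x. k (j x) = x" "\<And>y. j (k y) = y"
    using plane_complex_iso by blast
  have inj: "inj j" "inj k" by (metis injI jk(3,4))+
  have bij: "bij j" "bij k" by (metis bijI' jk(3,4))+
  have cj: "continuous_on X j" and ck: "continuous_on Y k" for X Y
    using jk(1,2) by (auto simp: linear_continuous_on linear_conv_bounded_linear)
  have s: "simple_path (j \<circ> c)" 
    using simple_path_linear_image_eq[OF jk(1) inj(1)] assms(1) by blast
  have f: "pathfinish (j \<circ> c) = pathstart (j \<circ> c)"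
    using assms(2) by (simp add: pathstart_def pathfinish_def)
  obtain inner outer where *: "inner \<noteq> {}" "open inner" "connected inner"
             "outer \<noteq> {}" "open outer" "connected outer"
             "bounded inner" "\<not> bounded outer" "inner \<inter> outer = {}"
             "inner \<union> outer = - path_image (j \<circ> c)"
             "frontier inner = path_image (j \<circ> c)"
             "frontier outer = path_image (j \<circ> c)"
    using Jordan_curve [OF s f] by blast
  have pim: "k ` path_image (j \<circ> c) = path_image c"
    using jk(3) by (simp add: path_image_compose image_image)
  have fr: "frontier (k ` X) = k ` frontier X" for X
    unfolding frontier_def
    using closure_injective_linear_image[OF jk(2) inj(2)] interior_bijective_linear_image[OF jk(2) bij(2)]
    by (simp add: image_set_diff[OF inj(2)])
  define I where "I = k ` inner"
  define O' where "O' = k ` outer"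
  have H: "I \<noteq> {}" "open I" "connected I" "open O'" "connected O'" "bounded I" "\<not> bounded O'" "I \<inter> O' = {}"
    "I \<union> O' = - path_image c" "frontier I = path_image c" "frontier O' = path_image c"
  proof -
    show "I \<noteq> {}" using * I_def by simp
    show "open I" "open O'" using * I_def O'_def open_bijective_linear_image_eq[OF jk(2) bij(2)] by auto
    show "connected I" "connected O'" using * I_def O'_def connected_continuous_image[OF ck] by auto
    show "bounded I" using * I_def bounded_linear_image jk(2) linear_conv_bounded_linear by blast
    show "\<not> bounded O'" 
    proof
      assume "bounded O'"
      then have "bounded (j ` O')" using bounded_linear_image jk(1) linear_conv_bounded_linear by blast
      moreover have "j ` O' = outer" unfolding O'_def using jk(4) by (simp add: image_comp o_def)
      ultimately show False using * by simp
    qed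
    show "I \<inter> O' = {}" unfolding I_def O'_def using *(9) inj by (simp add: image_Int[symmetric])
    have "I \<union> O' = k ` (- path_image (j \<circ> c))" unfolding I_def O'_def by (simp add: image_Un[symmetric] *(10))
    then show "I \<union> O' = - path_image c" using bij pim by (simp add: bij_image_Compl_eq)
    show "frontier I = path_image c" "frontier O' = path_image c" unfolding I_def O'_def by (simp_all add: fr * pim)
  qed
  have inner: "inside (path_image c) = I"
  proof (rule antisym)
    show "inside (path_image c) \<subseteq> I"
      by (rule inside_subset[of O']) (use H in auto)
    show "I \<subseteq> inside (path_image c)"
      using interior_inside_frontier[OF H(6)] H by (simp add: interior_open)
  qed
  have outer: "outside(path_image c) = O'"
    using H(8,9) inner outside_inside by blast
  show "open (inside (path_image c))" "connected (inside (path_image c))"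
    "open (outside (path_image c))" "connected (outside (path_image c))"
    "bounded (inside (path_image c))" "inside (path_image c) \<noteq> {}"
    "frontier (inside (path_image c)) = path_image c"
    "frontier (outside (path_image c)) = path_image c"
    using H by (auto simp: inner outer)
qed

text \<open>Otherwise the three Jordan interiors are pairwise disjoint. The closures of two of them
  meet exactly in the common arc, which is connected, so by Janiszewski a point of the third
  interior can be joined to a far away point off both closures. But the boundary of the third
  interior lies in these closures.\<close>

lemma theta_curve_arc_inside:
  fixes p1 p2 p3 :: "real \<Rightarrow> real^2"
  assumes arcs: "arc p1" "arc p2" "arc p3"
    and st: "pathstart p1 = x" "pathstart p2 = x" "pathstart p3 = x"
    and fi: "pathfinish p1 = p" "pathfinish p2 = p" "pathfinish p3 = p"
    and I12: "path_image p1 \<inter> path_image p2 = {x,p}"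
    and I13: "path_image p1 \<inter> path_image p3 = {x,p}"
    and I23: "path_image p2 \<inter> path_image p3 = {x,p}"
  shows "path_image p3 - {x,p} \<subseteq> inside (path_image p1 \<union> path_image p2) \<or>
         path_image p2 - {x,p} \<subseteq> inside (path_image p1 \<union> path_image p3) \<or>
         path_image p1 - {x,p} \<subseteq> inside (path_image p2 \<union> path_image p3)"
proof (rule ccontr)
  assume neg: "\<not> ?thesis"
  have jordan: "simple_path (q +++ reversepath r) \<and> pathfinish (q +++ reversepath r) = pathstart (q +++ reversepath r)
     \<and> path_image (q +++ reversepath r) = path_image q \<union> path_image r"
    if "arc q" "arc r" "pathstart q = x" "pathstart r = x" "pathfinish q = p" "pathfinish r = p"
      "path_image q \<inter> path_image r = {x,p}" for q r
    using that by (auto intro!: simple_path_join_loop arc_reversepath simp: path_image_join)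
  note J = Jordan_inside_outside_plane
  have side: "path_image r3 - {x,p} \<subseteq> inside (path_image r1 \<union> path_image r2) \<or>
       path_image r3 \<inter> inside (path_image r1 \<union> path_image r2) = {}"
    if "arc r1" "arc r2" "arc r3" "pathstart r1 = x" "pathstart r2 = x" "pathstart r3 = x"
      "pathfinish r1 = p" "pathfinish r2 = p" "pathfinish r3 = p"
      "path_image r1 \<inter> path_image r2 = {x,p}" "path_image r1 \<inter> path_image r3 = {x,p}"
      "path_image r2 \<inter> path_image r3 = {x,p}" for r1 r2 r3
  proof -
    let ?X = "path_image r1 \<union> path_image r2"
    have c: "connected (path_image r3 - {x,p})"
      using connected_simple_path_endless[of r3] that by (simp add: arc_imp_simple_path)
    have d: "(path_image r3 - {x,p}) \<inter> ?X = {}" using that by blast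
    have o: "open (inside ?X)" "open (outside ?X)"
      using jordan[of r1 r2] that J[of "r1 +++ reversepath r2"] by auto
    have "{x,p} \<inter> inside ?X = {}" using that inside_no_overlap[of ?X] by blast
    moreover have "path_image r3 - {x,p} \<subseteq> inside ?X \<union> outside ?X"
      using d inside_Un_outside[of ?X] by blast
    ultimately show ?thesis
      using connectedD[OF c o] inside_Int_outside[of ?X] by blast
  qed
  let ?D12 = "inside (path_image p1 \<union> path_image p2)"
  let ?D13 = "inside (path_image p1 \<union> path_image p3)"
  let ?D23 = "inside (path_image p2 \<union> path_image p3)"
  have e3: "path_image p3 \<inter> ?D12 = {}" using side[of p1 p2 p3] assms neg by blast
  have e2: "path_image p2 \<inter> ?D13 = {}" using side[of p1 p3 p2] assms neg by (metis inf_commute)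
  have e1: "path_image p1 \<inter> ?D23 = {}" using side[of p2 p3 p1] assms neg by (metis inf_commute)
  have j12: "open ?D12" "connected ?D12" "bounded ?D12" "frontier ?D12 = path_image p1 \<union> path_image p2"
     "connected (outside (path_image p1 \<union> path_image p2))"
    using jordan[of p1 p2] assms J[of "p1 +++ reversepath p2"] by auto
  have j13: "open ?D13" "connected ?D13" "bounded ?D13" "frontier ?D13 = path_image p1 \<union> path_image p3"
     "connected (outside (path_image p1 \<union> path_image p3))"
    using jordan[of p1 p3] assms J[of "p1 +++ reversepath p3"] by auto
  have j23: "open ?D23" "connected ?D23" "bounded ?D23" "frontier ?D23 = path_image p2 \<union> path_image p3"
    "?D23 \<noteq> {}"
    using jordan[of p2 p3] assms J[of "p2 +++ reversepath p3"] by auto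
  \<comment> \<open>If the two domains overlapped, \<open>Da\<close> could not leave
    \<open>inside X\<close> without meeting its frontier \<open>X\<close>; so \<open>Da\<close>
    would lie inside, and its frontier \<open>Y\<close> in the closure of the inside, hence in
    \<open>X\<close>.\<close>
  have sub: "Da \<inter> inside X = {}"
    if "connected Da" "frontier Da = Y" "open (inside X)" "frontier (inside X) = X" 
      "Da \<inter> X = {}" "Y \<inter> inside X = {}" "\<not> Y \<subseteq> X" for Da X Y :: "(real^2) set"
  proof (rule ccontr)
    assume ne: "Da \<inter> inside X \<noteq> {}"
    have "Da \<subseteq> inside X"
    proof (rule ccontr)
      assume "\<not> Da \<subseteq> inside X"
      then have "Da \<inter> frontier (inside X) \<noteq> {}"
        using connected_Int_frontier[OF \<open>connected Da\<close> ne] by blast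
      then show False using that by simp
    qed
    then have "closure Da \<subseteq> closure (inside X)" by (rule closure_mono)
    then have "Y \<subseteq> inside X \<union> X" using that unfolding frontier_def by (auto simp: interior_open)
    then show False using that(6,7) by blast
  qed
  have xp: "x \<noteq> p" using arc_distinct_ends[OF arcs(1)] st fi by simp
  have inter: "\<exists>z \<in> path_image q. z \<noteq> x \<and> z \<noteq> p" if "arc q" "pathstart q = x" "pathfinish q = p" for q
    using nonempty_simple_path_endless[of q] that by (auto simp: arc_imp_simple_path)
  have no: "path_image q \<inter> inside X = {} \<and> path_image r \<inter> inside X = {}" if "X = path_image q \<union> path_image r" for q r X
    using inside_no_overlap[of X] that by blast
  have n12: "\<not> path_image p1 \<union> path_image p2 \<subseteq> path_image p1 \<union> path_image p3"
    using inter[of p2] assms by blast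
  have n23: "\<not> path_image p2 \<union> path_image p3 \<subseteq> path_image p1 \<union> path_image p2"
    using inter[of p3] assms by blast
  have n23': "\<not> path_image p2 \<union> path_image p3 \<subseteq> path_image p1 \<union> path_image p3"
    using inter[of p2] assms by blast
  have d1: "?D12 \<inter> ?D13 = {}"
    apply (rule sub[OF j12(2,4) j13(1,4) _ _ n12])
    using e3 e2 no[OF refl, of p1 p2] no[OF refl, of p1 p3] by blast+
  have d2: "?D23 \<inter> ?D12 = {}"
    apply (rule sub[OF j23(2,4) j12(1,4) _ _ n23])
    using e3 e1 no[OF refl, of p1 p2] no[OF refl, of p2 p3] by blast+
  have d3: "?D23 \<inter> ?D13 = {}"
    apply (rule sub[OF j23(2,4) j13(1,4) _ _ n23'])
    using e2 e1 no[OF refl, of p1 p3] no[OF refl, of p2 p3] by blast+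
  let ?S = "closure ?D12" and ?T = "closure ?D13"
  have S: "?S = ?D12 \<union> (path_image p1 \<union> path_image p2)" using closure_Un_frontier[of ?D12] j12(4) by simp
  have T: "?T = ?D13 \<union> (path_image p1 \<union> path_image p3)" using closure_Un_frontier[of ?D13] j13(4) by simp
  have ST: "?S \<inter> ?T = path_image p1"
  proof -
    have "path_image p2 \<inter> path_image p3 \<subseteq> path_image p1" using I23 I12 by auto
    then show ?thesis unfolding S T using d1 e2 e3 no[OF refl, of p1 p2] no[OF refl, of p1 p3] by auto
  qed
  obtain a where a: "a \<in> ?D23" using j23 by blast
  have "bounded (?S \<union> ?T \<union> (path_image p2 \<union> path_image p3) \<union> ?D23)"
    using j12(3) j13(3) j23(3) arcs(2,3) by (simp add: bounded_closure bounded_arc_image)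
  then obtain b where b: "b \<notin> ?S \<union> ?T \<union> (path_image p2 \<union> path_image p3) \<union> ?D23"
    by (metis UNIV_eq_I not_bounded_UNIV)
  have cS: "- ?S = outside (path_image p1 \<union> path_image p2)"
    unfolding S outside_inside by (simp add: Un_commute)
  have cT: "- ?T = outside (path_image p1 \<union> path_image p3)"
    unfolding T outside_inside by (simp add: Un_commute)
  have aS: "a \<in> - ?S" unfolding S using a d2 e1 no[OF refl, of p2 p3] by blast
  have aT: "a \<in> - ?T" unfolding T using a d3 e1 no[OF refl, of p2 p3] by blast
  have "connected_component (- (?S \<union> ?T)) a b"
  proof (rule Janiszewski_plane)
    show "connected (?S \<inter> ?T)" unfolding ST using connected_arc_image arcs by blast
    show "compact ?S" using j12 by (simp add: compact_closure)
    show "connected_component (- ?S) a b" using j12(5) aS b cS by (metis ComplI UnI1 connected_iff_connected_component)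
    show "connected_component (- ?T) a b" using j13(5) aT b cT by (metis ComplI UnCI connected_iff_connected_component)
  qed simp
  then obtain U where U: "connected U" "U \<subseteq> - (?S \<union> ?T)" "a \<in> U" "b \<in> U"
    unfolding connected_component_def by blast
  have "U \<inter> frontier ?D23 \<noteq> {}"
    by (rule connected_Int_frontier) (use U a b in auto)
  then show False using U(2) unfolding j23(4) S T by blast
qed

section \<open>Limits, components and sizes of continua\<close>

definition hausdorff_limit :: "(nat \<Rightarrow> 'a::metric_space set) \<Rightarrow> 'a set \<Rightarrow> bool" where
  "hausdorff_limit C K \<longleftrightarrow>
     (\<forall>k\<in>K. \<forall>e>0. \<forall>\<^sub>F n in sequentially. C n \<inter> ball k e \<noteq> {}) \<and>
     (\<forall>U. open U \<longrightarrow> K \<subseteq> U \<longrightarrow> (\<forall>\<^sub>F n in sequentially. C n \<subseteq> U))"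

text \<open>The distance functions to the sets \<open>C n\<close> are bounded and 1-Lipschitz on
  \<open>S\<close>, so Arzela-Ascoli gives a uniformly convergent subsequence; \<open>K\<close> is
  the zero set of its limit. A splitting of \<open>K\<close> by disjoint open sets would split the
  connected sets \<open>C n\<close> for large \<open>n\<close>.\<close>

lemma continuum_limit:
  fixes C :: "nat \<Rightarrow> 'a::euclidean_space set"
  assumes S: "compact S" and C: "\<And>n. connected (C n)" "\<And>n. C n \<noteq> {}" "\<And>n. C n \<subseteq> S"
  obtains K r where "strict_mono (r::nat\<Rightarrow>nat)" "compact K" "connected K" "K \<subseteq> S"
    "hausdorff_limit (\<lambda>n. C (r n)) K"
proof -
  obtain M where M: "\<And>x y. x \<in> S \<Longrightarrow> y \<in> S \<Longrightarrow> dist x y \<le> M"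
    using bounded_two_points compact_imp_bounded[OF S] by metis
  have nm: "norm (infdist x (C n)) \<le> M" if "x \<in> S" for n x
  proof -
    obtain c where "c \<in> C n" using C(2) by blast
    then show ?thesis using infdist_le[of c "C n" x] M[OF that, of c] C(3)[of n] infdist_nonneg[of x "C n"]
      by auto
  qed
  have eq: "\<exists>d. 0 < d \<and> (\<forall>n y. y \<in> S \<and> norm(x - y) < d \<longrightarrow> norm(infdist x (C n) - infdist y (C n)) < e)"
    if "e > 0" for x e
    using that by (intro exI[of _ e]) (auto simp: dist_norm[symmetric] intro: le_less_trans[OF infdist_triangle_abs])
  obtain g k where gk: "continuous_on S g" "strict_mono (k :: nat \<Rightarrow> nat)"
         "\<And>e. 0 < e \<Longrightarrow> \<exists>N. \<forall>n x. n \<ge> N \<and> x \<in> S \<longrightarrow> norm(infdist x (C (k n)) - g x) < e"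
    using Arzela_Ascoli[OF S, of "\<lambda>n x. infdist x (C n)", OF nm eq] by metis
  define K where "K = {x \<in> S. g x = 0}"
  have K: "compact K" unfolding K_def
    using continuous_closed_preimage_constant[OF gk(1) compact_imp_closed[OF S], of 0] S
      compact_Int_closed[of S "{x \<in> S. g x = 0}"] by (simp add: Int_def conj_commute)
  have g0: "g x \<ge> 0" if xS: "x \<in> S" for x
  proof (rule ccontr)
    assume "\<not> 0 \<le> g x"
    then obtain N where "norm(infdist x (C (k N)) - g x) < - g x"
      using gk(3)[of "- g x"] xS by (metis neg_0_less_iff_less not_le order_refl)
    then show False using infdist_nonneg[of x "C (k N)"] by simp
  qed
  have near: "eventually (\<lambda>n. C (k n) \<inter> ball x e \<noteq> {}) sequentially" if "x \<in> K" "e > 0" for x e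
  proof -
    obtain N where N: "\<forall>n x. n \<ge> N \<and> x \<in> S \<longrightarrow> norm(infdist x (C (k n)) - g x) < e"
      using gk(3) \<open>e > 0\<close> by blast
    have "C (k n) \<inter> ball x e \<noteq> {}" if "n \<ge> N" for n
    proof -
      have "infdist x (C (k n)) < e" using N[rule_format, of n x] that \<open>x \<in> K\<close> unfolding K_def by auto
      then obtain c where "c \<in> C (k n)" "dist x c < e"
        using C(2) by (auto simp: infdist_def cInf_less_iff split: if_splits)
      then show ?thesis by auto
    qed
    then show ?thesis unfolding eventually_sequentially by blast
  qed
  have inside: "eventually (\<lambda>n. C (k n) \<subseteq> U) sequentially" if "open U" "K \<subseteq> U" for U
  proof (cases "S - U = {}")
    case True then show ?thesis using C(3) by (metis (mono_tags, lifting) Diff_eq_empty_iff always_eventually subset_trans)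
  next
    case False
    have "compact (S - U)" using S \<open>open U\<close> by (simp add: compact_diff)
    then obtain m where m: "m \<in> S - U" "\<And>y. y \<in> S - U \<Longrightarrow> g m \<le> g y"
      using continuous_attains_inf[of "S - U" g] False gk(1) continuous_on_subset by (metis Diff_subset)
    have "g m > 0" using m(1) that g0[of m] unfolding K_def by force
    then obtain N where N: "\<forall>n x. n \<ge> N \<and> x \<in> S \<longrightarrow> norm(infdist x (C (k n)) - g x) < g m"
      using gk(3) by blast
    have "C (k n) \<subseteq> U" if "n \<ge> N" for n
    proof
      fix c assume c: "c \<in> C (k n)"
      show "c \<in> U"
      proof (rule ccontr)
        assume "c \<notin> U"
        then have "c \<in> S - U" using c C(3) by blast
        then show False using m(2)[of c] N that c by fastforce
      qed
    qed
    then show ?thesis unfolding eventually_sequentially by blast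
  qed
  have "connected K"
    unfolding connected_closed_set[OF compact_imp_closed[OF K]]
  proof (rule notI, elim exE conjE)
    fix A B assume AB: "closed A" "closed B" "A \<noteq> {}" "B \<noteq> {}" "A \<union> B = K" "A \<inter> B = {}"
    obtain P Q where PQ: "open P" "open Q" "A \<subseteq> P" "B \<subseteq> Q" "P \<inter> Q = {}"
      using separation_normal[OF AB(1,2,6)] by metis
    obtain a b where ab: "a \<in> A" "b \<in> B" using AB by blast
    obtain ea where ea: "ea > 0" "ball a ea \<subseteq> P" using PQ ab open_contains_ball by (metis subsetD)
    obtain eb where eb: "eb > 0" "ball b eb \<subseteq> Q" using PQ ab open_contains_ball by (metis subsetD)
    have "eventually (\<lambda>n. C (k n) \<inter> ball a ea \<noteq> {} \<and> C (k n) \<inter> ball b eb \<noteq> {} \<and> C (k n) \<subseteq> P \<union> Q) sequentially"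
      using near[of a ea] near[of b eb] inside[of "P \<union> Q"] ab AB PQ ea eb
      by (auto intro!: eventually_conj)
    then obtain n where "C (k n) \<inter> ball a ea \<noteq> {}" "C (k n) \<inter> ball b eb \<noteq> {}" "C (k n) \<subseteq> P \<union> Q"
      using eventually_happens' sequentially_bot by blast
    then show False using connectedD[OF C(1) PQ(1,2), of "k n"] PQ(5) ea eb by blast
  qed
  moreover have "hausdorff_limit (\<lambda>n. C (k n)) K" unfolding hausdorff_limit_def using near inside by blast
  moreover have "K \<subseteq> S" unfolding K_def by blast
  ultimately show ?thesis using that[OF gk(2) K] by blast
qed

text \<open>\<open>S\<close> is divided into countably many classes \<open>W n d\<close>: radius
  above \<open>1 / Suc n\<close>, and \<open>v y\<close> close to a vector \<open>d\<close> of a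
  countable dense set. Two points of one class nearer than \<open>1 / Suc n\<close> would each lie
  strictly ahead of the other in direction \<open>d\<close>; so each class is uniformly
  discrete.\<close>

lemma countable_one_sided:
  fixes S :: "'a::euclidean_space set" and v :: "'a \<Rightarrow> 'a" and \<rho> :: "'a \<Rightarrow> real"
  assumes rho: "\<And>y. y \<in> S \<Longrightarrow> \<rho> y > 0"
    and v: "\<And>y z. y \<in> S \<Longrightarrow> z \<in> S \<Longrightarrow> z \<noteq> y \<Longrightarrow> dist z y < \<rho> y \<Longrightarrow> v y \<bullet> (z - y) > norm (z - y) / 2"
  shows "countable S"
proof -
  obtain D :: "'a set" where D: "countable D" "\<And>X. open X \<Longrightarrow> X \<noteq> {} \<Longrightarrow> \<exists>d\<in>D. d \<in> X"
    using countable_dense_exists by metis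
  define W where "W n d = {y \<in> S. 1 / real (Suc n) < \<rho> y \<and> dist d (v y) < 1/4}" for n d
  have cW: "countable (W n d)" for n d
  proof -
    have sep: "dist z y \<ge> 1 / real (Suc n)" if "z \<in> W n d" "y \<in> W n d" "z \<noteq> y" for z y
    proof (rule ccontr)
      assume lt: "\<not> ?thesis"
      \<comment> \<open>Replacing \<open>v y'\<close> by \<open>d\<close> costs at most a quarter of
        the norm, out of the half that is available.\<close>
      have a: "d \<bullet> (z' - y') > norm (z' - y') / 4" if "z' \<in> W n d" "y' \<in> W n d" "z' \<noteq> y'" "dist z' y' < 1 / real (Suc n)" for z' y'
      proof -
        have "v y' \<bullet> (z' - y') > norm (z' - y') / 2" using v[of y' z'] that unfolding W_def by auto
        moreover have "\<bar>(d - v y') \<bullet> (z' - y')\<bar> \<le> norm (d - v y') * norm (z' - y')" by (rule Cauchy_Schwarz_ineq2)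
        moreover have "norm (d - v y') * norm (z' - y') \<le> 1/4 * norm (z' - y')"
          using that unfolding W_def by (intro mult_right_mono) (auto simp: dist_norm)
        ultimately show ?thesis by (simp add: inner_diff_left)
      qed
      have "d \<bullet> (z - y) > 0"
        using a[OF that] lt norm_ge_zero[of "z - y"] by linarith
      moreover have "d \<bullet> (y - z) > 0"
        using a[OF that(2,1) that(3)[symmetric]] lt norm_ge_zero[of "y - z"] dist_commute[of y z]
        by linarith
      ultimately show False by (simp add: inner_diff_right)
    qed
    have "\<exists>f. \<forall>y \<in> W n d. f y \<in> D \<and> dist (f y) y < 1 / (2 * real (Suc n))"
    proof (rule bchoice, rule ballI)
      fix y
      have "\<exists>d\<in>D. d \<in> ball y (1 / (2 * real (Suc n)))" by (rule D(2)) auto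
      then show "\<exists>x. x \<in> D \<and> dist x y < 1 / (2 * real (Suc n))" by (auto simp: dist_commute)
    qed
    then obtain f where f: "\<forall>y \<in> W n d. f y \<in> D \<and> dist (f y) y < 1 / (2 * real (Suc n))" by blast
    have "inj_on f (W n d)"
    proof (rule inj_onI, rule ccontr)
      fix y z assume yz: "y \<in> W n d" "z \<in> W n d" "f y = f z" "y \<noteq> z"
      have "dist y z < 1 / (2 * real (Suc n)) + 1 / (2 * real (Suc n))"
        using f yz dist_triangle2[of y z "f y"] by (smt (verit, best) dist_commute)
      also have "\<dots> = 1 / real (Suc n)" by (simp add: field_simps)
      finally show False using sep[of y z] yz by simp
    qed
    then show ?thesis using f D(1) by (metis countable_image_inj_on countable_subset image_subsetI)
  qed
  have "S \<subseteq> (\<Union>n. \<Union>d\<in>D. W n d)"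
  proof
    fix y assume y: "y \<in> S"
    obtain n where n: "1 / real (Suc n) < \<rho> y" using rho[OF y] nat_approx_posE by blast
    have "\<exists>d\<in>D. d \<in> ball (v y) (1/4)" by (rule D(2)) auto
    then show "y \<in> (\<Union>n. \<Union>d\<in>D. W n d)" using y n unfolding W_def by (auto simp: dist_commute)
  qed
  moreover have "countable (\<Union>n. \<Union>d\<in>D. W n d)" using cW D(1) by auto
  ultimately show ?thesis using countable_subset by blast
qed

text \<open>By the Sura-Bura theorem the component has a relatively open compact neighbourhood in
  \<open>K \<inter> cball x R\<close> inside the open ball; staying off the sphere makes it
  relatively open in all of \<open>K\<close>.\<close>

lemma component_clopen_part:
  fixes K :: "'a::euclidean_space set"
  assumes K: "closed K" and C: "C \<in> components (K \<inter> cball x R)" and d: "C \<inter> sphere x R = {}"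
  obtains L where "compact L" "C \<subseteq> L" "L \<subseteq> K" "closed (K - L)" "L \<subseteq> ball x R"
proof -
  have S: "compact (K \<inter> cball x R)" using K by (simp add: closed_Int_compact)
  have CS: "C \<subseteq> K \<inter> cball x R" using C by (rule in_components_subset)
  have Cb: "C \<subseteq> ball x R" using CS d by (force simp: less_le)
  have lc: "locally compact (K \<inter> cball x R)" using S compact_imp_closed closed_imp_locally_compact by blast
  obtain L where L: "openin (top_of_set (K \<inter> cball x R)) L" "compact L" "C \<subseteq> L" "L \<subseteq> ball x R"
    using Sura_Bura_clopen_subset[OF lc C compact_components[OF S C] open_ball Cb] by blast
  obtain V where V: "open V" "L = K \<inter> cball x R \<inter> V" using L(1) by (auto simp: openin_open)
  have "L = K \<inter> (V \<inter> ball x R)" using V L(4) by auto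
  then have eq: "K - L = K \<inter> - (V \<inter> ball x R)" by auto
  have "closed (K - L)" unfolding eq using K V by (intro closed_Int) auto
  then show ?thesis using that L V by blast
qed

text \<open>An arc inside the path is cut at its first time \<open>t2\<close> in \<open>X2\<close>
  and at the last time \<open>t1\<close> before \<open>t2\<close> in \<open>X1\<close>.\<close>

lemma arc_between_closed:
  fixes g :: "real \<Rightarrow> 'a::{complete_space,real_normed_vector}"
  assumes "path g" "pathstart g \<in> X1" "pathfinish g \<in> X2" and cl: "closed X1" "closed X2"
    and d: "path_image g \<inter> X1 \<inter> X2 = {}"
  obtains h where "arc h" "path_image h \<subseteq> path_image g" "pathstart h \<in> X1" "pathfinish h \<in> X2"
    "path_image h \<inter> X1 = {pathstart h}" "path_image h \<inter> X2 = {pathfinish h}"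
proof -
  have "pathstart g \<noteq> pathfinish g" using assms by (metis IntI empty_iff pathstart_in_path_image)
  then obtain q where q: "arc q" "path_image q \<subseteq> path_image g" "pathstart q \<in> X1" "pathfinish q \<in> X2"
    using path_contains_arc[OF assms(1) refl refl] assms(2,3) by metis
  have cq: "continuous_on {0..1} q" using q(1) by (simp add: arc_def path_def)
  define T2 where "T2 = {t\<in>{0..1}. q t \<in> X2}"
  have "T2 = {0..1} \<inter> q -` X2" by (auto simp: T2_def)
  then have "compact T2" "1 \<in> T2"
    using continuous_closed_preimage[OF cq _ cl(2)] q(4) compact_Int_closed[of "{0..1}" T2]
    by (auto simp: pathfinish_def)
  then obtain t2 where t2: "t2 \<in> T2" "\<And>t. t \<in> T2 \<Longrightarrow> t2 \<le> t"
    using compact_attains_inf[of T2] by blast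
  define T1 where "T1 = {t\<in>{0..t2}. q t \<in> X1}"
  have "continuous_on {0..t2} q" using cq t2(1) continuous_on_subset unfolding T2_def by fastforce
  moreover have "T1 = {0..t2} \<inter> q -` X1" by (auto simp: T1_def)
  ultimately have "compact T1" "0 \<in> T1"
    using continuous_closed_preimage[OF _ _ cl(1), of "{0..t2}" q] q(3) t2(1) compact_Int_closed[of "{0..t2}" T1]
    by (auto simp: pathstart_def T2_def)
  then obtain t1 where t1: "t1 \<in> T1" "\<And>t. t \<in> T1 \<Longrightarrow> t \<le> t1"
    using compact_attains_sup[of T1] by blast
  have m: "t1 \<in> {0..1}" "t2 \<in> {0..1}" "t1 \<le> t2" "q t1 \<in> X1" "q t2 \<in> X2" using t1 t2 by (auto simp: T1_def T2_def)
  have "q t1 \<in> path_image g" using q(2) m unfolding path_image_def by blast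
  then have ne: "t1 \<noteq> t2" using m d by blast
  let ?h = "subpath t1 t2 q"
  have pi: "path_image ?h = q ` {t1..t2}" using m by (simp add: path_image_subpath)
  have ends: "pathstart ?h = q t1" "pathfinish ?h = q t2" by (simp_all add: pathstart_def pathfinish_def subpath_def)
  have mm: "t1 \<in> {t1..t2}" "t2 \<in> {t1..t2}" using m by auto
  have i1: "t = t1" if "t \<in> {t1..t2}" "q t \<in> X1" for t using t1(2)[of t] that m by (auto simp: T1_def)
  have i2: "t = t2" if "t \<in> {t1..t2}" "q t \<in> X2" for t using t2(2)[of t] that m by (auto simp: T2_def)
  show ?thesis
  proof (rule that)
    show "arc ?h" using arc_subpath_arc[OF q(1) m(1,2) ne] .
    show "path_image ?h \<subseteq> path_image g" using path_image_subpath_subset[OF m(1,2), of q] q(2) by blast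
    show "path_image ?h \<inter> X1 = {pathstart ?h}"
      unfolding pi ends using i1 m(4) mm(1) by blast
    show "path_image ?h \<inter> X2 = {pathfinish ?h}"
      unfolding pi ends using i2 m(5) mm(2) by blast
  qed (use ends m in auto)
qed

text \<open>If open sets \<open>P\<close> and \<open>Q\<close> split the intersection, compactness
  and directedness place a single member of the family in \<open>P \<union> Q\<close>, and that
  member would be split as well.\<close>

lemma connected_Inter_directed:
  fixes \<K> :: "'a::euclidean_space set set"
  assumes K: "\<And>K. K \<in> \<K> \<Longrightarrow> compact K \<and> connected K" and ne: "\<K> \<noteq> {}"
    and dir: "\<And>K L. K \<in> \<K> \<Longrightarrow> L \<in> \<K> \<Longrightarrow> K \<inter> L \<in> \<K>"
  shows "connected (\<Inter>\<K>)"
proof -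
  have cl: "closed (\<Inter>\<K>)" using K compact_imp_closed by blast
  obtain K0 where K0: "K0 \<in> \<K>" using ne by blast
  have fin: "K0 \<inter> \<Inter>F \<in> \<K>" if "finite F" "F \<subseteq> \<K>" for F
    using that
  proof (induction F)
    case (insert L F)
    then have "L \<inter> (K0 \<inter> \<Inter>F) \<in> \<K>" using dir by blast
    moreover have "L \<inter> (K0 \<inter> \<Inter>F) = K0 \<inter> \<Inter>(insert L F)" by auto
    ultimately show ?case by simp
  qed (use K0 in simp)
  show ?thesis
    unfolding connected_closed_set[OF cl]
  proof (rule notI, elim exE conjE)
    fix A B assume AB: "closed A" "closed B" "A \<noteq> {}" "B \<noteq> {}" "A \<union> B = \<Inter>\<K>" "A \<inter> B = {}"
    obtain P Q where PQ: "open P" "open Q" "A \<subseteq> P" "B \<subseteq> Q" "P \<inter> Q = {}"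
      using separation_normal[OF AB(1,2,6)] by metis
    have "\<exists>K\<in>\<K>. K \<subseteq> P \<union> Q"
    proof (rule ccontr)
      assume neg: "\<not> ?thesis"
      have "(K0 - (P \<union> Q)) \<inter> \<Inter>\<K> \<noteq> {}"
      proof (rule compact_imp_fip)
        show "compact (K0 - (P \<union> Q))" using K[OF K0] PQ by (simp add: compact_diff open_Un)
        show "closed T" if "T \<in> \<K>" for T using that K compact_imp_closed by blast
        show "(K0 - (P \<union> Q)) \<inter> \<Inter>F' \<noteq> {}" if "finite F'" "F' \<subseteq> \<K>" for F'
        proof -
          have "\<not> K0 \<inter> \<Inter>F' \<subseteq> P \<union> Q" using fin[OF that] neg by blast
          then show ?thesis by blast
        qed
      qed
      then show False using AB(5) PQ by blast
    qed
    then obtain K where "K \<in> \<K>" "K \<subseteq> P \<union> Q" by blast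
    moreover have "A \<subseteq> K" "B \<subseteq> K" using AB(5) \<open>K \<in> \<K>\<close> by blast+
    ultimately show False using connectedD[of K P Q] K PQ AB by blast
  qed
qed

text \<open>The map is the sum of \<open>(1/2)^n * (1 - min 1 (infdist (p n) K))\<close> over a
  dense sequence \<open>p\<close>. A \<open>p n\<close> close to a point of \<open>L - K\<close>
  makes it strictly monotone. Sets within \<open>e\<close> of each other have distance functions
  differing by at most \<open>e\<close>, and the weights add up to 2.\<close>

lemma whitney_map_exists:
  "\<exists>w :: 'a::euclidean_space set \<Rightarrow> real.
     (\<forall>K L. closed K \<longrightarrow> K \<noteq> {} \<longrightarrow> K \<subset> L \<longrightarrow> w K < w L) \<and>
     (\<forall>K L e. K \<noteq> {} \<longrightarrow> L \<noteq> {} \<longrightarrow> (\<forall>k\<in>K. \<exists>l\<in>L. dist k l \<le> e) \<longrightarrow> (\<forall>l\<in>L. \<exists>k\<in>K. dist k l \<le> e) \<longrightarrow> \<bar>w K - w L\<bar> \<le> 2 * e)"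
proof -
  obtain D :: "'a set" where D: "countable D" "\<And>X. open X \<Longrightarrow> X \<noteq> {} \<Longrightarrow> \<exists>d\<in>D. d \<in> X"
    using countable_dense_exists by metis
  have "D \<noteq> {}" using D(2)[of UNIV] by auto
  define p where "p = from_nat_into D"
  have p: "\<exists>n. p n \<in> X" if "open X" "X \<noteq> {}" for X
    using D(2)[OF that] from_nat_into_surj[OF D(1)] unfolding p_def by metis
  define m where "m K n = (1/2::real)^n * (1 - min 1 (infdist (p n) K))" for K n
  define w where "w K = (\<Sum>n. m K n)" for K
  have m0: "0 \<le> m K n" "m K n \<le> (1/2)^n" for K n
    using infdist_nonneg[of "p n" K] unfolding m_def by (auto simp: mult_left_le)
  have geo: "summable (\<lambda>n. (1/2::real)^n)" "(\<Sum>n. (1/2::real)^n) = 2"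
    using summable_geometric[of "1/2::real"] suminf_geometric[of "1/2::real"] by auto
  have sm: "summable (m K)" for K
    by (rule summable_comparison_test[OF _ geo(1)]) (use m0[of K] in auto)
  have strict: "w K < w L" if KL: "closed K" "K \<noteq> {}" "K \<subset> L" for K L
  proof -
    have mono: "m K n \<le> m L n" for n
      using infdist_mono[of K L "p n"] KL unfolding m_def by (auto intro!: mult_left_mono)
    obtain v where v: "v \<in> L" "v \<notin> K" using KL by blast
    define e where "e = infdist v K"
    have e: "e > 0" unfolding e_def using v KL by (simp add: infdist_pos_not_in_closed)
    \<comment> \<open>A third of \<open>min e 1\<close> leaves \<open>p n\<close> nearer to
      \<open>L\<close> than to \<open>K\<close>, and its distance to \<open>L\<close> below 1, so
      that the truncation at 1 does not hide the difference.\<close>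
    have "open (ball v (min e 1 / 3))" "ball v (min e 1 / 3) \<noteq> {}" using e by auto
    then obtain n where "p n \<in> ball v (min e 1 / 3)" using p by blast
    then have n: "dist v (p n) < min e 1 / 3" by simp
    have "infdist (p n) L \<le> dist (p n) v" using infdist_le[OF v(1)] .
    moreover have "e - dist v (p n) \<le> infdist (p n) K"
      using infdist_triangle_abs[of v K "p n"] unfolding e_def by linarith
    ultimately have "min 1 (infdist (p n) L) < min 1 (infdist (p n) K)"
      using n e by (auto simp: dist_commute min_def split: if_splits)
    then have "m K n < m L n" unfolding m_def by simp
    then have "0 < (\<Sum>n. m L n - m K n)"
      using mono by (intro suminf_pos2[of _ n] summable_diff sm) auto
    then show ?thesis unfolding w_def using suminf_diff[OF sm sm, of L K] by simp
  qed
  have half: "w K - w L \<le> 2 * e" if KL: "K \<noteq> {}" "L \<noteq> {}" "\<forall>k\<in>K. \<exists>l\<in>L. dist k l \<le> e" for K L e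
  proof -
    have i: "infdist (p n) L - e \<le> infdist (p n) K" for n
    proof -
      have "infdist (p n) L - e \<le> dist (p n) k" if kK: "k \<in> K" for k
      proof -
        obtain l where "l \<in> L" "dist k l \<le> e" using KL(3) kK by blast
        then show ?thesis using infdist_le[of l L "p n"] dist_triangle[of "p n" l k] by linarith
      qed
      then have "infdist (p n) L - e \<le> (INF a\<in>K. dist (p n) a)" using KL(1) by (intro cINF_greatest)
      then show ?thesis using KL(1) by (simp add: infdist_def)
    qed
    have e0: "e \<ge> 0" using KL by (meson all_not_in_conv dual_order.trans zero_le_dist)
    have "m K n - m L n \<le> e * (1/2)^n" for n
    proof -
      have "min 1 (infdist (p n) L) - min 1 (infdist (p n) K) \<le> e" using i[of n] e0 by auto
      then have "(1/2)^n * (min 1 (infdist (p n) L) - min 1 (infdist (p n) K)) \<le> (1/2)^n * e"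
        by (intro mult_left_mono) auto
      then show ?thesis unfolding m_def by (simp add: algebra_simps)
    qed
    then have "(\<Sum>n. m K n - m L n) \<le> (\<Sum>n. e * (1/2)^n)"
      by (intro suminf_le summable_diff sm summable_mult geo) auto
    then show ?thesis unfolding w_def using suminf_diff[OF sm sm, of K L] suminf_mult[OF geo(1), of e] geo(2) by simp
  qed
  have "\<bar>w K - w L\<bar> \<le> 2 * e" if "K \<noteq> {}" "L \<noteq> {}" "\<forall>k\<in>K. \<exists>l\<in>L. dist k l \<le> e" "\<forall>l\<in>L. \<exists>k\<in>K. dist k l \<le> e" for K L e
    using half[OF that(1,2,3)] half[OF that(2,1), of e] that(4) by (auto simp: dist_commute)
  then show ?thesis using strict by blast
qed

section \<open>Coordinates along a unit normal and the tangent obtained from it by a quarter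
  turn\<close>

definition rot :: "real^2 \<Rightarrow> real^2" where "rot a = vector [- a$2, a$1]"

lemma rot_simps [simp]: "rot a $ 1 = - a $ 2" "rot a $ 2 = a $ 1"
  by (simp_all add: rot_def)

lemma inner_plane: "a \<bullet> b = a$1 * b$1 + a$2 * b$2" for a b :: "real^2"
  by (simp add: inner_vec_def sum_2)

lemma inner_rot [simp]: "a \<bullet> rot a = 0" "rot a \<bullet> a = 0" "norm (rot a) = norm a"
  by (simp_all add: inner_plane norm_eq_sqrt_inner)

lemma plane_decomp:
  assumes "norm a = 1" shows "h = (a \<bullet> h) *\<^sub>R a + (rot a \<bullet> h) *\<^sub>R rot a"
proof -
  have 1: "a$1 * a$1 + a$2 * a$2 = 1"
    using assms by (metis inner_plane norm_eq_1)
  have "h$1 = (a \<bullet> h) * a$1 - (rot a \<bullet> h) * a$2"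
    using arg_cong[OF 1, of "\<lambda>x. h$1 * x"] by (simp add: inner_plane algebra_simps)
  moreover have "h$2 = (a \<bullet> h) * a$2 + (rot a \<bullet> h) * a$1"
    using arg_cong[OF 1, of "\<lambda>x. h$2 * x"] by (simp add: inner_plane algebra_simps)
  ultimately show ?thesis by (simp add: vec_eq_iff forall_2)
qed

lemma plane_norm_decomp:
  assumes "norm a = 1" shows "(norm h)^2 = (a \<bullet> h)^2 + (rot a \<bullet> h)^2"
proof -
  have "(norm h)^2 = h \<bullet> ((a \<bullet> h) *\<^sub>R a + (rot a \<bullet> h) *\<^sub>R rot a)"
    using plane_decomp[OF assms, of h] by (metis power2_norm_eq_inner)
  then show ?thesis by (simp add: inner_add_right inner_commute power2_eq_square)
qed

section \<open>Level sets without critical points\<close>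

text \<open>\<open>F\<close> stands for \<open>f - c\<close> and \<open>u\<close> for the normalised
  gradient. By \<open>cone\<close>, near a zero \<open>x\<close> the sign of
  \<open>F (x + h)\<close> is that of \<open>u x \<bullet> h\<close> outside any thin double cone
  around the tangent line; \<open>\<delta>\<close> depends on \<open>x\<close>. The hypotheses are
  symmetric under a change of sign.\<close>

locale level =
  fixes F :: "real^2 \<Rightarrow> real" and u :: "real^2 \<Rightarrow> real^2"
  assumes cont: "continuous_on UNIV F"
    and no_max: "0 < e \<Longrightarrow> \<exists>y. dist y x < e \<and> F y > F x"
    and no_min: "0 < e \<Longrightarrow> \<exists>y. dist y x < e \<and> F y < F x"
    and norm_u: "F x = 0 \<Longrightarrow> norm (u x) = 1"
    and cone: "F x = 0 \<Longrightarrow> 0 < \<epsilon> \<Longrightarrow> \<exists>\<delta>>0. \<forall>h. h \<noteq> 0 \<longrightarrow> norm h < \<delta> \<longrightarrow>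
        (\<epsilon> * norm h \<le> u x \<bullet> h \<longrightarrow> F (x + h) > 0) \<and> (u x \<bullet> h \<le> - \<epsilon> * norm h \<longrightarrow> F (x + h) < 0)"

lemma level_uminus:
  assumes "level F u" shows "level (\<lambda>x. - F x) (\<lambda>x. - u x)"
proof -
  interpret level F u by fact
  show ?thesis
  proof
    show "continuous_on UNIV (\<lambda>x. - F x)" using cont continuous_on_minus by blast
    show "\<exists>\<delta>>0. \<forall>h. h \<noteq> 0 \<longrightarrow> norm h < \<delta> \<longrightarrow>
        (\<epsilon> * norm h \<le> - u x \<bullet> h \<longrightarrow> - F (x + h) > 0) \<and> (- u x \<bullet> h \<le> - \<epsilon> * norm h \<longrightarrow> - F (x + h) < 0)"
      if "- F x = 0" "\<epsilon> > 0" for x \<epsilon>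
    proof -
      have "F x = 0" using that by simp
      from cone[OF this that(2)] obtain \<delta> where \<delta>: "\<delta> > 0" "\<forall>h. h \<noteq> 0 \<longrightarrow> norm h < \<delta> \<longrightarrow>
        (\<epsilon> * norm h \<le> u x \<bullet> h \<longrightarrow> F (x + h) > 0) \<and> (u x \<bullet> h \<le> - \<epsilon> * norm h \<longrightarrow> F (x + h) < 0)" by blast
      then show ?thesis by (intro exI[of _ \<delta>]) (auto simp: inner_minus_left)
    qed
  qed (use no_max no_min norm_u in auto)
qed

context level
begin

definition "Z = {x. F x = 0}"

lemma in_Z [simp]: "x \<in> Z \<longleftrightarrow> F x = 0" by (simp add: Z_def)

lemma closed_Z: "closed Z"
  unfolding Z_def by (rule closed_Collect_eq) (use cont in auto)

lemma compact_Z_cball: "compact (Z \<inter> cball x R)"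
  using closed_Z by (simp add: closed_Int_compact)

lemma sign_connected:
  assumes "connected U" "U \<inter> Z = {}" "p \<in> U" "q \<in> U" "F p > 0" shows "F q > 0"
proof (rule ccontr)
  assume "\<not> F q > 0"
  have "connected (F ` U)" using assms(1) cont continuous_on_subset connected_continuous_image by blast
  then have "0 \<in> F ` U" using connectedD_interval[of "F ` U" "F q" "F p" 0] assms \<open>\<not> F q > 0\<close> by auto
  then show False using assms(2) by auto
qed

text \<open>\<open>F\<close> attains its minimum over the closure of \<open>W\<close>. If this
  happens on the frontier, the minimum is at least 0, so \<open>p\<close> is a minimum point too.
  Either way there is a local minimum inside \<open>W\<close>.\<close>

lemma extremum_pos:
  assumes "open W" "bounded W" "p \<in> W" "\<And>z. z \<in> frontier W \<Longrightarrow> F z \<ge> 0" "F p \<le> 0"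
  shows False
proof -
  have "compact (closure W)" using assms by (simp add: compact_closure)
  moreover have "continuous_on (closure W) F" using cont continuous_on_subset by blast
  ultimately obtain m where m: "m \<in> closure W" "\<And>y. y \<in> closure W \<Longrightarrow> F m \<le> F y"
    using continuous_attains_inf[of "closure W" F] assms(3) closure_subset by blast
  have "\<exists>n\<in>W. F n \<le> F m"
  proof (cases "m \<in> W")
    case False
    then have "m \<in> frontier W" using m(1) assms(1) by (simp add: frontier_def interior_open)
    then have "F p \<le> F m" using assms(4)[of m] assms(5) by linarith
    then show ?thesis using assms(3) by blast
  qed auto
  then obtain n where n: "n \<in> W" "F n \<le> F m" by blast
  then obtain e where "e > 0" "ball n e \<subseteq> W" using assms(1) open_contains_ball by blast
  moreover obtain y where "dist y n < e" "F y < F n" using no_min[of e n] \<open>e > 0\<close> by blast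
  ultimately have "y \<in> W" "F y < F n" by (auto simp: dist_commute subset_iff)
  then show False using m(2)[of y] n closure_subset by fastforce
qed

lemma neg: "level (\<lambda>x. - F x) (\<lambda>x. - u x)"
  by (rule level_uminus) unfold_locales

lemma extremum_neg:
  assumes "open W" "bounded W" "p \<in> W" "\<And>z. z \<in> frontier W \<Longrightarrow> F z \<le> 0" "F p \<ge> 0"
  shows False
  using level.extremum_pos[OF neg assms(1-3)] assms(4,5) by auto

text \<open>A bounded component of the complement would have its frontier in \<open>K\<close>, where
  \<open>F\<close> vanishes, and \<open>F\<close> would have an extremum in it.\<close>

lemma compact_nonseparating:
  assumes "compact K" "K \<subseteq> Z" shows "connected (- K)"
proof (rule ccontr)
  assume "\<not> connected (- K)"
  then obtain W where W: "W \<in> components (- K)" "bounded W"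
    using cobounded_has_bounded_component[of "- K"] compact_imp_bounded[OF assms(1)] by auto
  have oW: "open W" using W(1) assms(1) compact_imp_closed open_components by blast
  obtain p where p: "p \<in> W" using W(1) in_components_nonempty by blast
  obtain x where "W = connected_component_set (- K) x" using W(1) by (auto simp: components_def)
  then have "frontier W \<subseteq> frontier (- K)" using frontier_of_connected_component_subset by blast
  then have fr: "frontier W \<subseteq> Z"
    using assms frontier_subset_compact by (metis frontier_complement subset_trans)
  show False
  proof (cases "F p \<le> 0")
    case True show ?thesis by (rule extremum_pos[OF oW W(2) p _ True]) (use fr in auto)
  next
    case False then have "F p \<ge> 0" by simp
    show ?thesis by (rule extremum_neg[OF oW W(2) p _ \<open>F p \<ge> 0\<close>]) (use fr in auto)
  qed
qed

lemma connected_Int_continua: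
  assumes "compact K" "connected K" "K \<subseteq> Z" "compact L" "connected L" "L \<subseteq> Z"
  shows "connected (K \<inter> L)"
  using assms by (intro Janiszewski_dual_plane compact_nonseparating) auto

lemma normal_signs:
  assumes "F y = 0"
  obtains \<delta> where "\<delta> > 0" "\<And>t. 0 < t \<Longrightarrow> t < \<delta> \<Longrightarrow> F (y + t *\<^sub>R u y) > 0 \<and> F (y - t *\<^sub>R u y) < 0"
proof -
  \<comment> \<open>With parameter 1 the cone conditions are equality cases of Cauchy-Schwarz: they
    hold precisely along the normal line.\<close>
  obtain \<delta> where \<delta>: "\<delta>>0" "\<forall>h. h \<noteq> 0 \<longrightarrow> norm h < \<delta> \<longrightarrow>
        (1 * norm h \<le> u y \<bullet> h \<longrightarrow> F (y + h) > 0) \<and> (u y \<bullet> h \<le> - 1 * norm h \<longrightarrow> F (y + h) < 0)"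
    using cone[OF assms, of 1] by auto
  have n: "norm (u y) = 1" "u y \<bullet> u y = 1" using norm_u[OF assms] by (auto simp: norm_eq_1)
  then have "u y \<noteq> 0" by auto
  have "F (y + t *\<^sub>R u y) > 0 \<and> F (y - t *\<^sub>R u y) < 0" if t: "0 < t" "t < \<delta>" for t
    using \<delta>(2)[rule_format, of "t *\<^sub>R u y"] \<delta>(2)[rule_format, of "- (t *\<^sub>R u y)"] t n \<open>u y \<noteq> 0\<close> by auto
  then show ?thesis using that \<delta>(1) by blast
qed

text \<open>The compact set \<open>K\<close> and the closed set \<open>Z - K\<close> separate the plane together,
  but neither does so alone near a point of \<open>K\<close>.\<close>

lemma no_compact_clopen:
  assumes "compact K" "K \<noteq> {}" "K \<subseteq> Z" "closed (Z - K)"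
  shows False
proof -
  obtain y where y: "y \<in> K" using assms by blast
  then have Fy: "F y = 0" using assms by auto
  obtain e where e: "e > 0" "ball y e \<inter> (Z - K) = {}"
    using y assms(4) open_contains_ball[of "- (Z - K)"] by blast
  obtain \<delta> where \<delta>: "\<delta> > 0" "\<And>t. 0 < t \<Longrightarrow> t < \<delta> \<Longrightarrow> F (y + t *\<^sub>R u y) > 0 \<and> F (y - t *\<^sub>R u y) < 0"
    using normal_signs[OF Fy] by blast
  define t where "t = min e \<delta> / 2"
  have t: "0 < t" "t < e" "t < \<delta>" using e \<delta> unfolding t_def by auto
  let ?p = "y + t *\<^sub>R u y" and ?q = "y - t *\<^sub>R u y"
  have s: "F ?p > 0" "F ?q < 0" using \<delta>(2)[OF t(1,3)] by auto
  have "connected_component (- (K \<union> (Z - K))) ?p ?q"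
  proof (rule Janiszewski_plane[OF assms(1,4)])
    show "connected_component (- K) ?p ?q"
      using compact_nonseparating[OF assms(1,3)] s assms(3) by (force simp: connected_iff_connected_component)
    have "?p \<in> ball y e" "?q \<in> ball y e" using t norm_u[OF Fy] by (auto simp: dist_norm)
    then show "connected_component (- (Z - K)) ?p ?q"
      unfolding connected_component_def using e(2) by (intro exI[of _ "ball y e"]) auto
  qed auto
  then obtain U where "connected U" "U \<subseteq> - (K \<union> (Z - K))" "?p \<in> U" "?q \<in> U"
    unfolding connected_component_def by blast
  then show False using sign_connected[of U ?p ?q] s assms(3) by auto
qed

text \<open>Boundary bumping: a component staying off the sphere would yield a compact relatively
  open part of \<open>Z\<close>.\<close>

lemma component_meets_sphere:
  assumes "C \<in> components (Z \<inter> cball x R)" shows "C \<inter> sphere x R \<noteq> {}"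
proof
  assume d: "C \<inter> sphere x R = {}"
  obtain L where L: "compact L" "C \<subseteq> L" "L \<subseteq> Z" "closed (Z - L)"
    using component_clopen_part[OF closed_Z assms d] by metis
  have "C \<noteq> {}" using assms in_components_nonempty by blast
  then show False using no_compact_clopen[OF L(1) _ L(3,4)] L(2) by blast
qed

text \<open>If there were no such zero, a half disc at \<open>y\<close> on the side of
  \<open>v\<close> would be a connected set off \<open>Z\<close>, although it contains points close
  to the positive and to the negative normal.\<close>

lemma two_sided:
  assumes Fy: "F y = 0" and v: "v \<bullet> u y = 0" "norm v = 1" and e: "e > 0"
  shows "\<exists>z. F z = 0 \<and> dist z y < e \<and> v \<bullet> (z - y) > 0"
proof (rule ccontr)
  assume neg: "\<not> ?thesis"
  obtain \<delta> where \<delta>: "\<delta>>0" "\<forall>h. h \<noteq> 0 \<longrightarrow> norm h < \<delta> \<longrightarrow>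
        (1/2 * norm h \<le> u y \<bullet> h \<longrightarrow> F (y + h) > 0) \<and> (u y \<bullet> h \<le> - (1/2) * norm h \<longrightarrow> F (y + h) < 0)"
    using cone[OF Fy, of "1/2"] by auto
  define t where "t = min e \<delta> / 3"
  have t: "0 < t" "2 * t < e" "2 * t < \<delta>" using e \<delta> unfolding t_def by auto
  have un: "norm (u y) = 1" "u y \<bullet> u y = 1" "v \<bullet> v = 1" using norm_u[OF Fy] v by (auto simp: norm_eq_1)
  \<comment> \<open>The two diagonals between tangent and normals: their norms are at most
    \<open>2 * t\<close> and their normal components are \<open>t\<close> and \<open>- t\<close>,
    just enough for the cone with parameter 1/2.\<close>
  define h where "h = t *\<^sub>R (u y + v)"
  define k where "k = t *\<^sub>R (v - u y)"
  have uh: "u y \<bullet> h = t" "u y \<bullet> k = - t" "v \<bullet> h = t" "v \<bullet> k = t"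
    using un v by (auto simp: h_def k_def inner_add_right inner_diff_right inner_commute)
  have n2: "norm h \<le> 2 * t" "norm k \<le> 2 * t"
    using t norm_triangle_ineq[of "u y" v] norm_triangle_ineq4[of v "u y"] un v by (auto simp: h_def k_def)
  have "h \<noteq> 0" "k \<noteq> 0" using uh t by auto
  moreover have "norm h < \<delta>" "norm k < \<delta>" "1/2 * norm h \<le> u y \<bullet> h" "u y \<bullet> k \<le> - (1/2) * norm k"
    using n2 t uh by auto
  ultimately have s: "F (y + h) > 0" "F (y + k) < 0"
    using \<delta>(2) by blast+
  define U where "U = ball y e \<inter> {z. v \<bullet> z > v \<bullet> y}"
  have "connected U" unfolding U_def by (intro convex_connected convex_Int convex_ball convex_halfspace_gt)
  moreover have "U \<inter> Z = {}" using neg unfolding U_def by (auto simp: dist_commute inner_diff_right)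
  moreover have "y + h \<in> U" "y + k \<in> U" using n2 t uh unfolding U_def by (auto simp: dist_norm inner_add_right)
  ultimately show False using sign_connected[of U "y + h" "y + k"] s by auto
qed

lemma tangent_cone:
  assumes "F y = 0" "\<epsilon> > 0"
  obtains r where "r > 0" "\<And>z. F z = 0 \<Longrightarrow> z \<noteq> y \<Longrightarrow> dist z y < r \<Longrightarrow> \<bar>u y \<bullet> (z - y)\<bar> < \<epsilon> * norm (z - y)"
proof -
  obtain \<delta> where \<delta>: "\<delta>>0" "\<forall>h. h \<noteq> 0 \<longrightarrow> norm h < \<delta> \<longrightarrow>
        (\<epsilon> * norm h \<le> u y \<bullet> h \<longrightarrow> F (y + h) > 0) \<and> (u y \<bullet> h \<le> - \<epsilon> * norm h \<longrightarrow> F (y + h) < 0)"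
    using cone[OF assms] by auto
  have "\<bar>u y \<bullet> (z - y)\<bar> < \<epsilon> * norm (z - y)" if "F z = 0" "z \<noteq> y" "dist z y < \<delta>" for z
    using \<delta>(2)[rule_format, of "z - y"] that by (auto simp: dist_norm abs_less_iff not_le[symmetric])
  then show ?thesis using that \<delta>(1) by blast
qed

text \<open>The normal component is below half of the norm, so by Pythagoras the tangential one is
  above half. Every zero near \<open>y\<close> thus lies clearly on one of two sides, with the bound
  that \<open>countable_one_sided\<close> asks for.\<close>

lemma side_cone:
  assumes "F y = 0"
  obtains r where "r > 0" "\<And>z. F z = 0 \<Longrightarrow> z \<noteq> y \<Longrightarrow> dist z y < r \<Longrightarrow> \<bar>rot (u y) \<bullet> (z - y)\<bar> > norm (z - y) / 2"
proof -
  obtain r where r: "r > 0" "\<And>z. F z = 0 \<Longrightarrow> z \<noteq> y \<Longrightarrow> dist z y < r \<Longrightarrow> \<bar>u y \<bullet> (z - y)\<bar> < 1/2 * norm (z - y)"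
    using tangent_cone[OF assms, of "1/2"] by auto
  have "\<bar>rot (u y) \<bullet> (z - y)\<bar> > norm (z - y) / 2" if "F z = 0" "z \<noteq> y" "dist z y < r" for z
  proof (rule ccontr)
    assume "\<not> ?thesis"
    then have "(rot (u y) \<bullet> (z - y))^2 \<le> (norm (z - y) / 2)^2"
      by (metis abs_le_square_iff abs_of_nonneg divide_nonneg_pos norm_ge_zero not_le zero_less_numeral)
    moreover have "(u y \<bullet> (z - y))^2 \<le> (norm (z - y) / 2)^2"
      using r(2)[OF that] by (intro abs_le_square_iff[THEN iffD1]) auto
    ultimately have "(norm (z - y))^2 \<le> 2 * (norm (z - y) / 2)^2"
      using plane_norm_decomp[OF norm_u[OF assms], of "z - y"] by linarith
    then show False using that(2) by (simp add: power2_eq_square)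
  qed
  then show ?thesis using that r(1) by blast
qed

end

section \<open>Cutting a continuum along a normal\<close>

lemma closed_segment_ray:
  fixes y v :: "'a::real_vector"
  assumes "s > 0"
  shows "closed_segment y (y + s *\<^sub>R v) = {y + t *\<^sub>R v | t. 0 \<le> t \<and> t \<le> s}"
proof -
  have eq: "(1 - a) *\<^sub>R y + a *\<^sub>R (y + s *\<^sub>R v) = y + (a * s) *\<^sub>R v" for a
    by (simp add: algebra_simps)
  show ?thesis
  proof (intro subset_antisym subsetI)
    fix x assume "x \<in> closed_segment y (y + s *\<^sub>R v)"
    then obtain a where "0 \<le> a" "a \<le> 1" "x = y + (a * s) *\<^sub>R v"
      unfolding closed_segment_def eq by blast
    then show "x \<in> {y + t *\<^sub>R v | t. 0 \<le> t \<and> t \<le> s}"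
      using assms by (auto simp: mult_left_le_one_le intro!: exI[of _ "a * s"])
  next
    fix x assume "x \<in> {y + t *\<^sub>R v | t. 0 \<le> t \<and> t \<le> s}"
    then obtain t where t: "x = y + t *\<^sub>R v" "0 \<le> t" "t \<le> s" by blast
    then have "x = (1 - t / s) *\<^sub>R y + (t / s) *\<^sub>R (y + s *\<^sub>R v)" "0 \<le> t / s" "t / s \<le> 1"
      unfolding eq using assms by simp_all
    then show "x \<in> closed_segment y (y + s *\<^sub>R v)" unfolding closed_segment_def by blast
  qed
qed

context level
begin

text \<open>\<open>P\<close> and \<open>Q\<close> will be the two sides of a Jordan curve that
  crosses \<open>K\<close> only at \<open>y\<close>, along the normal. The conditions concern all
  zeros near \<open>K\<close>, not only the points of \<open>K\<close>, so that continua close to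
  \<open>K\<close> are cut as well.\<close>

definition cuts :: "(real^2) set \<Rightarrow> real^2 \<Rightarrow> (real^2) set \<Rightarrow> (real^2) set \<Rightarrow> real \<Rightarrow> bool" where
  "cuts K y P Q \<eta> \<longleftrightarrow> open P \<and> open Q \<and> P \<inter> Q = {} \<and> \<eta> > 0 \<and>
    (\<forall>z. F z = 0 \<longrightarrow> (\<exists>k\<in>K. dist z k < \<eta>) \<longrightarrow> z \<noteq> y \<longrightarrow> z \<in> P \<union> Q) \<and>
    (\<forall>z. F z = 0 \<longrightarrow> dist z y < \<eta> \<longrightarrow>
       (rot (u y) \<bullet> (z - y) > 0 \<longrightarrow> z \<in> P) \<and> (rot (u y) \<bullet> (z - y) < 0 \<longrightarrow> z \<in> Q))"

text \<open>As \<open>K\<close> does not separate the plane, the ends of a short normal segment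
  through \<open>y\<close> can be joined off \<open>K\<close>. Closing this connection by the normal
  segment gives a Jordan curve meeting \<open>K\<close> only at \<open>y\<close>.\<close>

lemma continuum_cut:
  assumes K: "compact K" "K \<subseteq> Z" and yK: "y \<in> K"
  obtains P Q \<eta> where "cuts K y P Q \<eta>"
proof -
  have Fy: "F y = 0" using K(2) yK by auto
  obtain \<delta> where \<delta>: "\<delta> > 0" "\<And>t. 0 < t \<Longrightarrow> t < \<delta> \<Longrightarrow> F (y + t *\<^sub>R u y) > 0 \<and> F (y - t *\<^sub>R u y) < 0"
    using normal_signs[OF Fy] by blast
  define s where "s = \<delta> / 2"
  have s: "0 < s" "s < \<delta>" using \<delta> unfolding s_def by auto
  have nu: "norm (u y) = 1" "u y \<bullet> u y = 1" using norm_u[OF Fy] by (auto simp: norm_eq_1)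
  have u0: "u y \<noteq> 0" using nu by auto
  define v where "v = rot (u y)"
  have vu: "v \<bullet> u y = 0" unfolding v_def by simp
  define Am where "Am = closed_segment y (y - s *\<^sub>R u y)"
  define Ap where "Ap = closed_segment y (y + s *\<^sub>R u y)"
  have Am: "Am = {y - t *\<^sub>R u y | t. 0 \<le> t \<and> t \<le> s}"
    using closed_segment_ray[OF s(1), of y "- u y"] unfolding Am_def by simp
  have Ap: "Ap = {y + t *\<^sub>R u y | t. 0 \<le> t \<and> t \<le> s}"
    using closed_segment_ray[OF s(1), of y "u y"] unfolding Ap_def by simp
  have AmAp: "z = y" if zA: "z \<in> Am" "z \<in> Ap" for z
  proof -
    obtain a b where ab: "z = y - a *\<^sub>R u y" "z = y + b *\<^sub>R u y" "0 \<le> a" "0 \<le> b"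
      using zA unfolding Am Ap by blast
    then have "(a + b) *\<^sub>R u y = 0" by (simp add: algebra_simps)
    then show ?thesis using u0 ab by auto
  qed
  have AZ: "z = y" if "z \<in> Am \<union> Ap" "F z = 0" for z
  proof -
    obtain t where t: "z = y - t *\<^sub>R u y \<or> z = y + t *\<^sub>R u y" "0 \<le> t" "t \<le> s"
      using \<open>z \<in> Am \<union> Ap\<close> unfolding Am Ap by blast
    show ?thesis
    proof (cases "t = 0")
      case False
      then have "F (y + t *\<^sub>R u y) > 0 \<and> F (y - t *\<^sub>R u y) < 0" using \<delta>(2)[of t] t s by auto
      then show ?thesis using t(1) \<open>F z = 0\<close> by auto
    qed (use t in auto)
  qed
  have sg: "F (y + s *\<^sub>R u y) > 0" "F (y - s *\<^sub>R u y) < 0" using \<delta>(2)[OF s] by auto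
  have "path_connected (- K)"
    using compact_nonseparating[OF K] compact_imp_closed[OF K(1)] connected_open_path_connected by blast
  moreover have "y + s *\<^sub>R u y \<in> - K" "y - s *\<^sub>R u y \<in> - K" using sg K(2) by fastforce+
  ultimately obtain g where g: "path g" "path_image g \<subseteq> - K" "pathstart g = y - s *\<^sub>R u y" "pathfinish g = y + s *\<^sub>R u y"
    unfolding path_connected_def by metis
  \<comment> \<open>The two half segments meet only in \<open>y\<close>, which \<open>g\<close>
    avoids; so \<open>g\<close> can be trimmed to an arc that touches each half only at one
    end.\<close>
  have "path_image g \<inter> Am \<inter> Ap = {}" using AmAp g(2) yK by auto
  moreover have "pathstart g \<in> Am" "pathfinish g \<in> Ap" unfolding Am_def Ap_def using g by auto
  moreover have "closed Am" "closed Ap" unfolding Am_def Ap_def by auto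
  ultimately obtain h where h: "arc h" "path_image h \<subseteq> path_image g" "pathstart h \<in> Am" "pathfinish h \<in> Ap"
    "path_image h \<inter> Am = {pathstart h}" "path_image h \<inter> Ap = {pathfinish h}"
    using arc_between_closed[OF g(1)] by metis
  have hK: "path_image h \<inter> K = {}" using h(2) g(2) by blast
  obtain a b where ab: "pathstart h = y - a *\<^sub>R u y" "0 \<le> a" "pathfinish h = y + b *\<^sub>R u y" "0 \<le> b" "a \<le> s" "b \<le> s"
    using h(3,4) unfolding Am Ap by blast
  have "pathstart h \<noteq> y" "pathfinish h \<noteq> y" using hK yK by (metis disjoint_iff pathstart_in_path_image pathfinish_in_path_image)+
  then have ab0: "a > 0" "b > 0" using ab by (auto simp: less_le)
  define seg where "seg = closed_segment (pathfinish h) (pathstart h)"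
  have segI: "y + t *\<^sub>R u y \<in> seg" if "- a \<le> t" "t \<le> b" for t
  proof -
    have "t \<in> closed_segment b (- a)" using that ab0 by (simp add: closed_segment_eq_real_ivl)
    then obtain c where c: "0 \<le> c" "c \<le> 1" "t = (1 - c) * b + c * (- a)" by (auto simp: closed_segment_def)
    have "y + t *\<^sub>R u y = (1 - c) *\<^sub>R pathfinish h + c *\<^sub>R pathstart h"
      unfolding ab c(3) by (simp add: algebra_simps)
    then show ?thesis unfolding seg_def closed_segment_def using c by blast
  qed
  have segE: "z \<in> Am \<union> Ap \<and> v \<bullet> (z - y) = 0" if zs: "z \<in> seg" for z
  proof -
    obtain c where c: "0 \<le> c" "c \<le> 1" "z = (1 - c) *\<^sub>R pathfinish h + c *\<^sub>R pathstart h"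
      using zs unfolding seg_def closed_segment_def by blast
    define t where "t = (1 - c) * b - c * a"
    have z: "z = y + t *\<^sub>R u y" unfolding c(3) ab t_def by (simp add: algebra_simps)
    have "(1 - c) * b \<le> b" "c * a \<le> a" "0 \<le> (1 - c) * b" "0 \<le> c * a"
      using c ab0 by (simp_all add: mult_left_le_one_le)
    then have t: "t \<le> s" "- t \<le> s" unfolding t_def using ab by linarith+
    have "z \<in> Am \<union> Ap"
    proof (cases "t \<ge> 0")
      case True then show ?thesis unfolding Ap z using t by blast
    next
      case False
      have "z = y - (-t) *\<^sub>R u y" unfolding z by simp
      then show ?thesis unfolding Am using t False by (metis (mono_tags, lifting) UnI1 mem_Collect_eq neg_0_le_iff_le linorder_le_cases)
    qed
    then show ?thesis using vu z by simp
  qed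
  have pne: "pathfinish h \<noteq> pathstart h" using arc_distinct_ends[OF h(1)] by simp
  define J where "J = h +++ linepath (pathfinish h) (pathstart h)"
  have Jim: "path_image J = path_image h \<union> seg" unfolding J_def seg_def by (simp add: path_image_join)
  have "path_image h \<inter> seg \<subseteq> {pathstart h, pathfinish h}" using segE h(5,6) by blast
  then have Jsp: "simple_path J" unfolding J_def seg_def
    by (intro simple_path_join_loop h(1) arc_linepath pne) auto
  have Jcl: "pathfinish J = pathstart J" unfolding J_def by simp
  note JC = Jordan_inside_outside_plane[OF Jsp Jcl]
  let ?in = "inside (path_image J)" and ?out = "outside (path_image J)"
  have yJ: "y \<in> path_image J" using segI[of 0] ab0 unfolding Jim by auto
  have "closed (path_image h)" using h(1) by (simp add: closed_arc_image)
  moreover have "y \<notin> path_image h" using hK yK by blast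
  ultimately obtain r where r: "r > 0" "ball y r \<inter> path_image h = {}"
    using open_contains_ball[of "- path_image h"] by blast
  define \<rho> where "\<rho> = min r (min a b)"
  have \<rho>: "\<rho> > 0" "\<rho> \<le> r" "\<rho> \<le> a" "\<rho> \<le> b" using r ab0 unfolding \<rho>_def by auto
  define Hp where "Hp = ball y \<rho> \<inter> {z. v \<bullet> z > v \<bullet> y}"
  define Hm where "Hm = ball y \<rho> \<inter> {z. v \<bullet> z < v \<bullet> y}"
  have conH: "connected Hp" "connected Hm" unfolding Hp_def Hm_def
    by (intro convex_connected convex_Int convex_ball convex_halfspace_gt convex_halfspace_lt)+
  have HJ: "Hp \<inter> path_image J = {}" "Hm \<inter> path_image J = {}"
  proof -
    have "ball y \<rho> \<inter> path_image h = {}" using r(2) subset_ball[OF \<rho>(2), of y] by blast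
    moreover have "v \<bullet> z = v \<bullet> y" if "z \<in> seg" for z using segE[OF that] by (simp add: inner_diff_right)
    ultimately show "Hp \<inter> path_image J = {}" "Hm \<inter> path_image J = {}"
      unfolding Hp_def Hm_def Jim by fastforce+
  qed
  have side: "H \<subseteq> ?in \<or> H \<subseteq> ?out" if "connected H" "H \<inter> path_image J = {}" for H
  proof -
    have "H \<subseteq> ?in \<union> ?out" using that(2) inside_Un_outside[of "path_image J"] by blast
    then show ?thesis using connectedD[OF that(1) JC(1,3)] inside_Int_outside[of "path_image J"] by blast
  qed
  \<comment> \<open>Both sides of \<open>J\<close> accumulate at \<open>y\<close>, and near
    \<open>y\<close> everything off \<open>J\<close> lies in one of the half discs. As each half
    disc lies on one side, the two must lie on different sides.\<close>
  have both: "\<exists>w\<in>X. w \<in> Hp \<union> Hm" if X: "frontier X = path_image J" "X \<inter> path_image J = {}" for X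
  proof -
    have "y \<in> closure X" using X(1) yJ by (auto simp: frontier_def)
    then obtain w where w: "w \<in> X" "dist w y < \<rho>" using \<rho>(1) closure_approachable by blast
    have "w \<in> Hp \<union> Hm"
    proof (rule ccontr)
      assume n: "w \<notin> Hp \<union> Hm"
      then have "v \<bullet> (w - y) = 0" using w(2) unfolding Hp_def Hm_def by (auto simp: dist_commute inner_diff_right)
      then have eq: "w = y + (u y \<bullet> (w - y)) *\<^sub>R u y"
        using plane_decomp[OF nu(1), of "w - y"] unfolding v_def by (simp add: algebra_simps)
      have "\<bar>u y \<bullet> (w - y)\<bar> \<le> norm (u y) * norm (w - y)" by (rule Cauchy_Schwarz_ineq2)
      then have "\<bar>u y \<bullet> (w - y)\<bar> < \<rho>" using w(2) nu by (simp add: dist_norm)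
      then have "w \<in> seg" using segI[of "u y \<bullet> (w - y)"] eq \<rho> by (simp add: abs_less_iff)
      then show False using X(2) w(1) Jim by blast
    qed
    then show ?thesis using w by blast
  qed
  have din: "?in \<inter> path_image J = {}" "?out \<inter> path_image J = {}"
    using inside_no_overlap[of "path_image J"] outside_no_overlap[of "path_image J"] by blast+
  have opp: "(Hp \<subseteq> ?in \<and> Hm \<subseteq> ?out) \<or> (Hp \<subseteq> ?out \<and> Hm \<subseteq> ?in)"
    using side[OF conH(1) HJ(1)] side[OF conH(2) HJ(2)] both[OF JC(7) din(1)] both[OF JC(8) din(2)]
      inside_Int_outside[of "path_image J"] by blast
  obtain \<eta>1 where \<eta>1: "\<eta>1 > 0" "\<And>k z. k \<in> K \<Longrightarrow> z \<in> path_image h \<Longrightarrow> \<eta>1 \<le> dist k z"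
    using separate_compact_closed[OF K(1) \<open>closed (path_image h)\<close>] hK by blast
  define \<eta> where "\<eta> = min \<rho> \<eta>1"
  have \<eta>: "\<eta> > 0" using \<rho> \<eta>1 unfolding \<eta>_def by simp
  have inPQ: "z \<in> ?in \<union> ?out" if "F z = 0" "k \<in> K" "dist z k < \<eta>" "z \<noteq> y" for z k
  proof -
    have "z \<notin> path_image h" using \<eta>1(2)[of k z] that(2,3) unfolding \<eta>_def by (auto simp: dist_commute)
    moreover have "z \<notin> seg" using segE AZ that(1,4) by blast
    ultimately show ?thesis using Jim inside_Un_outside[of "path_image J"] by blast
  qed
  have hp: "z \<in> Hp" if "dist z y < \<eta>" "rot (u y) \<bullet> (z - y) > 0" for z
    using that unfolding Hp_def \<eta>_def v_def by (auto simp: dist_commute inner_diff_right)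
  have hm: "z \<in> Hm" if "dist z y < \<eta>" "rot (u y) \<bullet> (z - y) < 0" for z
    using that unfolding Hm_def \<eta>_def v_def by (auto simp: dist_commute inner_diff_right)
  from opp show ?thesis
  proof
    assume o: "Hp \<subseteq> ?in \<and> Hm \<subseteq> ?out"
    have "cuts K y ?in ?out \<eta>"
      unfolding cuts_def using JC(1,3) inside_Int_outside[of "path_image J"] \<eta> inPQ hp hm o by auto
    then show ?thesis by (rule that)
  next
    assume o: "Hp \<subseteq> ?out \<and> Hm \<subseteq> ?in"
    have "?out \<inter> ?in = {}" using inside_Int_outside[of "path_image J"] by blast
    then have "cuts K y ?out ?in \<eta>"
      unfolding cuts_def using JC(1,3) \<eta> inPQ hp hm o by (intro conjI) blast+
    then show ?thesis by (rule that)
  qed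
qed

text \<open>A limit of disjoint continua would be a continuum \<open>K\<close>; at all but countably many of its points
  \<open>K\<close> has points on both sides, and then the cut at such a point forces almost all of the
  disjoint continua through it.\<close>

lemma finite_disjoint_large:
  assumes C: "\<And>C. C \<in> \<C> \<Longrightarrow> connected C \<and> C \<subseteq> Z \<inter> cball x R \<and> (\<exists>a\<in>C. \<exists>b\<in>C. \<eta> \<le> dist a b)"
    and \<eta>: "\<eta> > 0" and disj: "pairwise disjnt \<C>"
  shows "finite \<C>"
proof (rule ccontr)
  assume inf: "infinite \<C>"
  then obtain f :: "nat \<Rightarrow> (real^2) set" where f: "inj f" "range f \<subseteq> \<C>"
    using infinite_countable_subset by blast
  have fC: "connected (f n)" "f n \<noteq> {}" "f n \<subseteq> Z \<inter> cball x R" for n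
  proof -
    have "f n \<in> \<C>" using f(2) by blast
    from C[OF this] show "connected (f n)" "f n \<noteq> {}" "f n \<subseteq> Z \<inter> cball x R" by auto
  qed
  obtain K r where K0: "strict_mono (r::nat\<Rightarrow>nat)" "compact K" "connected K" "K \<subseteq> Z \<inter> cball x R"
     "hausdorff_limit (\<lambda>n. f (r n)) K"
    using continuum_limit[OF compact_Z_cball, of f, OF fC] by metis
  have K5: "\<And>k e. k \<in> K \<Longrightarrow> e > 0 \<Longrightarrow> eventually (\<lambda>n. f (r n) \<inter> ball k e \<noteq> {}) sequentially"
    and K6: "\<And>U. open U \<Longrightarrow> K \<subseteq> U \<Longrightarrow> eventually (\<lambda>n. f (r n) \<subseteq> U) sequentially"
    using K0(5) unfolding hausdorff_limit_def by blast+
  note K = K0(1-4) K5 K6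
  have "K \<noteq> {}" using K(6)[of "{}"] fC(2) by (auto simp: eventually_sequentially)
  then obtain a where a: "a \<in> K" by blast
  \<comment> \<open>The lower bound \<open>\<eta>\<close> on the diameters survives in the limit, so
    \<open>K\<close> is not a single point and, being connected, is uncountable.\<close>
  have "\<exists>b\<in>K. b \<noteq> a"
  proof (rule ccontr)
    assume "\<not> ?thesis"
    then have "K \<subseteq> {a}" by blast
    then have "K \<subseteq> ball a (\<eta>/2)" using \<eta> by auto
    from K(6)[OF open_ball this] obtain n where n: "f (r n) \<subseteq> ball a (\<eta>/2)"
      by (auto simp: eventually_sequentially)
    obtain p q where pq: "p \<in> f (r n)" "q \<in> f (r n)" "\<eta> \<le> dist p q" using C[of "f (r n)"] f(2) by blast
    then have "dist a p < \<eta>/2" "dist a q < \<eta>/2" using n by (auto simp: subset_iff)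
    then show False using pq(3) dist_triangle3[of p q a] by linarith
  qed
  then have unc: "uncountable K" using connected_uncountable[OF K(3) a] by metis
  have KsubZ: "K \<subseteq> Z" using K(4) by blast
  have KZ: "F k = 0" if "k \<in> K" for k using K(4) that by auto
  \<comment> \<open>Points of \<open>K\<close> near which all other points of \<open>K\<close> lie
    ahead in direction \<open>v\<close>. The quantitative bound required for countability comes from
    \<open>side_cone\<close>.\<close>
  define one where "one v = {y \<in> K. \<exists>\<rho>>0. \<forall>z\<in>K. z \<noteq> y \<longrightarrow> dist z y < \<rho> \<longrightarrow> v y \<bullet> (z - y) > 0}" for v :: "real^2 \<Rightarrow> real^2"
  have cou: "countable (one v)" if v: "\<And>y. v y = rot (u y) \<or> v y = - rot (u y)" for v
  proof -
    have "\<exists>\<rho>. \<forall>y\<in>one v. \<rho> y > 0 \<and> (\<forall>z\<in>one v. z \<noteq> y \<longrightarrow> dist z y < \<rho> y \<longrightarrow> v y \<bullet> (z - y) > norm (z - y) / 2)"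
    proof (rule bchoice, rule ballI)
      fix y assume y: "y \<in> one v"
      then obtain \<rho> where \<rho>: "\<rho> > 0" "\<forall>z\<in>K. z \<noteq> y \<longrightarrow> dist z y < \<rho> \<longrightarrow> v y \<bullet> (z - y) > 0" and yK: "y \<in> K"
        unfolding one_def by blast
      obtain r where r: "r > 0" "\<And>z. F z = 0 \<Longrightarrow> z \<noteq> y \<Longrightarrow> dist z y < r \<Longrightarrow> \<bar>rot (u y) \<bullet> (z - y)\<bar> > norm (z - y) / 2"
        using side_cone[OF KZ[OF yK]] by blast
      have "v y \<bullet> (z - y) > norm (z - y) / 2" if z: "z \<in> one v" "z \<noteq> y" "dist z y < min \<rho> r" for z
      proof -
        have zK: "z \<in> K" using z unfolding one_def by blast
        have "v y \<bullet> (z - y) > 0" using \<rho>(2) zK z by auto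
        moreover have "\<bar>v y \<bullet> (z - y)\<bar> > norm (z - y) / 2" using v[of y] r(2)[OF KZ[OF zK] z(2)] z(3) by auto
        ultimately show ?thesis by linarith
      qed
      then show "\<exists>\<rho>. \<rho> > 0 \<and> (\<forall>z\<in>one v. z \<noteq> y \<longrightarrow> dist z y < \<rho> \<longrightarrow> v y \<bullet> (z - y) > norm (z - y) / 2)"
        using \<rho>(1) r(1) by (intro exI[of _ "min \<rho> r"]) auto
    qed
    then obtain \<rho> where "\<forall>y\<in>one v. \<rho> y > 0 \<and> (\<forall>z\<in>one v. z \<noteq> y \<longrightarrow> dist z y < \<rho> y \<longrightarrow> v y \<bullet> (z - y) > norm (z - y) / 2)"
      by blast
    then show ?thesis by (intro countable_one_sided[of "one v" \<rho> v]) auto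
  qed
  have "countable (one (\<lambda>y. rot (u y)) \<union> one (\<lambda>y. - rot (u y)))"
    using cou[of "\<lambda>y. rot (u y)"] cou[of "\<lambda>y. - rot (u y)"] by auto
  then obtain y where y: "y \<in> K" "y \<notin> one (\<lambda>y. rot (u y))" "y \<notin> one (\<lambda>y. - rot (u y))"
    using unc by (metis UnCI countable_subset subsetI)
  obtain P Q \<eta>' where "cuts K y P Q \<eta>'"
    by (rule continuum_cut[OF K(2) KsubZ y(1)])
  then have cut: "open P" "open Q" "P \<inter> Q = {}" "\<eta>' > 0"
    "\<And>z k. F z = 0 \<Longrightarrow> k \<in> K \<Longrightarrow> dist z k < \<eta>' \<Longrightarrow> z \<noteq> y \<Longrightarrow> z \<in> P \<union> Q"
    "\<And>z. F z = 0 \<Longrightarrow> dist z y < \<eta>' \<Longrightarrow> rot (u y) \<bullet> (z - y) > 0 \<Longrightarrow> z \<in> P"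
    "\<And>z. F z = 0 \<Longrightarrow> dist z y < \<eta>' \<Longrightarrow> rot (u y) \<bullet> (z - y) < 0 \<Longrightarrow> z \<in> Q"
    unfolding cuts_def by blast+
  obtain r' where r': "r' > 0" "\<And>z. F z = 0 \<Longrightarrow> z \<noteq> y \<Longrightarrow> dist z y < r' \<Longrightarrow> \<bar>rot (u y) \<bullet> (z - y)\<bar> > norm (z - y) / 2"
    using side_cone[OF KZ[OF y(1)]] by blast
  define e where "e = min r' \<eta>'"
  have e: "e > 0" "e \<le> r'" "e \<le> \<eta>'" using r' cut(4) unfolding e_def by auto
  obtain z1 where z1: "z1 \<in> K" "z1 \<noteq> y" "dist z1 y < e" "\<not> rot (u y) \<bullet> (z1 - y) > 0"
    using y(1,2) e(1) unfolding one_def by blast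
  obtain z2 where z2: "z2 \<in> K" "z2 \<noteq> y" "dist z2 y < e" "\<not> - rot (u y) \<bullet> (z2 - y) > 0"
    using y(1,3) e(1) unfolding one_def by blast
  have "z1 \<in> Q" using cut(7)[OF KZ[OF z1(1)]] z1 r'(2)[OF KZ[OF z1(1)] z1(2)] e norm_ge_zero[of "z1 - y"] by linarith
  then obtain e1 where e1: "e1 > 0" "ball z1 e1 \<subseteq> Q" using cut(2) open_contains_ball by blast
  have "z2 \<in> P" using cut(6)[OF KZ[OF z2(1)]] z2 r'(2)[OF KZ[OF z2(1)] z2(2)] e norm_ge_zero[of "z2 - y"]
      inner_minus_left[of "rot (u y)" "z2 - y"] by linarith
  then obtain e2 where e2: "e2 > 0" "ball z2 e2 \<subseteq> P" using cut(1) open_contains_ball by blast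
  have opn: "open (\<Union>k\<in>K. ball k \<eta>')" "K \<subseteq> (\<Union>k\<in>K. ball k \<eta>')" using cut(4) by auto
  have "eventually (\<lambda>n. f (r n) \<inter> ball z1 e1 \<noteq> {} \<and> f (r n) \<inter> ball z2 e2 \<noteq> {} \<and> f (r n) \<subseteq> (\<Union>k\<in>K. ball k \<eta>')) sequentially"
    using K(5)[OF z1(1) e1(1)] K(5)[OF z2(1) e2(1)] K(6)[OF opn] by (auto intro!: eventually_conj)
  then obtain N where N: "\<And>n. n \<ge> N \<Longrightarrow> f (r n) \<inter> ball z1 e1 \<noteq> {} \<and> f (r n) \<inter> ball z2 e2 \<noteq> {} \<and> f (r n) \<subseteq> (\<Union>k\<in>K. ball k \<eta>')"
    unfolding eventually_sequentially by blast
  have yin: "y \<in> f (r n)" if nN: "n \<ge> N" for n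
  proof (rule ccontr)
    assume yn: "y \<notin> f (r n)"
    have "f (r n) \<subseteq> P \<union> Q"
    proof
      fix z assume z: "z \<in> f (r n)"
      then have "z \<in> (\<Union>k\<in>K. ball k \<eta>')" using N[OF nN] by blast
      then obtain k where "k \<in> K" "dist z k < \<eta>'" by (auto simp: dist_commute)
      moreover have "F z = 0" "z \<noteq> y" using z yn fC(3)[of "r n"] by auto
      ultimately show "z \<in> P \<union> Q" using cut(5)[of z k] by blast
    qed
    then show False using connectedD[OF fC(1) cut(1,2), of "r n"] cut(3) N[OF nN] e1(2) e2(2) by blast
  qed
  \<comment> \<open>Two different members of the disjoint family contain \<open>y\<close>, which is
    absurd.\<close>
  have "r N \<noteq> r (Suc N)" using K(1) by (metis less_irrefl lessI strict_monoD)
  then have "f (r N) \<noteq> f (r (Suc N))" using f(1) by (meson injD)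
  then have "disjnt (f (r N)) (f (r (Suc N)))" using disj f(2) by (meson pairwiseD rangeI subsetD)
  then show False using yin[of N] yin[of "Suc N"] by (auto simp: disjnt_def)
qed

section \<open>Arcs in the level set\<close>

definition continuum :: "(real^2) set \<Rightarrow> bool" where
  "continuum K \<longleftrightarrow> compact K \<and> connected K \<and> K \<subseteq> Z"

definition linked :: "real^2 \<Rightarrow> real^2 \<Rightarrow> bool" where
  "linked a b \<longleftrightarrow> (\<exists>K. continuum K \<and> a \<in> K \<and> b \<in> K)"

text \<open>For linked points this is the least continuum in \<open>Z\<close> through both, and
  later an arc. For points that are not linked the family is empty and \<open>seg a b\<close> is the
  whole plane, hence the \<open>linked\<close> hypotheses below.\<close>

definition seg :: "real^2 \<Rightarrow> real^2 \<Rightarrow> (real^2) set" where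
  "seg a b = \<Inter>{K. continuum K \<and> a \<in> K \<and> b \<in> K}"

lemma continuum_Int: "continuum K \<Longrightarrow> continuum L \<Longrightarrow> continuum (K \<inter> L)"
  using connected_Int_continua[of K L] unfolding continuum_def by (auto intro: compact_Int)

lemma continuum_Un: "continuum K \<Longrightarrow> continuum L \<Longrightarrow> K \<inter> L \<noteq> {} \<Longrightarrow> continuum (K \<union> L)"
  unfolding continuum_def by (auto intro: compact_Un connected_Un)

lemma continuum_singleton: "F a = 0 \<Longrightarrow> continuum {a}"
  unfolding continuum_def by auto

lemma seg_minimal: "continuum K \<Longrightarrow> a \<in> K \<Longrightarrow> b \<in> K \<Longrightarrow> seg a b \<subseteq> K"
  unfolding seg_def by blast

lemma continuum_seg:
  assumes "linked a b" shows "continuum (seg a b)"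
proof -
  let ?K = "{K. continuum K \<and> a \<in> K \<and> b \<in> K}"
  obtain K where K: "K \<in> ?K" using assms unfolding linked_def by blast
  have "connected (\<Inter>?K)"
    by (rule connected_Inter_directed) (use K continuum_Int in \<open>auto simp: continuum_def\<close>)
  moreover have "compact (\<Inter>?K)" using K by (intro compact_Inter) (auto simp: continuum_def)
  ultimately show ?thesis using K unfolding seg_def continuum_def by auto
qed

lemma seg_ends [simp]: "a \<in> seg a b" "b \<in> seg a b"
  unfolding seg_def by auto

lemma seg_sym: "seg a b = seg b a"
  unfolding seg_def by (metis (no_types, lifting))

lemma linked_sym: "linked a b \<Longrightarrow> linked b a"
  unfolding linked_def by blast

lemma linked_trans: "linked a b \<Longrightarrow> linked b c \<Longrightarrow> linked a c"
  unfolding linked_def using continuum_Un by blast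

lemma linked_Z: assumes "linked a b" shows "F a = 0" "F b = 0"
  using assms unfolding linked_def continuum_def by auto

lemma linked_refl: "F a = 0 \<Longrightarrow> linked a a"
  unfolding linked_def using continuum_singleton by blast

lemma seg_refl: "F a = 0 \<Longrightarrow> seg a a = {a}"
  using seg_minimal[OF continuum_singleton, of a a a] by force

lemma linkedI: "continuum K \<Longrightarrow> a \<in> K \<Longrightarrow> b \<in> K \<Longrightarrow> linked a b"
  unfolding linked_def by blast

lemma seg_linked: 
  assumes "linked a b" "y \<in> seg a b" shows "linked a y" "linked y b"
  using linkedI[OF continuum_seg[OF assms(1)]] assms(2) by auto

lemma seg_subset:
  assumes "linked a b" "y \<in> seg a b" shows "seg a y \<subseteq> seg a b" "seg y b \<subseteq> seg a b"
  using seg_minimal[OF continuum_seg[OF assms(1)]] assms(2) by auto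

lemma seg_in_Z: assumes "linked a b" "y \<in> seg a b" shows "F y = 0"
  using continuum_seg[OF assms(1)] assms(2) unfolding continuum_def by auto

lemma seg_triangle:
  assumes "linked a b" "linked b c" shows "seg a c \<subseteq> seg a b \<union> seg b c"
proof (rule seg_minimal)
  have "b \<in> seg a b \<inter> seg b c" by simp
  then show "continuum (seg a b \<union> seg b c)" using assms continuum_seg continuum_Un by blast
qed auto

text \<open>The components of \<open>Z \<inter> cball x e\<close> that miss \<open>x\<close> but
  come within \<open>e/2\<close> of it reach the sphere, so they have diameter at least
  \<open>e/2\<close> and are finite in number. Their union is closed and misses
  \<open>x\<close>.\<close>

lemma local_component:
  assumes "F x = 0" "e > 0"
  obtains \<delta> where "\<delta> > 0" "\<And>z. F z = 0 \<Longrightarrow> dist z x < \<delta> \<Longrightarrow> z \<in> connected_component_set (Z \<inter> cball x e) x"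
proof -
  let ?S = "Z \<inter> cball x e"
  define \<C> where "\<C> = {C \<in> components ?S. x \<notin> C \<and> C \<inter> cball x (e/2) \<noteq> {}}"
  have fin: "finite \<C>"
  proof (rule finite_disjoint_large[where \<eta>="e/2" and x=x and R=e])
    show "connected C \<and> C \<subseteq> ?S \<and> (\<exists>a\<in>C. \<exists>b\<in>C. e/2 \<le> dist a b)" if C: "C \<in> \<C>" for C
    proof -
      have CC: "C \<in> components ?S" using C unfolding \<C>_def by blast
      obtain a where a: "a \<in> C" "dist x a \<le> e/2" using C unfolding \<C>_def by auto
      obtain b where "b \<in> C" "b \<in> sphere x e" using component_meets_sphere[OF CC] by blast
      then have b: "b \<in> C" "dist x b = e" by auto
      have "e/2 \<le> dist a b" using dist_triangle[of x b a] a b by linarith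
      then show ?thesis using a b CC in_components_connected in_components_subset by blast
    qed
    show "pairwise disjnt \<C>" unfolding pairwise_def disjnt_def \<C>_def
      using components_nonoverlap by blast
  qed (use assms in simp)
  have "closed C" if "C \<in> \<C>" for C
    using that closed_components[OF compact_imp_closed[OF compact_Z_cball]] unfolding \<C>_def by blast
  then have "closed (\<Union>\<C>)" using fin by blast
  moreover have "x \<notin> \<Union>\<C>" unfolding \<C>_def by blast
  ultimately obtain d where d: "d > 0" "ball x d \<inter> \<Union>\<C> = {}"
    using open_contains_ball[of "- \<Union>\<C>"] by blast
  have "z \<in> connected_component_set ?S x" if z: "F z = 0" "dist z x < min d (e/2)" for z
  proof -
    have zS: "z \<in> ?S" using z assms(2) by (auto simp: dist_commute)
    let ?C = "connected_component_set ?S z"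
    have "?C \<in> components ?S" using zS by (auto simp: components_def)
    moreover have "z \<in> ?C" using zS by (simp add: connected_component_refl)
    moreover have "z \<in> cball x (e/2)" "z \<in> ball x d" using z by (auto simp: dist_commute)
    ultimately have "x \<in> ?C" using d(2) unfolding \<C>_def by blast
    then show ?thesis by (simp add: connected_component_sym)
  qed
  then show ?thesis using that[of "min d (e/2)"] d(1) assms(2) by auto
qed

lemma continuum_component:
  assumes "F x = 0" "e > 0" shows "continuum (connected_component_set (Z \<inter> cball x e) x)" "x \<in> connected_component_set (Z \<inter> cball x e) x"
proof -
  have x: "x \<in> Z \<inter> cball x e" using assms by auto
  then have "connected_component_set (Z \<inter> cball x e) x \<in> components (Z \<inter> cball x e)" by (auto simp: components_def)
  then have "compact (connected_component_set (Z \<inter> cball x e) x)" using compact_components[OF compact_Z_cball] by blast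
  then show "continuum (connected_component_set (Z \<inter> cball x e) x)"
    unfolding continuum_def using connected_component_subset[of "Z \<inter> cball x e" x] by auto
  show "x \<in> connected_component_set (Z \<inter> cball x e) x" using x by (simp add: connected_component_refl)
qed

lemma local_seg:
  assumes "F x = 0" "e > 0"
  obtains \<delta> where "\<delta> > 0" "\<And>z. F z = 0 \<Longrightarrow> dist z x < \<delta> \<Longrightarrow> linked x z \<and> seg x z \<subseteq> cball x e"
proof -
  obtain \<delta> where \<delta>: "\<delta> > 0" "\<And>z. F z = 0 \<Longrightarrow> dist z x < \<delta> \<Longrightarrow> z \<in> connected_component_set (Z \<inter> cball x e) x"
    using local_component[OF assms] by blast
  note c = continuum_component[OF assms]
  have "linked x z \<and> seg x z \<subseteq> cball x e" if "F z = 0" "dist z x < \<delta>" for z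
    using linkedI[OF c(1,2) \<delta>(2)[OF that]] seg_minimal[OF c(1,2) \<delta>(2)[OF that]]
      connected_component_subset[of "Z \<inter> cball x e" x] by blast
  then show ?thesis using that \<delta>(1) by blast
qed

text \<open>To be joined by a continuum in \<open>Z \<inter> U\<close> is an equivalence relation on
  \<open>D\<close> with relatively open classes, by \<open>local_seg\<close>; a connected set has
  only one class. Here \<open>D\<close> may fail to be closed, and \<open>U\<close> is usually the
  complement of points to be avoided.\<close>

lemma connected_imp_linked:
  assumes D: "connected D" "D \<subseteq> Z" and U: "open U" "D \<subseteq> U" and ab: "a \<in> D" "b \<in> D"
  shows "linked a b" "seg a b \<subseteq> U"
proof -
  have "\<exists>K. continuum K \<and> K \<subseteq> U \<and> a \<in> K \<and> b \<in> K"
  proof (rule connected_equivalence_relation[OF D(1) ab, where R = "\<lambda>a b. \<exists>K. continuum K \<and> K \<subseteq> U \<and> a \<in> K \<and> b \<in> K"])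
    show "\<exists>K. continuum K \<and> K \<subseteq> U \<and> x \<in> K \<and> z \<in> K"
      if xy: "\<exists>K. continuum K \<and> K \<subseteq> U \<and> x \<in> K \<and> y \<in> K" "\<exists>K. continuum K \<and> K \<subseteq> U \<and> y \<in> K \<and> z \<in> K" for x y z
    proof -
      obtain K L where "continuum K" "K \<subseteq> U" "x \<in> K" "y \<in> K" "continuum L" "L \<subseteq> U" "y \<in> L" "z \<in> L" using xy by blast
      then show ?thesis using continuum_Un[of K L] by (intro exI[of _ "K \<union> L"]) auto
    qed
    show "\<exists>T. openin (top_of_set D) T \<and> x \<in> T \<and> (\<forall>z\<in>T. \<exists>K. continuum K \<and> K \<subseteq> U \<and> x \<in> K \<and> z \<in> K)" if x: "x \<in> D" for x
    proof -
      obtain e where e: "e > 0" "cball x e \<subseteq> U" using U x open_contains_cball by blast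
      have Fx: "F x = 0" using D(2) x by auto
      obtain \<delta> where \<delta>: "\<delta> > 0" "\<And>z. F z = 0 \<Longrightarrow> dist z x < \<delta> \<Longrightarrow> linked x z \<and> seg x z \<subseteq> cball x e"
        using local_seg[OF Fx e(1)] by blast
      have "\<exists>K. continuum K \<and> K \<subseteq> U \<and> x \<in> K \<and> z \<in> K" if "z \<in> D \<inter> ball x \<delta>" for z
      proof -
        have "linked x z" "seg x z \<subseteq> cball x e" 
          using \<delta>(2)[of z] that subsetD[OF D(2), of z] by (simp_all add: dist_commute)
        then show ?thesis using continuum_seg e(2) by (intro exI[of _ "seg x z"]) auto
      qed
      then show ?thesis using x \<delta>(1) by (intro exI[of _ "D \<inter> ball x \<delta>"]) auto
    qed
  qed blast
  then show "linked a b" "seg a b \<subseteq> U" using linkedI seg_minimal by blast+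
qed

text \<open>The preceding lemma with \<open>U\<close> the complement of \<open>y\<close>: a point of
  \<open>seg a b\<close> is a cut point of \<open>Z\<close> between \<open>a\<close> and
  \<open>b\<close>.\<close>

lemma seg_separates:
  assumes "y \<in> seg a b" "connected D" "D \<subseteq> Z" "y \<notin> D" "a \<in> D" shows "b \<notin> D"
  using connected_imp_linked(2)[of D "- {y}" a b] assms by blast

text \<open>Zeros close to \<open>q\<close> are joined to \<open>q\<close> by small continua that
  miss \<open>w\<close>, hence inside the same component.\<close>

lemma component_minus_point_open:
  assumes Q: "Q \<in> components (Z - {w})" and q: "q \<in> Q"
  obtains e where "e > 0" "\<And>z. F z = 0 \<Longrightarrow> dist z q < e \<Longrightarrow> z \<in> Q"
proof -
  have qZ: "F q = 0" "q \<noteq> w" using in_components_subset[OF Q] q by auto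
  define e where "e = dist q w / 2"
  have e: "e > 0" using qZ unfolding e_def by simp
  obtain \<delta> where \<delta>: "\<delta> > 0" "\<And>z. F z = 0 \<Longrightarrow> dist z q < \<delta> \<Longrightarrow> linked q z \<and> seg q z \<subseteq> cball q e"
    using local_seg[OF qZ(1) e] by blast
  have "z \<in> Q" if z: "F z = 0" "dist z q < \<delta>" for z
  proof -
    have c: "linked q z" "seg q z \<subseteq> cball q e" using \<delta>(2)[OF z] by auto
    have "w \<notin> cball q e" using e unfolding e_def by simp
    then have "seg q z \<subseteq> Z - {w}" using c continuum_seg[OF c(1)] unfolding continuum_def by blast
    moreover have "connected (seg q z)" using continuum_seg[OF c(1)] unfolding continuum_def by blast
    moreover have "Q \<inter> seg q z \<noteq> {}" using q seg_ends by blast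
    ultimately have "seg q z \<subseteq> Q" using components_maximal[OF Q] by blast
    then show ?thesis using seg_ends by blast
  qed
  then show ?thesis using that \<delta>(1) by blast
qed

end

section \<open>Order and length along the minimal continua\<close>

definition whitney_map :: "('a::euclidean_space set \<Rightarrow> real) \<Rightarrow> bool" where
  "whitney_map w \<longleftrightarrow> (\<forall>K L. closed K \<longrightarrow> K \<noteq> {} \<longrightarrow> K \<subset> L \<longrightarrow> w K < w L) \<and>
     (\<forall>K L e. K \<noteq> {} \<longrightarrow> L \<noteq> {} \<longrightarrow> (\<forall>k\<in>K. \<exists>l\<in>L. dist k l \<le> e) \<longrightarrow>
        (\<forall>l\<in>L. \<exists>k\<in>K. dist k l \<le> e) \<longrightarrow> \<bar>w K - w L\<bar> \<le> 2 * e)"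

definition whit :: "'a::euclidean_space set \<Rightarrow> real" where
  "whit = (SOME w. whitney_map w)"

lemma whitney_map_whit: "whitney_map whit"
proof -
  have "\<exists>w :: 'a set \<Rightarrow> real. whitney_map w" unfolding whitney_map_def by (rule whitney_map_exists)
  then show ?thesis unfolding whit_def by (rule someI_ex)
qed

lemma whit_strict_mono: "closed K \<Longrightarrow> K \<noteq> {} \<Longrightarrow> K \<subset> L \<Longrightarrow> whit K < whit L"
  using whitney_map_whit[unfolded whitney_map_def, THEN conjunct1] by blast

lemma whit_Lipschitz:
  assumes "K \<noteq> {}" "L \<noteq> {}" "\<And>k. k\<in>K \<Longrightarrow> \<exists>l\<in>L. dist k l \<le> e" "\<And>l. l\<in>L \<Longrightarrow> \<exists>k\<in>K. dist k l \<le> e"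
  shows "\<bar>whit K - whit L\<bar> \<le> 2 * e"
  using whitney_map_whit assms unfolding whitney_map_def by meson

context level
begin

text \<open>Let \<open>?O\<close> be the component of \<open>Z - {z}\<close> containing
  \<open>b\<close>. It misses \<open>y\<close>, because \<open>z\<close> separates \<open>y\<close>
  from \<open>b\<close>. Adding \<open>z\<close> to the part of \<open>seg y b\<close> in
  \<open>?O\<close> gives a continuum through \<open>z\<close> and \<open>b\<close> that misses
  \<open>y\<close>.\<close>

lemma seg_not_mutual:
  assumes yb: "linked y b" and z: "z \<in> seg y b" "z \<noteq> y"
  shows "y \<notin> seg z b"
proof (cases "z = b")
  case True
  then show ?thesis using seg_refl linked_Z[OF yb] z(2) by auto
next
  case False
  let ?D = "seg y b"
  let ?O = "connected_component_set (Z - {z}) b"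
  have D: "continuum ?D" using continuum_seg[OF yb] .
  have bZ: "b \<in> Z - {z}" using linked_Z[OF yb] False by auto
  have OZ: "?O \<subseteq> Z - {z}" by (rule connected_component_subset)
  have bO: "b \<in> ?O" using bZ by (simp add: connected_component_refl)
  have yO: "y \<notin> ?O"
    by (rule seg_separates[of z b y]) (use z seg_sym OZ bO in auto)
  have Oc: "?O \<in> components (Z - {z})" using bZ by (auto simp: components_def)
  define T where "T = ?D \<inter> ?O"
  obtain V where V: "closed V" "?O = (Z - {z}) \<inter> V"
    using closedin_connected_component[of "Z - {z}" b] by (auto simp: closedin_closed)
  have TV: "T = (?D - {z}) \<inter> V" using V(2) D unfolding T_def continuum_def by auto
  have clo: "closedin (top_of_set (?D - {z})) T" unfolding TV using V(1) by (metis closedin_closed)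
  have ope: "openin (top_of_set (?D - {z})) T"
  proof (subst openin_euclidean_subtopology_iff, intro conjI ballI)
    show "T \<subseteq> ?D - {z}" using TV by blast
    fix q assume q: "q \<in> T"
    then obtain e where e: "e > 0" "\<And>z'. F z' = 0 \<Longrightarrow> dist z' q < e \<Longrightarrow> z' \<in> ?O"
      using component_minus_point_open[OF Oc, of q] unfolding T_def by blast
    then show "\<exists>e>0. \<forall>x'\<in>?D - {z}. dist x' q < e \<longrightarrow> x' \<in> T"
      using seg_in_Z[OF yb] unfolding T_def by blast
  qed
  \<comment> \<open>\<open>T\<close> is both open and closed in the continuum without
    \<open>z\<close>, so putting \<open>z\<close> back makes it connected.\<close>
  have "connected ({z} \<union> T)"
    by (rule connected_Un_clopen_in_complement[OF _ _ _ ope clo]) (use D z in \<open>auto simp: continuum_def\<close>)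
  moreover have "{z} \<union> T = {z} \<union> (?D \<inter> V)" using TV by blast
  moreover have "compact ({z} \<union> (?D \<inter> V))" using D V(1) unfolding continuum_def by (intro compact_Un compact_Int_closed) auto
  moreover have "{z} \<union> T \<subseteq> Z" using D z(1) unfolding T_def continuum_def by auto
  ultimately have "continuum ({z} \<union> T)" unfolding continuum_def by metis
  then have "seg z b \<subseteq> {z} \<union> T" by (rule seg_minimal) (use bO T_def in auto)
  then show ?thesis using z(2) yO unfolding T_def by blast
qed

text \<open>A second common point \<open>v\<close> of the two pieces would give a way from
  \<open>x\<close> to \<open>y\<close> over \<open>v\<close> that avoids \<open>w\<close>, by
  \<open>seg_not_mutual\<close> on both pieces.\<close>

lemma seg_order:
  assumes "linked x y" "w \<in> seg x y" "v \<in> seg x w" "v \<in> seg w y" shows "v = w"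
proof (rule ccontr)
  assume ne: "v \<noteq> w"
  note xw = seg_linked[OF assms(1,2)]
  note xv = seg_linked[OF xw(1) assms(3)] and vy = seg_linked[OF xw(2) assms(4)]
  have "w \<notin> seg v y" by (rule seg_not_mutual[OF xw(2) assms(4) ne])
  moreover have "w \<notin> seg v x" 
    by (rule seg_not_mutual[OF linked_sym[OF xw(1)] _ ne]) (use assms(3) seg_sym in blast)
  moreover have "seg x y \<subseteq> seg x v \<union> seg v y" using seg_triangle[OF xv(1) vy(2)] .
  ultimately show False using assms(2) seg_sym by blast
qed

text \<open>If neither of \<open>y\<close>, \<open>z\<close> came before the other, each would lie
  on the way from the other to \<open>b\<close>, against \<open>seg_not_mutual\<close>. So inclusion
  of initial pieces is a linear order.\<close>

lemma seg_comparable: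
  assumes ab: "linked a b" and y: "y \<in> seg a b" and z: "z \<in> seg a b"
  shows "z \<in> seg a y \<or> y \<in> seg a z"
proof (rule ccontr)
  assume n: "\<not> ?thesis"
  have "z \<in> seg y b" using n z seg_triangle[OF seg_linked[OF ab y]] by blast
  moreover have "y \<in> seg z b" using n y seg_triangle[OF seg_linked[OF ab z]] by blast
  moreover have "z \<noteq> y" using n seg_ends by blast
  ultimately show False using seg_not_mutual[OF seg_linked(2)[OF ab y]] by blast
qed

text \<open>The Whitney size of the initial piece replaces arc length, which may be
  infinite.\<close>

definition len :: "real^2 \<Rightarrow> real^2 \<Rightarrow> real" where "len a y = whit (seg a y)"

lemma len_less:
  assumes "linked a z" "y \<in> seg a z" "y \<noteq> z" shows "len a y < len a z"
proof -
  have ay: "linked a y" using seg_linked assms by blast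
  have "z \<notin> seg y a" 
    using seg_not_mutual[OF linked_sym[OF assms(1)], of y] assms(2,3) seg_sym by blast
  then have "z \<notin> seg a y" using seg_sym by blast
  then have "seg a y \<subset> seg a z" using seg_subset[OF assms(1,2)] seg_ends by blast
  moreover have "closed (seg a y)" using continuum_seg[OF ay] compact_imp_closed unfolding continuum_def by blast
  moreover have "seg a y \<noteq> {}" using seg_ends(1)[of a y] by blast
  ultimately show ?thesis unfolding len_def using whit_strict_mono by blast
qed

lemma len_le:
  assumes "linked a z" "y \<in> seg a z" shows "len a y \<le> len a z"
  using len_less[OF assms] by (cases "y = z") auto

lemma seg_iff_len:
  assumes "linked a b" "y \<in> seg a b" "z \<in> seg a b" shows "y \<in> seg a z \<longleftrightarrow> len a y \<le> len a z"
proof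
  assume "y \<in> seg a z" then show "len a y \<le> len a z" using len_le seg_linked assms by blast
next
  assume le: "len a y \<le> len a z"
  show "y \<in> seg a z"
  proof (rule ccontr)
    assume n: "y \<notin> seg a z"
    then have "z \<in> seg a y" "z \<noteq> y" using seg_comparable[OF assms] seg_ends by auto
    then show False using len_less[of a y z] seg_linked(1)[OF assms(1,2)] le by auto
  qed
qed

lemma len_inj:
  assumes "linked a b" "y \<in> seg a b" "z \<in> seg a b" "len a y = len a z" shows "y = z"
proof (rule ccontr)
  assume "y \<noteq> z"
  moreover have "y \<in> seg a z" using seg_iff_len[OF assms(1-3)] assms(4) by simp
  ultimately show False using len_less[of a z y] seg_linked(1)[OF assms(1,3)] assms(4) by auto
qed

text \<open>By the triangle rule the two initial pieces differ only inside \<open>seg y z\<close>,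
  so each lies within \<open>2 * e\<close> of the other; the factor 2 of
  \<open>whit_Lipschitz\<close> gives \<open>4 * e\<close>.\<close>

lemma len_near:
  assumes ay: "linked a y" and yz: "linked y z" and s: "seg y z \<subseteq> cball y e" and e: "e > 0"
  shows "\<bar>len a z - len a y\<bar> \<le> 4 * e"
proof -
  have az: "linked a z" using ay yz linked_trans by blast
  have zy: "linked z y" using yz linked_sym by blast
  have "\<bar>whit (seg a z) - whit (seg a y)\<bar> \<le> 2 * (2 * e)"
  proof (rule whit_Lipschitz)
    show "\<exists>l\<in>seg a y. dist k l \<le> 2 * e" if k: "k \<in> seg a z" for k
    proof (cases "k \<in> seg a y")
      case False
      then have "k \<in> seg y z" using seg_triangle[OF ay yz] k by blast
      then have "dist k y \<le> 2 * e" using s e by (force simp: dist_commute)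
      then show ?thesis using seg_ends by blast
    qed (use e in force)
    show "\<exists>k\<in>seg a z. dist k l \<le> 2 * e" if l: "l \<in> seg a y" for l
    proof (cases "l \<in> seg a z")
      case False
      then have "l \<in> seg y z" using seg_triangle[OF az zy] l seg_sym by blast
      then have "l \<in> cball y e" "z \<in> cball y e" using s seg_ends by blast+
      then have "dist y l \<le> e" "dist y z \<le> e" by auto
      then have "dist z l \<le> 2 * e" using dist_triangle3[of z l y] by linarith
      then show ?thesis using seg_ends by blast
    qed (use e in force)
  qed (use seg_ends in blast)+
  then show ?thesis unfolding len_def by simp
qed

lemma len_continuous:
  assumes "\<And>y. y \<in> S \<Longrightarrow> linked a y" shows "continuous_on S (len a)"
  unfolding continuous_on_iff
proof (intro ballI allI impI)
  fix y and e :: real assume y: "y \<in> S" and e: "e > 0"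
  have "F y = 0" using assms[OF y] linked_Z by blast
  then obtain \<delta> where \<delta>: "\<delta> > 0" "\<And>z. F z = 0 \<Longrightarrow> dist z y < \<delta> \<Longrightarrow> linked y z \<and> seg y z \<subseteq> cball y (e/5)"
    using local_seg[of y "e/5"] e by auto
  have "dist (len a z) (len a y) < e" if z: "z \<in> S" "dist z y < \<delta>" for z
  proof -
    have "F z = 0" using assms[OF z(1)] linked_Z by blast
    then have "linked y z" "seg y z \<subseteq> cball y (e/5)" using \<delta>(2)[of z] z(2) by auto
    then have "\<bar>len a z - len a y\<bar> \<le> 4 * (e/5)" by (rule len_near[OF assms[OF y]]) (use e in simp)
    then show ?thesis using e by (simp add: dist_real_def)
  qed
  then show "\<exists>d>0. \<forall>x'\<in>S. dist x' y < d \<longrightarrow> dist (len a x') (len a y) < e" using \<delta>(1) by blast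
qed

lemma seg_param:
  assumes ab: "linked a b"
  obtains k where "homeomorphism (seg a b) {len a a..len a b} (len a) k"
proof -
  have c: "continuous_on (seg a b) (len a)" by (rule len_continuous) (use seg_linked ab in blast)
  have K: "compact (seg a b)" "connected (seg a b)" using continuum_seg[OF ab] unfolding continuum_def by auto
  have "len a ` seg a b = {len a a..len a b}"
  proof (intro subset_antisym subsetI)
    fix t assume "t \<in> len a ` seg a b"
    then obtain y where y: "y \<in> seg a b" "t = len a y" by blast
    show "t \<in> {len a a..len a b}" using y len_le[OF ab y(1)] len_le[OF seg_linked(1)[OF ab y(1)], of a] by simp
  next
    fix t assume "t \<in> {len a a..len a b}"
    then show "t \<in> len a ` seg a b"
      using connectedD_interval[OF connected_continuous_image[OF c K(2)], of "len a a" "len a b" t] by auto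
  qed
  moreover have "inj_on (len a) (seg a b)" using len_inj[OF ab] by (auto simp: inj_on_def)
  ultimately show ?thesis using homeomorphism_compact[OF K(1) c] that by blast
qed

lemma seg_arc:
  assumes ab: "linked a b" "a \<noteq> b"
  obtains g where "arc g" "path_image g = seg a b" "pathstart g = a" "pathfinish g = b"
proof -
  obtain k where k: "homeomorphism (seg a b) {len a a..len a b} (len a) k" using seg_param[OF ab(1)] .
  have lt: "len a a < len a b" using len_less[OF ab(1), of a] ab(2) by auto
  define g where "g t = k (len a a + t * (len a b - len a a))" for t
  have im: "(\<lambda>t. len a a + t * (len a b - len a a)) ` {0..1} = {len a a..len a b}"
    using lt image_affinity_atLeastAtMost[of "len a b - len a a" "len a a" 0 1] by (simp add: algebra_simps)
  have "continuous_on {0..1} g" unfolding g_def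
    by (rule continuous_on_compose2[of "{len a a..len a b}" k]) (use k im in \<open>auto simp: homeomorphism_def intro!: continuous_intros\<close>)
  moreover have "inj_on g {0..1}"
  proof (rule inj_onI)
    fix s t assume st: "s \<in> {0..1}" "t \<in> {0..1}" "g s = g t"
    have "len a a + s * (len a b - len a a) \<in> {len a a..len a b}" "len a a + t * (len a b - len a a) \<in> {len a a..len a b}"
      using im st by blast+
    then have "len a a + s * (len a b - len a a) = len a a + t * (len a b - len a a)"
      using st(3) k unfolding g_def homeomorphism_def by metis
    then show "s = t" using lt by simp
  qed
  ultimately have "arc g" unfolding arc_def path_def by blast
  moreover have "path_image g = seg a b"
  proof -
    have "path_image g = k ` ((\<lambda>t. len a a + t * (len a b - len a a)) ` {0..1})"
      unfolding path_image_def g_def by (simp add: image_image)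
    then show ?thesis using im k by (simp add: homeomorphism_def)
  qed
  moreover have "pathstart g = a" "pathfinish g = b"
    using k seg_ends unfolding pathstart_def pathfinish_def g_def homeomorphism_def by auto
  ultimately show ?thesis using that by blast
qed

lemma connected_seg_minus_start:
  assumes ab: "linked a b" shows "connected (seg a b - {a})"
proof -
  obtain k where k: "homeomorphism (seg a b) {len a a..len a b} (len a) k" using seg_param[OF ab(1)] .
  have "seg a b - {a} = k ` {len a a<..len a b}"
  proof (intro subset_antisym subsetI)
    fix y assume y: "y \<in> seg a b - {a}"
    have "len a y \<in> {len a a..len a b}" using k y unfolding homeomorphism_def by blast
    moreover have "len a y \<noteq> len a a" using len_inj[OF ab, of y a] y by auto
    ultimately have "len a y \<in> {len a a<..len a b}" by auto
    moreover have "y = k (len a y)" using k y unfolding homeomorphism_def by simp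
    ultimately show "y \<in> k ` {len a a<..len a b}" by blast
  next
    fix y assume "y \<in> k ` {len a a<..len a b}"
    then obtain t where t: "t \<in> {len a a<..len a b}" "y = k t" by blast
    then have t': "t \<in> {len a a..len a b}" by auto
    have "y \<in> seg a b" "len a y = t" using k t' t(2) unfolding homeomorphism_def by blast+
    then show "y \<in> seg a b - {a}" using t by auto
  qed
  moreover have "continuous_on {len a a<..len a b} k"
    using k continuous_on_subset unfolding homeomorphism_def by (metis greaterThanAtMost_subseteq_atLeastAtMost_iff order_refl)
  ultimately show ?thesis by (simp add: connected_continuous_image)
qed

lemma connected_seg_interior:
  assumes ab: "linked a b" shows "connected (seg a b - {a, b})"
proof (cases "a = b")
  case True then show ?thesis using seg_refl linked_Z[OF ab] by simp
next
  case False
  then obtain g where "arc g" "path_image g = seg a b" "pathstart g = a" "pathfinish g = b" using seg_arc[OF ab] by blast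
  then show ?thesis using connected_simple_path_endless[of g] by (simp add: arc_imp_simple_path)
qed

lemma seg_point_near_start:
  assumes ab: "linked a b" "a \<noteq> b" and e: "e > 0"
  obtains z where "z \<in> seg a b" "z \<noteq> a" "z \<noteq> b" "dist z a < e" "seg a z \<subseteq> ball a e"
proof -
  have Fa: "F a = 0" using linked_Z ab by blast
  obtain \<delta> where \<delta>: "\<delta> > 0" "\<And>z. F z = 0 \<Longrightarrow> dist z a < \<delta> \<Longrightarrow> linked a z \<and> seg a z \<subseteq> cball a (e/2)"
    using local_seg[OF Fa, of "e/2"] e by auto
  have "a islimpt seg a b"
    using connected_imp_perfect[of "seg a b" a] continuum_seg[OF ab(1)] ab(2) seg_ends unfolding continuum_def
    by (metis singletonD)
  moreover define d where "d = min (dist a b) (min \<delta> e)"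
  moreover have "d > 0" using \<delta> e ab(2) unfolding d_def by auto
  ultimately obtain z where z: "z \<in> seg a b" "z \<noteq> a" "dist z a < d" unfolding islimpt_approachable by blast
  have "seg a z \<subseteq> cball a (e/2)" using \<delta>(2)[of z] z seg_in_Z[OF ab(1)] unfolding d_def by auto
  then have "seg a z \<subseteq> ball a e" using e by auto
  then show ?thesis using that[of z] z unfolding d_def by (auto simp: dist_commute)
qed

section \<open>Punctured level sets and continuation of arcs\<close>

lemma component_of_linked:
  assumes xz: "linked x z" "z \<noteq> x"
  shows "seg x z - {x} \<subseteq> connected_component_set (Z - {x}) z"
    "x \<in> closure (connected_component_set (Z - {x}) z)"
    "connected_component_set (Z - {x}) z \<in> components (Z - {x})" "z \<in> connected_component_set (Z - {x}) z"
proof -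
  have zZ: "z \<in> Z - {x}" using linked_Z[OF xz(1)] xz(2) by auto
  show s: "seg x z - {x} \<subseteq> connected_component_set (Z - {x}) z"
    by (rule connected_component_maximal[OF _ connected_seg_minus_start[OF xz(1)]])
      (use xz(2) seg_in_Z[OF xz(1)] in auto)
  show "x \<in> closure (connected_component_set (Z - {x}) z)"
    unfolding closure_approachable
  proof (intro allI impI)
    fix e :: real assume e: "e > 0"
    have "x \<noteq> z" using xz(2) by blast
    obtain y where "y \<in> seg x z" "y \<noteq> x" "dist y x < e" using seg_point_near_start[OF xz(1) \<open>x \<noteq> z\<close> e] by metis
    then show "\<exists>y\<in>connected_component_set (Z - {x}) z. dist y x < e" using s by blast
  qed
  show "connected_component_set (Z - {x}) z \<in> components (Z - {x})" "z \<in> connected_component_set (Z - {x}) z"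
    using zZ by (auto simp: components_def connected_component_refl)
qed

text \<open>There are no dead ends. A cut at \<open>y\<close> of \<open>seg p y\<close> together
  with a local component puts \<open>p\<close> on one side; by \<open>two_sided\<close> there are
  zeros near \<open>y\<close> on the other side, and the way from \<open>p\<close> to such a zero
  must pass through \<open>y\<close>.\<close>

lemma seg_extend:
  assumes py: "linked p y" and e: "e > 0"
  obtains z where "F z = 0" "dist z y < e" "z \<noteq> y" "linked p z" "y \<in> seg p z"
proof -
  have Fy: "F y = 0" using linked_Z[OF py] by blast
  obtain \<delta> where \<delta>: "\<delta> > 0" "\<And>z. F z = 0 \<Longrightarrow> dist z y < \<delta> \<Longrightarrow> z \<in> connected_component_set (Z \<inter> cball y e) y"
    using local_component[OF Fy e] by blast
  let ?L = "connected_component_set (Z \<inter> cball y e) y"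
  note L = continuum_component[OF Fy e]
  have rt: "rot (u y) \<bullet> u y = 0" "norm (rot (u y)) = 1" "- rot (u y) \<bullet> u y = 0" "norm (- rot (u y)) = 1"
    using norm_u[OF Fy] by auto
  have near: "\<exists>z. F z = 0 \<and> dist z y < d \<and> v \<bullet> (z - y) > 0" if "v = rot (u y) \<or> v = - rot (u y)" "d > 0" for v d
    using two_sided[OF Fy] rt that by metis
  show ?thesis
  proof (cases "p = y")
    case True
    obtain z where z: "F z = 0" "dist z y < min e \<delta>" "rot (u y) \<bullet> (z - y) > 0"
      using near[of "rot (u y)" "min e \<delta>"] e \<delta>(1) by auto
    then have "z \<in> ?L" using \<delta>(2) by auto
    then have "linked y z" using linkedI[OF L] by blast
    moreover have "z \<noteq> y" using z(3) by auto
    ultimately show ?thesis using that[of z] z(1,2) True seg_ends[of y z] by simp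
  next
    case False
    define K where "K = seg p y \<union> ?L"
    have K: "continuum K" unfolding K_def
      by (rule continuum_Un[OF continuum_seg[OF py] L(1)]) (use L(2) seg_ends in blast)
    then have K': "compact K" "K \<subseteq> Z" "y \<in> K" unfolding continuum_def K_def by auto
    obtain P Q \<eta> where "cuts K y P Q \<eta>" using continuum_cut[OF K'] .
    then have cut: "open P" "open Q" "P \<inter> Q = {}" "\<eta> > 0"
      "\<And>z k. F z = 0 \<Longrightarrow> k \<in> K \<Longrightarrow> dist z k < \<eta> \<Longrightarrow> z \<noteq> y \<Longrightarrow> z \<in> P \<union> Q"
      "\<And>z. F z = 0 \<Longrightarrow> dist z y < \<eta> \<Longrightarrow> rot (u y) \<bullet> (z - y) > 0 \<Longrightarrow> z \<in> P"
      "\<And>z. F z = 0 \<Longrightarrow> dist z y < \<eta> \<Longrightarrow> rot (u y) \<bullet> (z - y) < 0 \<Longrightarrow> z \<in> Q"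
      unfolding cuts_def by blast+
    have pPQ: "p \<in> P \<union> Q" using cut(4) cut(5)[of p p] linked_Z[OF py] False unfolding K_def by auto
    have "\<exists>z. F z = 0 \<and> dist z y < min e (min \<delta> \<eta>) \<and> z \<noteq> y \<and> ((p \<in> P \<and> z \<in> Q) \<or> (p \<in> Q \<and> z \<in> P))"
    proof (cases "p \<in> P")
      case True
      obtain z where "F z = 0" "dist z y < min e (min \<delta> \<eta>)" "- rot (u y) \<bullet> (z - y) > 0"
        using near[of "- rot (u y)" "min e (min \<delta> \<eta>)"] e \<delta>(1) cut(4) by auto
      then show ?thesis using True cut(7)[of z] by (intro exI[of _ z]) auto
    next
      case False
      obtain z where "F z = 0" "dist z y < min e (min \<delta> \<eta>)" "rot (u y) \<bullet> (z - y) > 0"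
        using near[of "rot (u y)" "min e (min \<delta> \<eta>)"] e \<delta>(1) cut(4) by auto
      then show ?thesis using False pPQ cut(6)[of z] by (intro exI[of _ z]) auto
    qed
    then obtain z where z: "F z = 0" "dist z y < min e (min \<delta> \<eta>)" "z \<noteq> y" "(p \<in> P \<and> z \<in> Q) \<or> (p \<in> Q \<and> z \<in> P)"
      by blast
    have zK: "z \<in> K" "p \<in> K" using \<delta>(2)[of z] z unfolding K_def by auto
    have pz: "linked p z" using linkedI[OF K zK(2,1)] .
    have sK: "seg p z \<subseteq> K" using seg_minimal[OF K zK(2,1)] .
    have "y \<in> seg p z"
    proof (rule ccontr)
      assume n: "y \<notin> seg p z"
      have "seg p z \<subseteq> P \<union> Q"
      proof
        fix x assume x: "x \<in> seg p z"
        then show "x \<in> P \<union> Q" using cut(5)[of x x] cut(4) sK seg_in_Z[OF pz x] n by auto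
      qed
      moreover have "connected (seg p z)" using continuum_seg[OF pz] unfolding continuum_def by blast
      ultimately show False using connectedD[of "seg p z" P Q] cut(1,2,3) z(4) seg_ends[of p z] seg_ends[of z p] by blast
    qed
    then show ?thesis using that[of z] z pz by auto
  qed
qed

lemma component_minus_point_closure:
  assumes "Q \<in> components (Z - {w})" shows "closure Q \<subseteq> Q \<union> {w}" "closure Q \<subseteq> Z"
proof -
  obtain V where V: "closed V" "Q = (Z - {w}) \<inter> V"
    using closedin_component[OF assms] by (auto simp: closedin_closed)
  have "closure Q \<subseteq> Z \<inter> V" by (rule closure_minimal) (use V closed_Z in auto)
  then show "closure Q \<subseteq> Q \<union> {w}" "closure Q \<subseteq> Z" using V by blast+
qed

text \<open>A point of a bounded component that is farthest from \<open>w\<close> along the curve could be passed by \<open>seg_extend\<close>.\<close>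

lemma component_minus_point_unbounded:
  assumes Q: "Q \<in> components (Z - {w})" shows "\<not> bounded Q"
proof
  assume b: "bounded Q"
  let ?C = "closure Q"
  note cl = component_minus_point_closure[OF Q]
  have Qc: "connected Q" "Q \<noteq> {}" using Q in_components_connected in_components_nonempty by auto
  have C: "continuum ?C" unfolding continuum_def using b Qc cl by (auto simp: compact_closure connected_imp_connected_closure)
  obtain q where q: "q \<in> Q" using Qc by blast
  \<comment> \<open>Measuring from \<open>w\<close>, whenever \<open>w\<close> is adherent to
    \<open>Q\<close>, settles the case that the farthest point is \<open>w\<close>: then
    \<open>a = w\<close>, and every other point is farther.\<close>
  define a where "a = (if w \<in> ?C then w else q)"
  have aC: "a \<in> ?C" using q closure_subset unfolding a_def by auto
  have lk: "linked a y" if "y \<in> ?C" for y using linkedI[OF C aC] that by blast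
  have "compact ?C" "?C \<noteq> {}" using C aC unfolding continuum_def by auto
  then obtain m where m: "m \<in> ?C" "\<And>y. y \<in> ?C \<Longrightarrow> len a y \<le> len a m"
    using continuous_attains_sup[of ?C "len a"] len_continuous lk by blast
  have "\<exists>z\<in>?C. z \<noteq> m \<and> m \<in> seg a z"
  proof (cases "m \<in> Q")
    case True
    obtain e where e: "e > 0" "\<And>z. F z = 0 \<Longrightarrow> dist z m < e \<Longrightarrow> z \<in> Q"
      using component_minus_point_open[OF Q True] by blast
    obtain z where "F z = 0" "dist z m < e" "z \<noteq> m" "m \<in> seg a z"
      using seg_extend[OF lk[OF m(1)] e(1)] by metis
    then show ?thesis using e(2) closure_subset by blast
  next
    case False
    then have "m = w" using m(1) cl(1) by blast
    then have "a = m" using m(1) unfolding a_def by simp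
    then show ?thesis using q closure_subset False seg_ends(1)[of a q] by (intro bexI[of _ q]) auto
  qed
  then obtain z where "z \<in> ?C" "z \<noteq> m" "m \<in> seg a z" by blast
  then show False using len_less[of a z m] lk m(2) by fastforce
qed

text \<open>Being unbounded, each component contains a continuum running from the ball of radius
  \<open>R\<close> to the sphere of radius \<open>R + 1\<close>, of diameter at least 1. These
  continua are disjoint and lie in one ball.\<close>

lemma finite_disjoint_components:
  assumes Q: "\<And>Q. Q \<in> \<Q> \<Longrightarrow> (\<exists>w. Q \<in> components (Z - {w})) \<and> Q \<inter> ball x R \<noteq> {}"
    and disj: "pairwise disjnt \<Q>" and R: "R > 0"
  shows "finite \<Q>"
proof -
  have "\<exists>f. \<forall>Q\<in>\<Q>. f Q \<subseteq> Q \<and> connected (f Q) \<and> f Q \<subseteq> Z \<inter> cball x (R+1) \<and> (\<exists>a\<in>f Q. \<exists>b\<in>f Q. 1 \<le> dist a b)"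
  proof (rule bchoice, rule ballI)
    fix Q assume "Q \<in> \<Q>"
    then obtain w q where w: "Q \<in> components (Z - {w})" "q \<in> Q" "q \<in> ball x R" using Q by blast
    have "\<not> Q \<subseteq> cball x (R+1)" using component_minus_point_unbounded[OF w(1)] bounded_cball bounded_subset by blast
    then obtain v where v: "v \<in> Q" "v \<notin> cball x (R+1)" by blast
    have Qp: "connected Q" "Q \<subseteq> Z" "Q \<subseteq> - {w}" using w(1) in_components_connected in_components_subset by blast+
    have op: "open (- {w})" by (rule open_Compl) simp
    note qv = connected_imp_linked[OF Qp(1,2) op Qp(3) w(2) v(1)]
    have K: "continuum (seg q v)" using continuum_seg[OF qv(1)] .
    then have Kc: "compact (seg q v)" "connected (seg q v)" "seg q v \<subseteq> Z" unfolding continuum_def by auto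
    have KQ: "seg q v \<subseteq> Q" using components_maximal[OF w(1) Kc(2)] Kc(3) qv(2) w(2) seg_ends by blast
    let ?S = "seg q v \<inter> cball x (R+1)"
    let ?C = "connected_component_set ?S q"
    have qS: "q \<in> ?S" using w(3) seg_ends by auto
    have C: "?C \<in> components ?S" using qS by (auto simp: components_def)
    have qC: "q \<in> ?C" using qS by (simp add: connected_component_refl)
    have CS: "?C \<subseteq> ?S" by (rule connected_component_subset)
    \<comment> \<open>Otherwise a clopen part of the connected set \<open>seg q v\<close> would
      contain \<open>q\<close> but not \<open>v\<close>.\<close>
    have "?C \<inter> sphere x (R+1) \<noteq> {}"
    proof
      assume "?C \<inter> sphere x (R+1) = {}"
      then obtain L where L: "compact L" "?C \<subseteq> L" "L \<subseteq> seg q v" "closed (seg q v - L)" "L \<subseteq> ball x (R+1)"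
        using component_clopen_part[OF compact_imp_closed[OF Kc(1)] C] by metis
      have "v \<in> seg q v - L" "q \<in> L" using L(2,5) qC v(2) seg_ends by (auto simp: subset_iff)
      moreover have "L \<inter> (seg q v - L) \<inter> seg q v = {}" "seg q v \<subseteq> L \<union> (seg q v - L)" by auto
      ultimately show False using connected_closedD[OF Kc(2), of L "seg q v - L"] compact_imp_closed[OF L(1)] L(4) seg_ends by blast
    qed
    then obtain b where "b \<in> ?C" "b \<in> sphere x (R+1)" by blast
    then have b: "b \<in> ?C" "dist x b = R + 1" by auto
    have "1 \<le> dist q b" using dist_triangle[of x b q] b(2) w(3) by (simp add: dist_commute)
    then show "\<exists>C. C \<subseteq> Q \<and> connected C \<and> C \<subseteq> Z \<inter> cball x (R+1) \<and> (\<exists>a\<in>C. \<exists>b\<in>C. 1 \<le> dist a b)"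
      using CS KQ Kc(3) qC b(1) connected_connected_component[of ?S q]
      by (intro exI[of _ ?C] conjI bexI[of _ q] bexI[of _ b]) auto
  qed
  then obtain f where f: "\<And>Q. Q\<in>\<Q> \<Longrightarrow> f Q \<subseteq> Q \<and> connected (f Q) \<and> f Q \<subseteq> Z \<inter> cball x (R+1) \<and> (\<exists>a\<in>f Q. \<exists>b\<in>f Q. 1 \<le> dist a b)"
    by blast
  have fne: "f Q \<noteq> {}" if "Q \<in> \<Q>" for Q using f[OF that] by blast
  have "finite (f ` \<Q>)"
  proof (rule finite_disjoint_large[where \<eta>=1 and x=x and R="R+1"])
    show "pairwise disjnt (f ` \<Q>)"
    proof (rule pairwiseI, elim imageE)
      fix A B P Q assume "A \<noteq> B" "A = f P" "P \<in> \<Q>" "B = f Q" "Q \<in> \<Q>"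
      moreover from this have "disjnt P Q" using disj by (metis pairwiseD)
      ultimately show "disjnt A B" using f unfolding disjnt_def by blast
    qed
  qed (use f in auto)
  moreover have "inj_on f \<Q>"
  proof (rule inj_onI, rule ccontr)
    fix P Q assume "P \<in> \<Q>" "Q \<in> \<Q>" "f P = f Q" "P \<noteq> Q"
    moreover from this have "disjnt P Q" using disj by (metis pairwiseD)
    moreover obtain p where "p \<in> f P" using fne[OF \<open>P \<in> \<Q>\<close>] by blast
    ultimately show False using f[OF \<open>P \<in> \<Q>\<close>] f[OF \<open>Q \<in> \<Q>\<close>] unfolding disjnt_def by auto
  qed
  ultimately show ?thesis using finite_imageD by blast
qed

end

lemma component_closed_under:
  assumes "G \<in> components S" "h \<in> G" "connected_component S h h'" shows "h' \<in> G"
  using assms unfolding components_def by (auto intro: connected_component_trans)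

context level
begin

section \<open>Branches and faces\<close>

text \<open>Components of the whole punctured set count the local arms correctly because
  \<open>Z\<close> contains no loops: two arms leaving \<open>x\<close> are not joined again
  elsewhere.\<close>

definition branches :: "real^2 \<Rightarrow> (real^2) set set" where
  "branches x = {Q \<in> components (Z - {x}). x \<in> closure Q}"

text \<open>A zero turns out to be regular exactly when it is not a branching point; see
  \<open>regular_not_brp\<close> and \<open>not_brp_regular\<close>.\<close>

definition regular :: "real^2 \<Rightarrow> bool" where
  "regular w \<longleftrightarrow> (\<exists>a b r. linked a b \<and> w \<in> seg a b \<and> w \<noteq> a \<and> w \<noteq> b \<and> r > 0 \<and> Z \<inter> ball w r \<subseteq> seg a b)"

lemma component_disjoint:
  assumes "P \<in> components S" "Q \<in> components S" "q \<in> P" "q \<in> Q" shows "P = Q"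
  using assms components_nonoverlap by blast

lemma finite_branches: "finite (branches x)"
proof (rule finite_disjoint_components[where R=1 and x=x])
  show "(\<exists>w. Q \<in> components (Z - {w})) \<and> Q \<inter> ball x 1 \<noteq> {}" if "Q \<in> branches x" for Q
  proof -
    have Q: "Q \<in> components (Z - {x})" "x \<in> closure Q" using that unfolding branches_def by auto
    have "\<exists>y\<in>Q. dist y x < 1" using Q(2) closure_approachable zero_less_one by blast
    then show ?thesis using Q(1) by (auto simp: dist_commute)
  qed
  show "pairwise disjnt (branches x)"
    unfolding pairwise_def disjnt_def branches_def using components_nonoverlap by blast
qed simp

lemma branch_of_linked:
  assumes "linked x z" "z \<noteq> x"
  shows "connected_component_set (Z - {x}) z \<in> branches x"
  using component_of_linked[OF assms] unfolding branches_def by auto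

text \<open>\<open>w\<close> is the last common point of the two arcs from \<open>x\<close>. Their
  remaining parts meet only in \<open>w\<close>, so a connected \<open>seg y b\<close> missing
  \<open>w\<close> would be split between them.\<close>

lemma seg_gate:
  assumes xy: "linked x y" and xb: "linked x b"
  obtains w where "w \<in> seg x y" "w \<in> seg x b" "seg x y \<inter> seg x b = seg x w" "w \<in> seg y b"
proof -
  let ?T = "seg x y \<inter> seg x b"
  have T: "continuum ?T" using continuum_Int continuum_seg assms by blast
  have lk: "linked x v" if "v \<in> ?T" for v using seg_linked[OF xy] that by blast
  have "compact ?T" using T unfolding continuum_def by blast
  moreover have "?T \<noteq> {}" using seg_ends(1)[of x y] seg_ends(1)[of x b] by blast
  ultimately obtain w where w: "w \<in> ?T" "\<And>v. v \<in> ?T \<Longrightarrow> len x v \<le> len x w"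
    using continuous_attains_sup[of ?T "len x"] len_continuous lk by blast
  have eq: "?T = seg x w"
  proof (intro subset_antisym subsetI)
    fix v assume "v \<in> ?T" then show "v \<in> seg x w" using seg_iff_len[OF xb, of v w] w by blast
  next
    fix v assume "v \<in> seg x w" then show "v \<in> ?T" using seg_subset[OF xy] seg_subset[OF xb] w(1) by blast
  qed
  have "w \<in> seg y b"
  proof (rule ccontr)
    assume n: "w \<notin> seg y b"
    have wy: "linked w y" and wb: "linked w b" using seg_linked[OF xy] seg_linked[OF xb] w(1) by blast+
    have yb: "linked y b" using linked_trans linked_sym wy wb by blast
    have c: "connected (seg y b)" "closed (seg y w)" "closed (seg w b)"
      using continuum_seg[OF yb] continuum_seg[OF linked_sym[OF wy]] continuum_seg[OF wb] compact_imp_closed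
      unfolding continuum_def by auto
    have "v = w" if v: "v \<in> seg y w" "v \<in> seg w b" for v
    proof -
      have v': "v \<in> seg w y" using v(1) seg_sym by blast
      have "v \<in> seg x y" "v \<in> seg x b" using seg_subset(2)[OF xy, of w] seg_subset(2)[OF xb, of w] w(1) v' v(2) by blast+
      then have "v \<in> seg x w" using eq by blast
      then show "v = w" using seg_order[OF xy _ _ v'] w(1) by blast
    qed
    then have d: "seg y w \<inter> seg w b \<inter> seg y b = {}" using n by blast
    have "seg y b \<subseteq> seg y w \<union> seg w b" using seg_triangle[OF linked_sym[OF wy] wb] .
    then show False using connected_closedD[OF c(1) d _ c(2,3)] seg_ends by blast
  qed
  then show ?thesis using that w(1) eq by blast
qed


text \<open>Choose a side branch \<open>f w\<close> at each such \<open>w\<close>. Every other point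
  of \<open>seg x b\<close> lies in the component of \<open>x\<close> or of \<open>b\<close>, hence
  not in \<open>f w\<close>. If two side branches overlapped, one of them with its root added would
  lie in the other. So they are disjoint, and all of them meet a ball around
  \<open>seg x b\<close>.\<close>

lemma finite_third_branch:
  assumes xb: "linked x b"
  shows "finite {w \<in> seg x b - {x, b}. \<exists>Q\<in>branches w. x \<notin> Q \<and> b \<notin> Q}" (is "finite ?W")
proof -
  have "\<exists>f. \<forall>w\<in>?W. f w \<in> branches w \<and> x \<notin> f w \<and> b \<notin> f w" by (rule bchoice) blast
  then obtain f where f: "\<And>w. w \<in> ?W \<Longrightarrow> f w \<in> branches w \<and> x \<notin> f w \<and> b \<notin> f w" by blast
  have fc: "f w \<in> components (Z - {w})" "w \<in> closure (f w)" "connected (f w)" "f w \<noteq> {}" "f w \<subseteq> Z - {w}" if "w \<in> ?W" for w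
  proof -
    show c: "f w \<in> components (Z - {w})" and "w \<in> closure (f w)" using f[OF that] unfolding branches_def by blast+
    show "connected (f w)" "f w \<noteq> {}" "f w \<subseteq> Z - {w}"
      using c in_components_connected in_components_nonempty in_components_subset by blast+
  qed
  have notin: "w' \<notin> f w" if w: "w \<in> ?W" "w' \<in> ?W" "w \<noteq> w'" for w w'
  proof
    assume w'f: "w' \<in> f w"
    have lw: "linked w x" "linked w b" using seg_linked[OF xb] w(1) linked_sym by blast+
    have ne: "x \<noteq> w" "b \<noteq> w" using w(1) by auto
    have "w' \<in> seg x w \<union> seg w b" using seg_triangle[OF linked_sym[OF lw(1)] lw(2)] w(2) by blast
    then show False
    proof
      assume "w' \<in> seg x w"
      then have "w' \<in> seg w x - {w}" using seg_sym w(3) by blast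
      then have "w' \<in> connected_component_set (Z - {w}) x" using component_of_linked(1)[OF lw(1) ne(1)] by blast
      then have "connected_component_set (Z - {w}) x = f w"
        using component_disjoint component_of_linked(3)[OF lw(1) ne(1)] fc(1)[OF w(1)] w'f by blast
      then show False using component_of_linked(4)[OF lw(1) ne(1)] f[OF w(1)] by blast
    next
      assume "w' \<in> seg w b"
      then have "w' \<in> seg w b - {w}" using w(3) by blast
      then have "w' \<in> connected_component_set (Z - {w}) b" using component_of_linked(1)[OF lw(2) ne(2)] by blast
      then have "connected_component_set (Z - {w}) b = f w"
        using component_disjoint component_of_linked(3)[OF lw(2) ne(2)] fc(1)[OF w(1)] w'f by blast
      then show False using component_of_linked(4)[OF lw(2) ne(2)] f[OF w(1)] by blast
    qed
  qed
  have dis: "f w \<inter> f w' = {}" if w: "w \<in> ?W" "w' \<in> ?W" "w \<noteq> w'" for w w'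
  proof (rule ccontr)
    assume ne: "f w \<inter> f w' \<noteq> {}"
    have c: "connected (insert w (f w))"
      by (rule connected_intermediate_closure[OF fc(3)[OF w(1)]]) (use fc(2)[OF w(1)] closure_subset in auto)
    have "F w = 0" using seg_in_Z[OF xb] w(1) by blast
    then have s: "insert w (f w) \<subseteq> Z - {w'}" using fc(5)[OF w(1)] notin[OF w] w(3) by auto
    have "insert w (f w) \<subseteq> f w'"
      by (rule components_maximal[OF fc(1)[OF w(2)] c s]) (use ne in blast)
    then show False using notin[OF w(2,1)] w(3) by blast
  qed
  have inj: "inj_on f ?W"
  proof (rule inj_onI, rule ccontr)
    fix w w' assume w: "w \<in> ?W" "w' \<in> ?W" "f w = f w'" "w \<noteq> w'"
    then show False using dis[OF w(1,2,4)] fc(4)[OF w(1)] by simp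
  qed
  obtain R where R: "R > 0" "seg x b \<subseteq> ball x R"
    using continuum_seg[OF xb] bounded_subset_ballD[of "seg x b" x] compact_imp_bounded unfolding continuum_def by blast
  have "finite (f ` ?W)"
  proof (rule finite_disjoint_components[OF _ _ R(1)])
    fix Q assume "Q \<in> f ` ?W"
    then obtain w where w: "w \<in> ?W" "Q = f w" by blast
    then have "w \<in> closure (f w) \<inter> ball x R" using fc(2)[OF w(1)] R(2) by blast
    then have "ball x R \<inter> f w \<noteq> {}" using open_Int_closure_eq_empty[OF open_ball] by blast
    then show "(\<exists>w. Q \<in> components (Z - {w})) \<and> Q \<inter> ball x R \<noteq> {}" using w fc(1)[OF w(1)] by blast
  next
    show "pairwise disjnt (f ` ?W)"
      unfolding pairwise_def disjnt_def using dis by blast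
  qed
  then show ?thesis using finite_imageD[OF _ inj] by blast
qed

lemma finite_avoid:
  fixes x :: "'a::metric_space"
  assumes "finite D" "x \<notin> D" obtains d where "d > 0" "\<And>y. y \<in> D \<Longrightarrow> d \<le> dist y x"
  using finite_set_avoid[OF assms(1), of x] assms(2) by (metis dist_commute)

text \<open>A zero \<open>z\<close> near \<open>x\<close> off the chosen arc of its branch leaves
  this arc at a gate \<open>w\<close>, and the component of \<open>Z - {w}\<close> containing
  \<open>z\<close> is a branch avoiding both ends of the arc. There are finitely many such gates, so
  near \<open>x\<close> there are none.\<close>

lemma branches_cover:
  assumes Fx: "F x = 0" and sel: "\<And>Q. Q \<in> branches x \<Longrightarrow> sel Q \<in> Q \<and> linked x (sel Q)"
  obtains r where "r > 0" "Z \<inter> ball x r \<subseteq> {x} \<union> (\<Union>Q\<in>branches x. seg x (sel Q))"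
proof -
  let ?W = "\<lambda>b. {w \<in> seg x b - {x, b}. \<exists>Q\<in>branches w. x \<notin> Q \<and> b \<notin> Q}"
  \<comment> \<open>The ends \<open>sel Q\<close> are included so that a gate within
    \<open>d/2\<close> of \<open>x\<close> is not an end either.\<close>
  define D where "D = (\<Union>Q\<in>branches x. insert (sel Q) (?W (sel Q)))"
  have "finite D" unfolding D_def using finite_branches finite_third_branch sel by auto
  moreover have "x \<notin> D"
    unfolding D_def using sel in_components_subset unfolding branches_def by fastforce
  ultimately obtain d where d: "d > 0" "\<And>y. y \<in> D \<Longrightarrow> d \<le> dist y x" using finite_avoid by blast
  obtain \<delta> where \<delta>: "\<delta> > 0" "\<And>z. F z = 0 \<Longrightarrow> dist z x < \<delta> \<Longrightarrow> linked x z \<and> seg x z \<subseteq> cball x (d/2)"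
    using local_seg[OF Fx, of "d/2"] d(1) by auto
  have "z \<in> {x} \<union> (\<Union>Q\<in>branches x. seg x (sel Q))" if z: "F z = 0" "dist z x < \<delta>" "z \<noteq> x" for z
  proof -
    have xz: "linked x z" "seg x z \<subseteq> cball x (d/2)" using \<delta>(2)[OF z(1,2)] by auto
    let ?Q = "connected_component_set (Z - {x}) z"
    have Q: "?Q \<in> branches x" using branch_of_linked[OF xz(1) z(3)] .
    define b where "b = sel ?Q"
    have b: "b \<in> ?Q" "linked x b" using sel[OF Q] unfolding b_def by auto
    obtain w where w: "w \<in> seg x z" "w \<in> seg x b" "seg x z \<inter> seg x b = seg x w" "w \<in> seg z b"
      using seg_gate[OF xz(1) b(2)] .
    have "dist w x \<le> d/2" using w(1) xz(2) by (force simp: dist_commute)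
    then have wD: "w \<notin> D" using d by force
    have "w \<noteq> x"
    proof
      assume "w = x"
      then have "x \<in> seg z b" using w(4) by simp
      then show False
        using seg_separates[of x z b ?Q] b(1) component_of_linked(4)[OF xz(1) z(3)]
          connected_component_subset[of "Z - {x}" z] by auto
    qed
    have "w \<noteq> b" using wD Q unfolding D_def b_def by blast
    have "w = z"
    proof (rule ccontr)
      assume "w \<noteq> z"
      then have zw: "z \<noteq> w" by simp
      have lwz: "linked w z" using seg_linked(2)[OF xz(1) w(1)] .
      let ?P = "connected_component_set (Z - {w}) z"
      have P: "?P \<in> branches w" using branch_of_linked[OF lwz zw] .
      have Psub: "connected ?P" "?P \<subseteq> Z" "w \<notin> ?P" "z \<in> ?P"
        using component_of_linked(4)[OF lwz zw] connected_component_subset[of "Z - {w}" z] by auto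
      have "x \<notin> ?P" using seg_separates[of w z x ?P] w(1) seg_sym[of x z] Psub by blast
      moreover have "b \<notin> ?P" using seg_separates[OF w(4) Psub] .
      ultimately have "w \<in> ?W b" using P w(2) \<open>w \<noteq> x\<close> \<open>w \<noteq> b\<close> by blast
      then show False using wD Q unfolding D_def b_def by blast
    qed
    then show ?thesis using w(2) Q unfolding b_def by blast
  qed
  then have "Z \<inter> ball x \<delta> \<subseteq> {x} \<union> (\<Union>Q\<in>branches x. seg x (sel Q))" by (fastforce simp: dist_commute)
  then show ?thesis using that \<delta>(1) by blast
qed

text \<open>When every branch at \<open>w\<close> contains \<open>x\<close> or \<open>b\<close>, the
  two halves of \<open>seg x b\<close> serve as the chosen arcs in
  \<open>branches_cover\<close>.\<close>

lemma regularI: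
  assumes xb: "linked x b" and w: "w \<in> seg x b" "w \<noteq> x" "w \<noteq> b"
    and br: "\<And>Q. Q \<in> branches w \<Longrightarrow> x \<in> Q \<or> b \<in> Q"
  shows "regular w"
proof -
  define sel where "sel Q = (if x \<in> Q then x else b)" for Q
  have lw: "linked w x" "linked w b" using seg_linked[OF xb w(1)] linked_sym by blast+
  have "sel Q \<in> Q \<and> linked w (sel Q)" if "Q \<in> branches w" for Q
    using br[OF that] lw unfolding sel_def by auto
  then obtain r where r: "r > 0" "Z \<inter> ball w r \<subseteq> {w} \<union> (\<Union>Q\<in>branches w. seg w (sel Q))"
    using branches_cover[OF seg_in_Z[OF xb w(1)], of sel] by blast
  have "seg w (sel Q) \<subseteq> seg x b" for Q
    using seg_subset[OF xb w(1)] seg_sym[of x w] unfolding sel_def by auto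
  then have "Z \<inter> ball w r \<subseteq> seg x b" using r(2) w(1) by blast
  then show ?thesis unfolding regular_def using xb w r(1) by blast
qed

text \<open>The local picture at \<open>x\<close>: \<open>B\<close> consists of the outer ends of
  the arms, one arm for each end. Nothing is claimed about regularity at the outer ends.\<close>

definition star :: "real^2 \<Rightarrow> (real^2) set \<Rightarrow> bool" where
  "star x B \<longleftrightarrow> finite B \<and> (\<forall>b\<in>B. linked x b \<and> b \<noteq> x \<and> (\<forall>w\<in>seg x b - {x, b}. regular w)) \<and>
     (\<forall>b\<in>B. \<forall>b'\<in>B. b \<noteq> b' \<longrightarrow> seg x b \<inter> seg x b' = {x}) \<and>
     (\<exists>r>0. Z \<inter> ball x r \<subseteq> {x} \<union> (\<Union>b\<in>B. seg x b))"

text \<open>One arm for each branch, shortened to end before the finitely many points where a third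
  branch leaves it.\<close>

lemma star_exists:
  assumes Fx: "F x = 0" and e: "\<epsilon> > 0"
  obtains B where "star x B" "\<And>b. b \<in> B \<Longrightarrow> seg x b \<subseteq> ball x \<epsilon>"
proof -
  let ?W = "\<lambda>b. {w \<in> seg x b - {x, b}. \<exists>Q\<in>branches w. x \<notin> Q \<and> b \<notin> Q}"
  obtain \<delta> where \<delta>: "\<delta> > 0" "\<And>z. F z = 0 \<Longrightarrow> dist z x < \<delta> \<Longrightarrow> linked x z \<and> seg x z \<subseteq> cball x 1"
    using local_seg[OF Fx, of 1] by auto
  have "\<exists>b. b \<in> Q \<and> linked x b \<and> seg x b \<subseteq> ball x \<epsilon> \<and> seg x b - {x} \<subseteq> Q \<and> (\<forall>w\<in>seg x b - {x,b}. regular w)" if Qb: "Q \<in> branches x" for Q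
  proof -
    have Q: "Q \<in> components (Z - {x})" "x \<in> closure Q" using Qb unfolding branches_def by auto
    obtain c where c: "c \<in> Q" "dist c x < \<delta>" using Q(2) \<delta>(1) closure_approachable by blast
    have cZ: "F c = 0" "c \<noteq> x" using in_components_subset[OF Q(1)] c(1) by auto
    have xc: "linked x c" using \<delta>(2)[OF cZ(1) c(2)] by blast
    obtain d where d: "d > 0" "\<And>y. y \<in> ?W c \<Longrightarrow> d \<le> dist y x"
      using finite_avoid[OF finite_third_branch[OF xc], of x] by auto
    have "x \<noteq> c" using cZ by simp
    obtain b where b: "b \<in> seg x c" "b \<noteq> x" "b \<noteq> c" "seg x b \<subseteq> ball x (min \<epsilon> d)"
      using seg_point_near_start[OF xc \<open>x \<noteq> c\<close>, of "min \<epsilon> d"] d(1) e by (metis min_less_iff_conj)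
    have eq: "connected_component_set (Z - {x}) c = Q"
      using component_disjoint[OF component_of_linked(3)[OF xc cZ(2)] Q(1) component_of_linked(4)[OF xc cZ(2)] c(1)] .
    have sub: "seg x b \<subseteq> seg x c" using seg_subset[OF xc b(1)] by blast
    have sQ: "seg x c - {x} \<subseteq> Q" using component_of_linked(1)[OF xc cZ(2)] eq by simp
    have "regular w" if w: "w \<in> seg x b - {x,b}" for w
    proof (rule regularI[OF xc])
      show "w \<in> seg x c" "w \<noteq> x" using w sub by auto
      have "c \<notin> seg x b" using len_less[OF xc b(1,3)] len_le[of x b c] seg_linked(1)[OF xc b(1)] by force
      then show "w \<noteq> c" using w by blast
      show "x \<in> P \<or> c \<in> P" if P: "P \<in> branches w" for P
      proof (rule ccontr)
        assume "\<not> ?thesis"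
        then have "w \<in> ?W c" using P \<open>w \<in> seg x c\<close> \<open>w \<noteq> x\<close> \<open>w \<noteq> c\<close> by blast
        then have "d \<le> dist w x" by (rule d(2))
        moreover have "w \<in> ball x (min \<epsilon> d)" using w b(4) by blast
        ultimately show False by (simp add: dist_commute)
      qed
    qed
    then show ?thesis using b(1,2,4) sQ sub seg_linked(1)[OF xc b(1)] by (intro exI[of _ b]) auto
  qed
  then obtain sel where sel: "\<And>Q. Q \<in> branches x \<Longrightarrow> sel Q \<in> Q \<and> linked x (sel Q) \<and> seg x (sel Q) \<subseteq> ball x \<epsilon> \<and>
      seg x (sel Q) - {x} \<subseteq> Q \<and> (\<forall>w\<in>seg x (sel Q) - {x,sel Q}. regular w)"
    by metis
  obtain r where r: "r > 0" "Z \<inter> ball x r \<subseteq> {x} \<union> (\<Union>Q\<in>branches x. seg x (sel Q))"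
    using branches_cover[OF Fx, of sel] sel by blast
  have "star x (sel ` branches x)"
    unfolding star_def
  proof (intro conjI ballI impI)
    show "finite (sel ` branches x)" using finite_branches by simp
    show "regular w" if "b \<in> sel ` branches x" "w \<in> seg x b - {x,b}" for b w
      using sel that by blast
    show "linked x b" "b \<noteq> x" if "b \<in> sel ` branches x" for b
      using sel that in_components_subset[of _ "Z - {x}"] unfolding branches_def by fastforce+
    show "seg x b \<inter> seg x b' = {x}" if b: "b \<in> sel ` branches x" "b' \<in> sel ` branches x" "b \<noteq> b'" for b b'
    proof -
      obtain Q Q' where Q: "Q \<in> branches x" "b = sel Q" "Q' \<in> branches x" "b' = sel Q'" using b by blast
      then have "Q \<noteq> Q'" using b(3) by blast
      then have "Q \<inter> Q' = {}" using Q components_nonoverlap unfolding branches_def by blast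
      then show ?thesis using sel[OF Q(1)] sel[OF Q(3)] Q(2,4) seg_ends by blast
    qed
    show "\<exists>r>0. Z \<inter> ball x r \<subseteq> {x} \<union> (\<Union>b\<in>sel ` branches x. seg x b)" using r by auto
  qed
  then show ?thesis using that[of "sel ` branches x"] sel by blast
qed

text \<open>Near a regular point \<open>Z\<close> lies in one arc, so every arm starts in the
  component of \<open>a\<close> or in that of \<open>b\<close>; three arms pairwise separated by
  \<open>w\<close> would occupy three components.\<close>

lemma regular_no_triod:
  assumes w: "regular w" and y: "linked w y1" "linked w y2" "linked w y3" "y1 \<noteq> w" "y2 \<noteq> w" "y3 \<noteq> w"
    and s: "w \<in> seg y1 y2" "w \<in> seg y1 y3" "w \<in> seg y2 y3"
  shows False
proof -
  obtain a b r where r: "linked a b" "w \<in> seg a b" "w \<noteq> a" "w \<noteq> b" "r > 0" "Z \<inter> ball w r \<subseteq> seg a b"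
    using w unfolding regular_def by blast
  have lw: "linked w a" "linked w b" using seg_linked[OF r(1,2)] linked_sym by blast+
  let ?C = "\<lambda>y. connected_component_set (Z - {w}) y"
  have ab: "?C y = ?C a \<or> ?C y = ?C b" if y: "linked w y" "y \<noteq> w" for y
  proof -
    have "w \<noteq> y" using y by simp
    obtain z where z: "z \<in> seg w y" "z \<noteq> w" "dist z w < r" using seg_point_near_start[OF y(1) \<open>w \<noteq> y\<close> r(5)] by metis
    have "z \<in> seg a b" using r(6) z seg_in_Z[OF y(1) z(1)] by (auto simp: dist_commute)
    then have "z \<in> seg w a \<or> z \<in> seg w b" using seg_triangle[OF linked_sym[OF lw(1)] lw(2)] seg_sym[of a w] by blast
    then have "z \<in> ?C a \<or> z \<in> ?C b"
      using component_of_linked(1)[OF lw(1)] component_of_linked(1)[OF lw(2)] r(3,4) z(2) by blast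
    moreover have "z \<in> ?C y" using component_of_linked(1)[OF y] z by blast
    ultimately show ?thesis
      using component_disjoint[of _ "Z - {w}" _ z] component_of_linked(3)[OF y]
        component_of_linked(3)[OF lw(1)] component_of_linked(3)[OF lw(2)] r(3,4) by metis
  qed
  have no: "?C y \<noteq> ?C y'" if y: "linked w y" "y \<noteq> w" "linked w y'" "y' \<noteq> w" "w \<in> seg y y'" for y y'
  proof
    assume eq: "?C y = ?C y'"
    have "y' \<notin> ?C y"
      by (rule seg_separates[OF y(5)]) (use component_of_linked(4)[OF y(1,2)] connected_component_subset[of "Z - {w}" y] in auto)
    then show False using eq component_of_linked(4)[OF y(3,4)] by simp
  qed
  show False using ab[OF y(1,4)] ab[OF y(2,5)] ab[OF y(3,6)] no[OF y(1,4) y(2,5) s(1)] no[OF y(1,4) y(3,6) s(2)] no[OF y(2,5) y(3,6) s(3)]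
    by metis
qed

section \<open>Signs and faces next to regular points\<close>

lemma normal_segment:
  assumes Fa: "F a = 0" and e: "e > 0" and s: "\<bar>s\<bar> = 1"
  obtains q where "q \<noteq> a" "closed_segment a q \<subseteq> ball a e" "\<And>x. x \<in> closed_segment a q \<Longrightarrow> x \<noteq> a \<Longrightarrow> s * F x > 0"
proof -
  obtain \<delta> where \<delta>: "\<delta> > 0" "\<And>t. 0 < t \<Longrightarrow> t < \<delta> \<Longrightarrow> F (a + t *\<^sub>R u a) > 0 \<and> F (a - t *\<^sub>R u a) < 0"
    using normal_signs[OF Fa] by blast
  define t where "t = min \<delta> e / 2"
  have t: "t > 0" "t < \<delta>" "t < e" using \<delta>(1) e unfolding t_def by auto
  define v where "v = s *\<^sub>R u a"
  have nv: "norm v = 1" using norm_u[OF Fa] s unfolding v_def by simp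
  have eq: "closed_segment a (a + t *\<^sub>R v) = {a + c *\<^sub>R v | c. 0 \<le> c \<and> c \<le> t}" using closed_segment_ray[OF t(1)] .
  have F: "s * F (a + c *\<^sub>R v) > 0" if "0 < c" "c \<le> t" for c
  proof -
    have "s = 1 \<or> s = -1" using s by linarith
    then show ?thesis using \<delta>(2)[of c] that t unfolding v_def by auto
  qed
  show ?thesis
  proof (rule that[of "a + t *\<^sub>R v"])
    show "a + t *\<^sub>R v \<noteq> a" using t nv by auto
    show "closed_segment a (a + t *\<^sub>R v) \<subseteq> ball a e" unfolding eq using t nv by (auto simp: dist_norm)
    show "s * F x > 0" if x: "x \<in> closed_segment a (a + t *\<^sub>R v)" "x \<noteq> a" for x
    proof -
      obtain c where "x = a + c *\<^sub>R v" "0 \<le> c" "c \<le> t" using x(1) unfolding eq by blast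
      then show ?thesis using F[of c] x(2) by (cases "c = 0") auto
    qed
  qed
qed

text \<open>A Jordan curve \<open>J\<close> containing the arc \<open>seg a b\<close> is closed up along the positive normals at \<open>a\<close> and \<open>b\<close>.
  Each side of \<open>J\<close> is connected near \<open>w\<close> (Janiszewski, with the part \<open>T0\<close> of \<open>J\<close> away from \<open>w\<close>),
  and both signs occur near \<open>w\<close>, so each side carries one sign.\<close>

lemma regular_local_sides:
  assumes reg: "regular w"
  obtains r where "r > 0" "\<And>h h'. dist h w < r \<Longrightarrow> dist h' w < r \<Longrightarrow> F h * F h' > 0 \<Longrightarrow> connected_component (- Z) h h'"
proof -
  obtain a b r0 where r0: "linked a b" "w \<in> seg a b" "w \<noteq> a" "w \<noteq> b" "r0 > 0" "Z \<inter> ball w r0 \<subseteq> seg a b"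
    using reg unfolding regular_def by blast
  let ?A = "seg a b"
  have Fab: "F a = 0" "F b = 0" "F w = 0" using linked_Z[OF r0(1)] seg_in_Z[OF r0(1,2)] by auto
  have ab: "a \<noteq> b" using r0(2,3) seg_refl[OF Fab(1)] by auto
  have A: "compact ?A" "?A \<subseteq> Z" using continuum_seg[OF r0(1)] unfolding continuum_def by auto
  \<comment> \<open>Half the distance keeps the normal segments at \<open>a\<close> and
    \<open>b\<close> disjoint.\<close>
  define d where "d = dist a b / 2"
  have d: "d > 0" using ab unfolding d_def by simp
  obtain qa where qa: "qa \<noteq> a" "closed_segment a qa \<subseteq> ball a d" "\<And>x. x \<in> closed_segment a qa \<Longrightarrow> x \<noteq> a \<Longrightarrow> 1 * F x > 0"
    using normal_segment[OF Fab(1) d, of 1] by auto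
  obtain qb where qb: "qb \<noteq> b" "closed_segment b qb \<subseteq> ball b d" "\<And>x. x \<in> closed_segment b qb \<Longrightarrow> x \<noteq> b \<Longrightarrow> 1 * F x > 0"
    using normal_segment[OF Fab(2) d, of 1] by auto
  let ?I1 = "closed_segment a qa" and ?I2 = "closed_segment b qb"
  have I1Z: "x = a" if "x \<in> ?I1" "x \<in> ?A" for x using qa(3)[of x] that A(2) by force
  have I2Z: "x = b" if "x \<in> ?I2" "x \<in> ?A" for x using qb(3)[of x] that A(2) by force
  have I12: "?I1 \<inter> ?I2 = {}"
  proof (rule ccontr)
    assume "?I1 \<inter> ?I2 \<noteq> {}"
    then obtain x where "dist a x < d" "dist b x < d" using qa(2) qb(2) by (auto simp: subset_iff)
    then show False using dist_triangle2[of a b x] unfolding d_def by linarith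
  qed
  have "qa \<in> - ?A" "qb \<in> - ?A" using qa(1) qb(1) I1Z[of qa] I2Z[of qb] by auto
  moreover have "path_connected (- ?A)"
    using compact_nonseparating[OF A] compact_imp_closed[OF A(1)] connected_open_path_connected by blast
  ultimately obtain g0 where g0: "path g0" "path_image g0 \<subseteq> - ?A" "pathstart g0 = qa" "pathfinish g0 = qb"
    unfolding path_connected_def by metis
  have "path_image g0 \<inter> ?I1 \<inter> ?I2 = {}" using I12 by blast
  moreover have "pathstart g0 \<in> ?I1" "pathfinish g0 \<in> ?I2" using g0 by auto
  ultimately obtain h where h: "arc h" "path_image h \<subseteq> path_image g0" "pathstart h \<in> ?I1" "pathfinish h \<in> ?I2"
    "path_image h \<inter> ?I1 = {pathstart h}" "path_image h \<inter> ?I2 = {pathfinish h}"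
    using arc_between_closed[OF g0(1), of ?I1 ?I2] closed_segment by metis
  let ?p1 = "pathstart h" and ?p2 = "pathfinish h"
  have hA: "path_image h \<inter> ?A = {}" using h(2) g0(2) by blast
  have p1: "?p1 \<noteq> a" and p2: "?p2 \<noteq> b"
    using hA seg_ends(1)[of a b] seg_ends(2)[of b a] by (metis disjoint_iff pathstart_in_path_image pathfinish_in_path_image)+
  let ?S1 = "closed_segment ?p1 a" and ?S2 = "closed_segment b ?p2"
  have S1: "?S1 \<subseteq> ?I1" and S2: "?S2 \<subseteq> ?I2" using h(3,4) by (simp_all add: subset_closed_segment)
  obtain g where g: "arc g" "path_image g = ?A" "pathstart g = a" "pathfinish g = b" using seg_arc[OF r0(1) ab] .
  define q where "q = (linepath ?p1 a +++ g) +++ linepath b ?p2"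
  have pg: "path g" using g(1) arc_imp_path by blast
  have a1: "arc (linepath ?p1 a +++ g)"
    by (rule arc_join) (use p1 g S1 I1Z in \<open>auto simp: arc_linepath\<close>)
  have "path_image (linepath ?p1 a +++ g) = ?S1 \<union> ?A" using g by (simp add: path_image_join)
  then have a2: "arc q" unfolding q_def
    by (intro arc_join a1) (use p2 g S1 S2 I12 I2Z in \<open>auto simp: arc_linepath\<close>)
  have qim: "path_image q = ?S1 \<union> ?A \<union> ?S2" unfolding q_def using g by (simp add: path_image_join)
  have qends: "pathstart q = ?p1" "pathfinish q = ?p2" unfolding q_def by simp_all
  define J where "J = q +++ reversepath h"
  have "path_image q \<inter> path_image h \<subseteq> {?p1, ?p2}"
    unfolding qim using S1 S2 hA h(5,6) by blast
  then have Jsp: "simple_path J" unfolding J_def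
    by (intro simple_path_join_loop a2) (use h(1) qends in \<open>auto intro: arc_reversepath\<close>)
  have Jcl: "pathfinish J = pathstart J" unfolding J_def using qends by simp
  have Jim: "path_image J = ?S1 \<union> ?A \<union> ?S2 \<union> path_image h"
    unfolding J_def using qends qim by (simp add: path_image_join)
  note JC = Jordan_inside_outside_plane[OF Jsp Jcl]
  have lw: "linked w a" "linked w b" using seg_linked[OF r0(1,2)] linked_sym by blast+
  obtain a' where a': "a' \<in> seg w a" "a' \<noteq> w" "a' \<noteq> a" "seg w a' \<subseteq> ball w r0"
    using seg_point_near_start[OF lw(1) r0(3) r0(5)] by metis
  obtain b' where b': "b' \<in> seg w b" "b' \<noteq> w" "b' \<noteq> b" "seg w b' \<subseteq> ball w r0"
    using seg_point_near_start[OF lw(2) r0(4) r0(5)] by metis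
  note la = seg_linked[OF lw(1) a'(1)] and lb = seg_linked[OF lw(2) b'(1)]
  \<comment> \<open>\<open>J\<close> without the open piece from \<open>a'\<close> over
    \<open>w\<close> to \<open>b'\<close>: a chain of continua, hence connected, and away from
    \<open>w\<close> by \<open>seg_not_mutual\<close>.\<close>
  let ?T0 = "seg a' a \<union> ?S1 \<union> path_image h \<union> ?S2 \<union> seg b' b"
  have subA: "seg w a \<subseteq> ?A" "seg w b \<subseteq> ?A" using seg_subset[OF r0(1,2)] seg_sym by blast+
  have TA: "seg a' a \<subseteq> ?A" "seg b' b \<subseteq> ?A" "seg w a' \<subseteq> ?A" "seg w b' \<subseteq> ?A"
    using seg_subset[OF lw(1) a'(1)] seg_subset[OF lw(2) b'(1)] subA by blast+
  have T0J: "?T0 \<subseteq> path_image J" unfolding Jim using TA by blast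
  have Acov: "?A \<subseteq> seg a' a \<union> seg w a' \<union> seg w b' \<union> seg b' b"
  proof -
    have "?A \<subseteq> seg a w \<union> seg w b" using seg_triangle[OF linked_sym[OF lw(1)] lw(2)] .
    moreover have "seg a w \<subseteq> seg w a' \<union> seg a' a" using seg_triangle[OF la] seg_sym by blast
    moreover have "seg w b \<subseteq> seg w b' \<union> seg b' b" using seg_triangle[OF lb] .
    ultimately show ?thesis by blast
  qed
  have K: "compact (seg a' a)" "connected (seg a' a)" "compact (seg b' b)" "connected (seg b' b)"
    using continuum_seg[OF la(2)] continuum_seg[OF lb(2)] unfolding continuum_def by auto
  have hK: "compact (path_image h)" "connected (path_image h)" using h(1) compact_arc_image connected_arc_image by auto
  have compT0: "compact ?T0" using K hK by (intro compact_Un compact_segment)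
  have conT0: "connected ?T0"
  proof -
    have "a \<in> seg a' a \<inter> ?S1" "?p1 \<in> (seg a' a \<union> ?S1) \<inter> path_image h"
      "?p2 \<in> (seg a' a \<union> ?S1 \<union> path_image h) \<inter> ?S2"
      "b \<in> (seg a' a \<union> ?S1 \<union> path_image h \<union> ?S2) \<inter> seg b' b" by auto
    then show ?thesis
      using K(2,4) hK(2) connected_Un connected_segment by (metis empty_iff)
  qed
  have wT0: "w \<notin> ?T0"
  proof -
    have "w \<notin> seg a' a" "w \<notin> seg b' b" using seg_not_mutual[OF lw(1) a'(1,2)] seg_not_mutual[OF lw(2) b'(1,2)] .
    moreover have "w \<notin> ?S1" "w \<notin> ?S2" using S1 S2 I1Z[OF _ r0(2)] I2Z[OF _ r0(2)] r0(3,4) by blast+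
    moreover have "w \<notin> path_image h" using hA r0(2) by blast
    ultimately show ?thesis by blast
  qed
  obtain r1 where r1: "r1 > 0" "ball w r1 \<subseteq> - ?T0"
    using open_contains_ball[of "- ?T0"] wT0 compact_imp_closed[OF compT0] by blast
  define r where "r = min r0 r1"
  have r: "r > 0" "r \<le> r0" "r \<le> r1" using r0(5) r1(1) unfolding r_def by auto
  have rT: "ball w r \<subseteq> - ?T0" using r1(2) subset_ball[OF r(3), of w] by blast
  \<comment> \<open>Since \<open>J\<close> outside \<open>?T0\<close> stays in
    \<open>ball w r0\<close>, the intersection of \<open>J\<close> and \<open>T\<close> is the
    connected \<open>?T0\<close>. Off \<open>J\<close> and \<open>T\<close> only points of that ball
    remain, and its zeros all lie on \<open>J\<close>.\<close>
  define T where "T = ?T0 \<union> - ball w r0"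
  have JT: "path_image J \<inter> T = ?T0"
  proof -
    have "path_image J \<subseteq> ?T0 \<union> ball w r0" unfolding Jim using Acov a'(4) b'(4) by blast
    then show ?thesis unfolding T_def using T0J by blast
  qed
  have notJ: "x \<notin> path_image J" if x: "dist x w < r" "F x \<noteq> 0" for x
  proof
    assume xJ: "x \<in> path_image J"
    have "x \<notin> ?T0" using rT x(1) by (auto simp: dist_commute)
    then have "x \<in> ?A" using xJ unfolding Jim by blast
    then show False using A(2) x(2) by auto
  qed
  have key: "connected_component (- Z) x y"
    if xy: "dist x w < r" "dist y w < r" "connected_component (- path_image J) x y" for x y
  proof -
    have "connected_component (- (path_image J \<union> T)) x y"
    proof (rule Janiszewski_plane)
      show "compact (path_image J)" using Jsp by (simp add: compact_simple_path_image)
      show "closed T" unfolding T_def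
        using closed_Un[OF compact_imp_closed[OF compT0] closed_Compl[OF open_ball]] .
      show "connected (path_image J \<inter> T)" unfolding JT by (rule conT0)
      have "ball w r \<subseteq> - T" unfolding T_def using rT subset_ball[OF r(2), of w] by blast
      then show "connected_component (- T) x y" unfolding connected_component_def
        using xy(1,2) by (intro exI[of _ "ball w r"]) (auto simp: dist_commute)
    qed (use xy in simp)
    moreover have "- (path_image J \<union> T) \<subseteq> - Z" unfolding T_def Jim using r0(6) by blast
    ultimately show ?thesis using connected_component_mono by blast
  qed
  have side: "connected_component (- path_image J) x y"
    if xy: "x \<in> X" "y \<in> X" "X = inside (path_image J) \<or> X = outside (path_image J)" for x y X
  proof -
    have "connected X" "X \<subseteq> - path_image J" using xy(3) JC(2,4) inside_Un_outside[of "path_image J"] by blast+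
    then show ?thesis using xy(1,2) unfolding connected_component_def by blast
  qed
  have sign: False if "connected_component (- Z) x y" "F x * F y < 0" for x y
  proof -
    obtain U where U: "connected U" "U \<subseteq> - Z" "x \<in> U" "y \<in> U"
      using \<open>connected_component (- Z) x y\<close> unfolding connected_component_def by blast
    have "U \<inter> Z = {}" using U(2) by blast
    then show False using sign_connected[OF U(1) _ U(3,4)] sign_connected[OF U(1) _ U(4,3)] \<open>F x * F y < 0\<close>
      by (auto simp: mult_less_0_iff)
  qed
  have "connected_component (- Z) x y" if xy: "dist x w < r" "dist y w < r" "F x * F y > 0" for x y
  proof -
    obtain s :: real where s: "\<bar>s\<bar> = 1" "s * F x < 0" "s * F y < 0"
    proof (cases "F x > 0")
      case True then show ?thesis using that[of "-1"] xy(3) by (auto simp: zero_less_mult_iff)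
    next
      case False then show ?thesis using that[of 1] xy(3) by (auto simp: zero_less_mult_iff)
    qed
    obtain k where k: "k \<noteq> w" "closed_segment w k \<subseteq> ball w r" "\<And>x. x \<in> closed_segment w k \<Longrightarrow> x \<noteq> w \<Longrightarrow> s * F x > 0"
      using normal_segment[OF Fab(3) r(1) s(1)] by blast
    have kr: "dist k w < r" using k(2) by (auto simp: dist_commute subset_iff)
    have sk: "s * F k > 0" using k(1,3) by auto
    have ne: "F x * F k < 0" "F k * F y < 0" using sk s by (auto simp: zero_less_mult_iff mult_less_0_iff)
    have "F x \<noteq> 0" "F y \<noteq> 0" "F k \<noteq> 0" using xy(3) sk by auto
    then have out: "x \<in> inside (path_image J) \<union> outside (path_image J)" "y \<in> inside (path_image J) \<union> outside (path_image J)"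
      "k \<in> inside (path_image J) \<union> outside (path_image J)"
      using notJ xy(1,2) kr inside_Un_outside[of "path_image J"] by blast+
    show ?thesis
    proof (rule ccontr)
      assume n: "\<not> ?thesis"
      have "\<not> connected_component (- path_image J) x y" using key[OF xy(1,2)] n by blast
      moreover have "\<not> connected_component (- path_image J) x k" using key[OF xy(1) kr] sign[of x k] ne by blast
      moreover have "\<not> connected_component (- path_image J) k y" using key[OF kr xy(2)] sign[of k y] ne by blast
      ultimately show False using out side by blast
    qed
  qed
  then show ?thesis using that[of r] r(1) by blast
qed

text \<open>The number \<open>s\<close> is 1 or -1 in all uses; it lets one argument serve for the
  positive and the negative components.\<close>

definition face :: "real \<Rightarrow> (real^2) set \<Rightarrow> bool" where
  "face s G \<longleftrightarrow> G \<in> components (- Z) \<and> (\<forall>g\<in>G. s * F g > 0)"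

lemma face_exists:
  assumes "s * F p > 0" "\<bar>s\<bar> = 1"
  obtains G where "face s G" "p \<in> G"
proof -
  let ?G = "connected_component_set (- Z) p"
  have p: "p \<in> - Z" using assms(1) by auto
  have G: "?G \<in> components (- Z)" "p \<in> ?G" using p by (auto simp: components_def connected_component_refl)
  have c: "connected ?G" "?G \<inter> Z = {}" using connected_component_subset[of "- Z" p] by auto
  have "s * F g > 0" if g: "g \<in> ?G" for g
  proof -
    have "F g \<noteq> 0" using c(2) g by auto
    moreover have "F g > 0 \<longleftrightarrow> F p > 0" using sign_connected[OF c G(2) g] sign_connected[OF c g G(2)] by blast
    moreover have "s = 1 \<or> s = - 1" using assms(2) by linarith
    ultimately show ?thesis using assms(1) by (elim disjE) auto
  qed
  then show ?thesis using that[of ?G] G unfolding face_def by blast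
qed

lemma component_is_face:
  assumes "G \<in> components (- Z)" shows "face 1 G \<or> face (-1) G"
proof -
  have c: "connected G" "G \<inter> Z = {}" using in_components_connected[OF assms] in_components_subset[OF assms] by auto
  obtain p where p: "p \<in> G" using in_components_nonempty[OF assms] by blast
  have nz: "F g \<noteq> 0" if "g \<in> G" for g using c(2) that by auto
  show ?thesis
  proof (cases "F p > 0")
    case True
    then show ?thesis using sign_connected[OF c p] assms unfolding face_def by auto
  next
    case False
    have "F g < 0" if "g \<in> G" for g using sign_connected[OF c that p] nz[OF that] False by fastforce
    then show ?thesis using assms unfolding face_def by auto
  qed
qed

text \<open>By \<open>regular_local_sides\<close> all points of sign \<open>s\<close> near
  \<open>w\<close> are joined off \<open>Z\<close>, so the face of one of them contains them
  all.\<close>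

lemma regular_face:
  assumes reg: "regular w" and s: "\<bar>s\<bar> = 1"
  obtains G r where "face s G" "w \<in> closure G" "r > 0" "\<And>h. dist h w < r \<Longrightarrow> s * F h > 0 \<Longrightarrow> h \<in> G"
proof -
  have Fw: "F w = 0" using reg seg_in_Z unfolding regular_def by blast
  obtain r where r: "r > 0" "\<And>h h'. dist h w < r \<Longrightarrow> dist h' w < r \<Longrightarrow> F h * F h' > 0 \<Longrightarrow> connected_component (- Z) h h'"
    using regular_local_sides[OF reg] by blast
  have ex: "\<exists>k. dist k w < e \<and> s * F k > 0" if e: "e > 0" for e
  proof -
    obtain k where k: "k \<noteq> w" "closed_segment w k \<subseteq> ball w e" "\<And>x. x \<in> closed_segment w k \<Longrightarrow> x \<noteq> w \<Longrightarrow> s * F x > 0"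
      using normal_segment[OF Fw e s] by blast
    then show ?thesis using ends_in_segment(2)[of k w] by (intro exI[of _ k]) (auto simp: dist_commute subset_iff)
  qed
  obtain k where k: "dist k w < r" "s * F k > 0" using ex[OF r(1)] by blast
  obtain G where G: "face s G" "k \<in> G" using face_exists[OF k(2) s] .
  have in_G: "h \<in> G" if h: "dist h w < r" "s * F h > 0" for h
  proof -
    have "F k * F h > 0" using k(2) h(2) s by (auto simp: zero_less_mult_iff)
    then have "connected_component (- Z) k h" using r(2)[OF k(1) h(1)] by blast
    then show ?thesis using component_closed_under G unfolding face_def by blast
  qed
  have "w \<in> closure G"
    unfolding closure_approachable
  proof (intro allI impI)
    fix e :: real assume "e > 0"
    then obtain h where "dist h w < min e r" "s * F h > 0" using ex[of "min e r"] r(1) by auto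
    then show "\<exists>y\<in>G. dist y w < e" using in_G[of h] by auto
  qed
  then show ?thesis using that G(1) r(1) in_G by blast
qed

lemma regular_face_unique:
  assumes reg: "regular w" and s: "\<bar>s\<bar> = 1" and G: "face s G" "w \<in> closure G" and H: "face s H" "w \<in> closure H"
  shows "G = H"
proof -
  obtain G0 r where G0: "face s G0" "w \<in> closure G0" "r > 0" "\<And>h. dist h w < r \<Longrightarrow> s * F h > 0 \<Longrightarrow> h \<in> G0"
    using regular_face[OF reg s] by blast
  have "K = G0" if K: "face s K" "w \<in> closure K" for K
  proof -
    obtain k where "k \<in> K" "dist k w < r" using K(2) G0(3) closure_approachable by blast
    moreover from this have "k \<in> G0" using G0(4) K(1) unfolding face_def by blast
    ultimately show ?thesis using K(1) G0(1) component_disjoint unfolding face_def by blast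
  qed
  then show ?thesis using G H by blast
qed

text \<open>Pigeonhole: among three components two have the same sign, but a regular point is
  adherent to only one face of each sign.\<close>

lemma regular_not_branching:
  assumes "regular w"
    and "A \<in> components (- Z)" "B \<in> components (- Z)" "C \<in> components (- Z)" "A \<noteq> B" "A \<noteq> C" "B \<noteq> C"
    and "w \<in> closure A" "w \<in> closure B" "w \<in> closure C"
  shows False
proof -
  have "face 1 X \<or> face (-1) X" if "X \<in> {A, B, C}" for X using component_is_face that assms by auto
  moreover have "X = Y" if "X \<in> {A, B, C}" "Y \<in> {A, B, C}" "face s X" "face s Y" "s = 1 \<or> s = -1" for X Y s
    using regular_face_unique[OF assms(1), of s X Y] that assms by auto
  ultimately show False using assms(5-7) by (metis insertCI)
qed

text \<open>The face of sign \<open>s\<close> adherent to a regular point is locally constant along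
  the arm, and the arm without its ends is connected. The point \<open>x\<close> is reached by
  taking closures.\<close>

lemma face_along_seg:
  assumes xb: "linked x b" "b \<noteq> x" and reg: "\<And>w. w \<in> seg x b - {x, b} \<Longrightarrow> regular w" and s: "\<bar>s\<bar> = 1"
  obtains G where "face s G" "seg x b - {x, b} \<subseteq> closure G" "x \<in> closure G"
    "\<And>H w. face s H \<Longrightarrow> w \<in> seg x b - {x, b} \<Longrightarrow> w \<in> closure H \<Longrightarrow> H = G"
proof -
  let ?A = "seg x b - {x, b}"
  have ne: "x \<noteq> b" using xb(2) by simp
  obtain z0 where z0: "z0 \<in> ?A" using seg_point_near_start[OF xb(1) ne zero_less_one] by (metis Diff_iff insertE singletonD)
  obtain G where G: "face s G" "z0 \<in> closure G" using regular_face[OF reg[OF z0] s] by blast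
  have all: "w \<in> closure G" if w: "w \<in> ?A" for w
  proof -
    have "z0 \<in> closure G \<longleftrightarrow> w \<in> closure G"
    proof (rule connected_equivalence_relation[OF connected_seg_interior[OF xb(1)] z0 w,
          where R = "\<lambda>v w. v \<in> closure G \<longleftrightarrow> w \<in> closure G"])
      fix v assume v: "v \<in> ?A"
      obtain G0 r where G0: "face s G0" "v \<in> closure G0" "r > 0" "\<And>h. dist h v < r \<Longrightarrow> s * F h > 0 \<Longrightarrow> h \<in> G0"
        using regular_face[OF reg[OF v] s] by blast
      have "v \<in> closure G \<longleftrightarrow> v' \<in> closure G" if v': "v' \<in> ?A \<inter> ball v r" for v'
      proof -
        obtain G1 r1 where G1: "face s G1" "v' \<in> closure G1" "r1 > 0" "\<And>h. dist h v' < r1 \<Longrightarrow> s * F h > 0 \<Longrightarrow> h \<in> G1"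
          using regular_face[OF reg s, of v'] v' by blast
        have "r - dist v v' > 0" using v' by simp
        then obtain k where k: "k \<in> G1" "dist k v' < r - dist v v'" using G1(2) closure_approachable by blast
        have "dist k v < r" using k(2) dist_triangle[of k v v'] by (simp add: dist_commute)
        then have "k \<in> G0" using G0(4) G1(1) k(1) unfolding face_def by blast
        then have "G0 = G1" using k(1) G0(1) G1(1) component_disjoint unfolding face_def by blast
        then show ?thesis
          using regular_face_unique[OF reg[OF v] s G0(1,2) G(1)] regular_face_unique[OF reg s G1(1,2) G(1)] v' G0(2) G1(2)
          by blast
      qed
      then show "\<exists>T. openin (top_of_set ?A) T \<and> v \<in> T \<and> (\<forall>v'\<in>T. v \<in> closure G \<longleftrightarrow> v' \<in> closure G)"
        using v G0(3) by (intro exI[of _ "?A \<inter> ball v r"]) (auto intro: openin_open_Int)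
    qed auto
    then show ?thesis using G(2) by blast
  qed
  have "x \<in> closure ?A"
    unfolding closure_approachable
    using seg_point_near_start[OF xb(1) ne] by (metis Diff_iff insertE singletonD)
  then have "x \<in> closure G" using all closure_mono[of ?A "closure G"] by auto
  moreover have "H = G" if "face s H" "w \<in> ?A" "w \<in> closure H" for H w
    using regular_face_unique[OF reg[OF that(2)] s that(1,3) G(1) all[OF that(2)]] .
  ultimately show ?thesis using that[of G] G(1) all by blast
qed

lemma no_zero_inside:
  assumes J: "compact J" and s: "\<bar>s\<bar> = 1" "\<And>z. z \<in> J \<Longrightarrow> s * F z \<ge> 0" and p: "p \<in> inside J" "F p = 0"
  shows False
proof -
  have W: "open (inside J)" "bounded (inside J)" "frontier (inside J) \<subseteq> J"
    using compact_imp_closed[OF J] compact_imp_bounded[OF J] by (auto simp: open_inside bounded_inside frontier_inside_subset)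
  have "s = 1 \<or> s = -1" using s(1) by linarith
  then show False
  proof
    assume s1: "s = 1"
    show False by (rule extremum_pos[OF W(1,2) p(1)]) (use s(2) s1 W(3) p(2) in auto)
  next
    assume s1: "s = -1"
    show False by (rule extremum_neg[OF W(1,2) p(1)]) (use s(2) s1 W(3) p(2) in fastforce)+
  qed
qed

lemma frontier_component_Z:
  assumes "G \<in> components (- Z)" shows "frontier G \<subseteq> Z"
proof -
  obtain y where "G = connected_component_set (- Z) y" using assms by (auto simp: components_def)
  then have "frontier G \<subseteq> frontier Z" using frontier_of_connected_component_subset[of "- Z" y] by simp
  then show ?thesis using frontier_subset_closed[OF closed_Z] by blast
qed

text \<open>A short normal segment on the side of sign \<open>s\<close> lies in the only face there,
  so the face can be entered from \<open>w\<close> along it.\<close>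

lemma regular_access:
  assumes reg: "regular w" and s: "\<bar>s\<bar> = 1" and G: "face s G" "w \<in> closure G"
  obtains q where "q \<in> G" "closed_segment w q - {w} \<subseteq> G"
proof -
  have Fw: "F w = 0" using reg seg_in_Z unfolding regular_def by blast
  obtain G0 r where G0: "face s G0" "w \<in> closure G0" "r > 0" "\<And>h. dist h w < r \<Longrightarrow> s * F h > 0 \<Longrightarrow> h \<in> G0"
    using regular_face[OF reg s] by blast
  have eq: "G0 = G" using regular_face_unique[OF reg s G0(1,2) G] .
  obtain q where q: "q \<noteq> w" "closed_segment w q \<subseteq> ball w r" "\<And>x. x \<in> closed_segment w q \<Longrightarrow> x \<noteq> w \<Longrightarrow> s * F x > 0"
    using normal_segment[OF Fw G0(3) s] by blast
  have "closed_segment w q - {w} \<subseteq> G"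
  proof
    fix x assume x: "x \<in> closed_segment w q - {w}"
    then have "dist x w < r" using q(2) by (auto simp: dist_commute)
    then show "x \<in> G" using G0(4) q(3) x eq by blast
  qed
  then show ?thesis using that[of q] q(1) ends_in_segment(2)[of q w] by blast
qed

text \<open>Otherwise a small punctured disc minus one branch, which is connected near \<open>x\<close>,
  would lie in \<open>G\<close> although both signs occur in it.\<close>

lemma face_at_least_two_branches:
  assumes st: "star x B" and s: "\<bar>s\<bar> = 1" and G: "face s G" "x \<in> closure G"
    and Fx: "F x = 0" and b0: "b0 = x \<or> b0 \<in> B"
  obtains b where "b \<in> B" "b \<noteq> b0" "seg x b - {x, b} \<subseteq> closure G"
proof (rule ccontr)
  assume neg: "\<not> thesis"
  note wit = that
  have only: "b = b0" if "b \<in> B" "seg x b - {x,b} \<subseteq> closure G" for b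
    using wit[OF that(1) _ that(2)] neg by blast
  have B: "finite B" "\<And>b. b\<in>B \<Longrightarrow> linked x b \<and> b \<noteq> x \<and> (\<forall>w\<in>seg x b - {x, b}. regular w)"
    using st unfolding star_def by auto
  obtain r where r: "r > 0" "Z \<inter> ball x r \<subseteq> {x} \<union> (\<Union>b\<in>B. seg x b)" using st unfolding star_def by blast
  obtain d where d: "d > 0" "\<And>b. b \<in> B \<Longrightarrow> d \<le> dist b x" using finite_avoid[OF B(1), of x] B(2) by blast
  define \<rho> where "\<rho> = min r d"
  have \<rho>: "\<rho> > 0" "\<rho> \<le> r" "\<rho> \<le> d" using r(1) d(1) unfolding \<rho>_def by auto
  \<comment> \<open>The value \<open>b0 = x\<close> encodes that no branch is excluded;
    \<open>?S\<close> is then just \<open>{x}\<close>.\<close>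
  have l0: "linked x b0" using b0 B(2) linked_refl[OF Fx] by blast
  let ?S = "seg x b0"
  have S: "compact ?S" "?S \<subseteq> Z" using continuum_seg[OF l0] unfolding continuum_def by auto
  \<comment> \<open>\<open>L\<close> is the far part of the excluded arm, empty if there is none. It
    is what \<open>?S\<close> has in common with \<open>L\<close> and the outside of the ball, and
    it is connected, as Janiszewski requires.\<close>
  obtain L where L: "compact L" "connected L" "L \<subseteq> ?S" "x \<notin> L" "?S \<subseteq> L \<union> ball x \<rho>"
  proof (cases "b0 = x")
    case True
    then show ?thesis using that[of "{}"] seg_refl[OF Fx] \<rho>(1) by auto
  next
    case False
    then have ne: "x \<noteq> b0" by simp
    obtain b' where b': "b' \<in> seg x b0" "b' \<noteq> x" "b' \<noteq> b0" "seg x b' \<subseteq> ball x \<rho>"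
      using seg_point_near_start[OF l0 ne \<rho>(1)] by metis
    note lb = seg_linked[OF l0 b'(1)]
    show ?thesis
    proof (rule that[of "seg b' b0"])
      show "compact (seg b' b0)" "connected (seg b' b0)" using continuum_seg[OF lb(2)] unfolding continuum_def by auto
      show "seg b' b0 \<subseteq> ?S" using seg_subset[OF l0 b'(1)] by blast
      show "x \<notin> seg b' b0" using seg_not_mutual[OF l0 b'(1,2)] .
      show "?S \<subseteq> seg b' b0 \<union> ball x \<rho>" using seg_triangle[OF lb] b'(4) by blast
    qed
  qed
  obtain r1 where r1: "r1 > 0" "ball x r1 \<subseteq> - L"
    using open_contains_ball[of "- L"] L(4) compact_imp_closed[OF L(1)] by blast
  define r2 where "r2 = min r1 \<rho>"
  have r2: "r2 > 0" "ball x r2 \<subseteq> - L" "ball x r2 \<subseteq> ball x \<rho>" using r1 \<rho>(1) unfolding r2_def by auto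
  obtain g where g: "g \<in> G" "dist g x < r2" using G(2) r2(1) closure_approachable by blast
  \<comment> \<open>A point \<open>k\<close> of the opposite sign near \<open>x\<close> serves as
    the target: a connected set from \<open>g\<close> to \<open>k\<close> must leave
    \<open>G\<close>.\<close>
  have s': "\<bar>- s\<bar> = 1" using s by simp
  obtain k where k: "k \<noteq> x" "closed_segment x k \<subseteq> ball x r2" "\<And>y. y \<in> closed_segment x k \<Longrightarrow> y \<noteq> x \<Longrightarrow> - s * F y > 0"
    using normal_segment[OF Fx r2(1) s'] by blast
  have kr: "dist k x < r2" and sk: "- s * F k > 0" using k by (auto simp: dist_commute subset_iff)
  have nS: "g \<in> - ?S" "k \<in> - ?S" using S(2) g(1) G(1) sk unfolding face_def by force+
  have "connected_component (- (?S \<union> (L \<union> - ball x \<rho>))) g k"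
  proof (rule Janiszewski_plane[OF S(1)])
    show "closed (L \<union> - ball x \<rho>)" using closed_Un[OF compact_imp_closed[OF L(1)] closed_Compl[OF open_ball]] .
    have "?S \<inter> (L \<union> - ball x \<rho>) = L" using L(3,5) by blast
    then show "connected (?S \<inter> (L \<union> - ball x \<rho>))" using L(2) by simp
    show "connected_component (- ?S) g k"
      using compact_nonseparating[OF S] nS connected_iff_connected_component by blast
    show "connected_component (- (L \<union> - ball x \<rho>)) g k"
      unfolding connected_component_def using r2 g(2) kr by (intro exI[of _ "ball x r2"]) (auto simp: dist_commute)
  qed
  then obtain U where U: "connected U" "U \<subseteq> - (?S \<union> (L \<union> - ball x \<rho>))" "g \<in> U" "k \<in> U"
    unfolding connected_component_def by blast
  have "k \<notin> G" using sk G(1) unfolding face_def by fastforce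
  then have "U \<inter> frontier G \<noteq> {}" using connected_Int_frontier[OF U(1)] U(3,4) g(1) by blast
  then obtain z where z: "z \<in> U" "z \<in> frontier G" by blast
  \<comment> \<open>The point where \<open>U\<close> leaves \<open>G\<close> is a zero in the ball
    and off the excluded arm, hence an interior point of another arm, which then borders
    \<open>G\<close>.\<close>
  have "z \<in> Z" using frontier_component_Z z(2) G(1) unfolding face_def by blast
  then have zZ: "F z = 0" by simp
  have zb: "z \<in> ball x \<rho>" "z \<notin> ?S" using z(1) U(2) by auto
  then have "z \<noteq> x" using seg_ends(1)[of x b0] by blast
  then obtain b where b: "b \<in> B" "z \<in> seg x b" using r(2) zZ zb(1) \<rho>(2) by auto
  have "z \<noteq> b" using d(2)[OF b(1)] zb(1) \<rho>(3) by (auto simp: dist_commute)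
  then have zA: "z \<in> seg x b - {x,b}" using b(2) \<open>z \<noteq> x\<close> by blast
  have zc: "z \<in> closure G" using z(2) unfolding frontier_def by blast
  have bl: "linked x b" "b \<noteq> x" "\<And>w. w \<in> seg x b - {x,b} \<Longrightarrow> regular w" using B(2)[OF b(1)] by blast+
  obtain H where H: "face s H" "seg x b - {x, b} \<subseteq> closure H" "x \<in> closure H"
    "\<And>H' w. face s H' \<Longrightarrow> w \<in> seg x b - {x, b} \<Longrightarrow> w \<in> closure H' \<Longrightarrow> H' = H"
    using face_along_seg[OF bl s] by metis
  have "G = H" using H(4)[OF G(1) zA zc] .
  then have "b = b0" using only[OF b(1)] H(2) by simp
  then show False using b(2) zb(2) by simp
qed

text \<open>Three branches bordering \<open>G\<close> would form a theta curve with a tripod in \<open>G\<close>;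
  one of its arcs would lie inside the Jordan curve formed by the other two.\<close>

lemma face_at_most_two_branches:
  assumes s: "\<bar>s\<bar> = 1" and G: "face s G"
    and l: "linked x a1" "linked x a2" "linked x a3" and ne: "a1 \<noteq> x" "a2 \<noteq> x" "a3 \<noteq> x"
    and dis: "seg x a1 \<inter> seg x a2 = {x}" "seg x a1 \<inter> seg x a3 = {x}" "seg x a2 \<inter> seg x a3 = {x}"
    and reg: "regular a1" "regular a2" "regular a3"
    and cl: "a1 \<in> closure G" "a2 \<in> closure G" "a3 \<in> closure G"
  shows False
proof -
  have Fa: "F a1 = 0" "F a2 = 0" "F a3 = 0" "F x = 0" using l linked_Z by blast+
  have a12: "a2 \<notin> seg x a1" "a3 \<notin> seg x a1" "a1 \<notin> seg x a2" "a3 \<notin> seg x a2" "a1 \<notin> seg x a3" "a2 \<notin> seg x a3"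
    using dis ne seg_ends by blast+
  then have d12: "a1 \<noteq> a2" "a1 \<noteq> a3" "a2 \<noteq> a3" using seg_ends by blast+
  have GZ: "F g \<noteq> 0" if "g \<in> G" for g using G that unfolding face_def by fastforce
  then have aG: "a1 \<notin> G" "a2 \<notin> G" "a3 \<notin> G" using Fa by blast+
  have SG: "seg x a1 \<inter> G = {}" "seg x a2 \<inter> G = {}" "seg x a3 \<inter> G = {}"
    using GZ seg_in_Z[OF l(1)] seg_in_Z[OF l(2)] seg_in_Z[OF l(3)] by blast+
  have "open G" "connected G" using G open_components[of "- Z" G] closed_Z in_components_connected unfolding face_def by auto
  then have pc: "path_connected G" using connected_open_path_connected by blast
  obtain q1 where q1: "q1 \<in> G" "closed_segment a1 q1 - {a1} \<subseteq> G" using regular_access[OF reg(1) s G cl(1)] .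
  obtain q2 where q2: "q2 \<in> G" "closed_segment a2 q2 - {a2} \<subseteq> G" using regular_access[OF reg(2) s G cl(2)] .
  obtain q3 where q3: "q3 \<in> G" "closed_segment a3 q3 - {a3} \<subseteq> G" using regular_access[OF reg(3) s G cl(3)] .
  obtain g where g: "path g" "path_image g \<subseteq> G" "pathstart g = q1" "pathfinish g = q2"
    using pc q1(1) q2(1) unfolding path_connected_def by metis
  define g' where "g' = linepath a1 q1 +++ g +++ linepath q2 a2"
  have g': "path g'" "pathstart g' = a1" "pathfinish g' = a2" unfolding g'_def using g by auto
  have "path_image g' = closed_segment a1 q1 \<union> path_image g \<union> closed_segment a2 q2"
    unfolding g'_def using g by (simp add: path_image_join closed_segment_commute Un_assoc)
  then have g'im: "path_image g' \<subseteq> G \<union> {a1, a2}" using q1(2) q2(2) g(2) by blast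
  obtain \<alpha> where al: "arc \<alpha>" "path_image \<alpha> \<subseteq> path_image g'" "pathstart \<alpha> = a1" "pathfinish \<alpha> = a2"
    using path_contains_arc[OF g' d12(1)] by metis
  have alG: "path_image \<alpha> \<subseteq> G \<union> {a1,a2}" using al(2) g'im by blast
  obtain m where m: "m \<in> path_image \<alpha>" "m \<in> G"
    using nonempty_simple_path_endless[of \<alpha>] al alG by (auto simp: arc_imp_simple_path)
  obtain k where k: "path k" "path_image k \<subseteq> G" "pathstart k = q3" "pathfinish k = m"
    using pc q3(1) m(2) unfolding path_connected_def by metis
  define k' where "k' = linepath a3 q3 +++ k"
  have k': "path k'" "pathstart k' = a3" "pathfinish k' = m" unfolding k'_def using k by auto
  have "path_image k' = closed_segment a3 q3 \<union> path_image k"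
    unfolding k'_def using k by (simp add: path_image_join)
  then have k'im: "path_image k' \<subseteq> G \<union> {a3}" using q3(2) k(2) by blast
  have a3al: "a3 \<notin> path_image \<alpha>" using alG aG(3) d12 by blast
  have k0: "pathstart k' \<in> {a3}" "pathfinish k' \<in> path_image \<alpha>" using k' m(1) by auto
  have d0: "path_image k' \<inter> {a3} \<inter> path_image \<alpha> = {}" using a3al by blast
  obtain \<beta> where be: "arc \<beta>" "path_image \<beta> \<subseteq> path_image k'" "pathstart \<beta> \<in> {a3}" "pathfinish \<beta> \<in> path_image \<alpha>"
    "path_image \<beta> \<inter> {a3} = {pathstart \<beta>}" "path_image \<beta> \<inter> path_image \<alpha> = {pathfinish \<beta>}"
    using arc_between_closed[OF k'(1) k0 closed_singleton closed_arc_image[OF al(1)] d0] by metis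
  \<comment> \<open>The centre of the tripod: \<open>\<alpha>\<close> runs from \<open>a1\<close> to
    \<open>a2\<close> through \<open>G\<close>, and \<open>\<beta>\<close> comes from
    \<open>a3\<close> and meets \<open>\<alpha>\<close> only in \<open>p\<close>.\<close>
  define p where "p = pathfinish \<beta>"
  have b3: "pathstart \<beta> = a3" using be(3) by simp
  have beG: "path_image \<beta> \<subseteq> G \<union> {a3}" using be(2) k'im by blast
  have pal: "p \<in> path_image \<alpha>" using be(4) p_def by simp
  have "p \<noteq> a3" using pal a3al by blast
  then have pG: "p \<in> G" using beG pathfinish_in_path_image[of \<beta>] unfolding p_def by blast
  then have pn: "p \<noteq> a1" "p \<noteq> a2" "p \<noteq> x" using aG GZ Fa by blast+
  obtain t where t: "t \<in> {0..1}" "\<alpha> t = p" using pal unfolding path_image_def by blast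
  have t01: "0 < t" "t < 1" using t pn al(3,4) by (auto simp: pathstart_def pathfinish_def less_le)
  let ?\<alpha>1 = "subpath 0 t \<alpha>" and ?\<alpha>2 = "subpath t 1 \<alpha>"
  have arc12: "arc ?\<alpha>1" "arc ?\<alpha>2" using arc_subpath_arc[OF al(1)] t01 by auto
  have im12: "path_image ?\<alpha>1 = \<alpha> ` {0..t}" "path_image ?\<alpha>2 = \<alpha> ` {t..1}" using t01 by (auto simp: path_image_subpath)
  have inj: "inj_on \<alpha> {0..1}" using al(1) unfolding arc_def by blast
  have int12: "path_image ?\<alpha>1 \<inter> path_image ?\<alpha>2 = {p}"
  proof (intro subset_antisym subsetI)
    fix y assume "y \<in> path_image ?\<alpha>1 \<inter> path_image ?\<alpha>2"
    then obtain c d where cd: "c \<in> {0..t}" "d \<in> {t..1}" "y = \<alpha> c" "y = \<alpha> d" unfolding im12 by blast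
    then have "c = d" using inj_onD[OF inj, of c d] t01 by auto
    then have "c = t" using cd(1,2) by auto
    then show "y \<in> {p}" using cd(3) t(2) by simp
  qed (use t t01 im12 in auto)
  have a1n: "a1 \<notin> path_image ?\<alpha>2"
  proof
    assume "a1 \<in> path_image ?\<alpha>2"
    then obtain d where "d \<in> {t..1}" "\<alpha> d = \<alpha> 0" unfolding im12 using al(3) by (auto simp: pathstart_def)
    then show False using inj_onD[OF inj, of d 0] t01 by auto
  qed
  have a2n: "a2 \<notin> path_image ?\<alpha>1"
  proof
    assume "a2 \<in> path_image ?\<alpha>1"
    then obtain d where "d \<in> {0..t}" "\<alpha> d = \<alpha> 1" unfolding im12 using al(4) by (auto simp: pathfinish_def)
    then show False using inj_onD[OF inj, of d 1] t01 by auto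
  qed
  have sub12: "path_image ?\<alpha>1 \<subseteq> path_image \<alpha>" "path_image ?\<alpha>2 \<subseteq> path_image \<alpha>"
    using path_image_subpath_subset[of 0 t \<alpha>] path_image_subpath_subset[of t 1 \<alpha>] t01 by auto
  have al1: "path_image ?\<alpha>1 \<subseteq> G \<union> {a1}" and al2: "path_image ?\<alpha>2 \<subseteq> G \<union> {a2}"
    using sub12 alG a1n a2n by blast+
  have e12: "pathstart ?\<alpha>1 = a1" "pathfinish ?\<alpha>1 = p" "pathstart ?\<alpha>2 = p" "pathfinish ?\<alpha>2 = a2"
    using t al(3,4) by (simp_all add: pathstart_def pathfinish_def subpath_def)
  obtain c1 where c1: "arc c1" "path_image c1 = seg x a1" "pathstart c1 = x" "pathfinish c1 = a1" using seg_arc[OF l(1) ne(1)[symmetric]] .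
  obtain c2 where c2: "arc c2" "path_image c2 = seg x a2" "pathstart c2 = x" "pathfinish c2 = a2" using seg_arc[OF l(2) ne(2)[symmetric]] .
  obtain c3 where c3: "arc c3" "path_image c3 = seg x a3" "pathstart c3 = x" "pathfinish c3 = a3" using seg_arc[OF l(3) ne(3)[symmetric]] .
  define P1 where "P1 = c1 +++ ?\<alpha>1"
  define P2 where "P2 = c2 +++ reversepath ?\<alpha>2"
  define P3 where "P3 = c3 +++ \<beta>"
  have i1: "path_image P1 = seg x a1 \<union> path_image ?\<alpha>1" unfolding P1_def using c1 e12 by (simp add: path_image_join)
  have i2: "path_image P2 = seg x a2 \<union> path_image ?\<alpha>2" unfolding P2_def using c2 e12 by (simp add: path_image_join)
  have i3: "path_image P3 = seg x a3 \<union> path_image \<beta>" unfolding P3_def using c3 b3 by (simp add: path_image_join)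
  have arcs: "arc P1" "arc P2" "arc P3"
  proof -
    have "seg x a1 \<inter> path_image ?\<alpha>1 \<subseteq> {a1}" using al1 SG by blast
    then show "arc P1" unfolding P1_def by (intro arc_join c1 arc12) (use c1 e12 in auto)
    have "seg x a2 \<inter> path_image ?\<alpha>2 \<subseteq> {a2}" using al2 SG by blast
    then show "arc P2" unfolding P2_def by (intro arc_join c2 arc_reversepath arc12) (use c2 e12 in auto)
    have "seg x a3 \<inter> path_image \<beta> \<subseteq> {a3}" using beG SG by blast
    then show "arc P3" unfolding P3_def by (intro arc_join c3 be(1)) (use c3 b3 in auto)
  qed
  have st: "pathstart P1 = x" "pathstart P2 = x" "pathstart P3 = x" "pathfinish P1 = p" "pathfinish P2 = p" "pathfinish P3 = p"
    unfolding P1_def P2_def P3_def using c1 c2 c3 e12 p_def by auto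
  have mem: "x \<in> path_image P1" "x \<in> path_image P2" "x \<in> path_image P3" "p \<in> path_image P1" "p \<in> path_image P2" "p \<in> path_image P3"
    using pathstart_in_path_image[of P1] pathstart_in_path_image[of P2] pathstart_in_path_image[of P3]
      pathfinish_in_path_image[of P1] pathfinish_in_path_image[of P2] pathfinish_in_path_image[of P3] st by auto
  have I12: "path_image P1 \<inter> path_image P2 = {x,p}"
  proof -
    have "seg x a1 \<inter> path_image ?\<alpha>2 = {}" using al2 SG a12 by blast
    moreover have "path_image ?\<alpha>1 \<inter> seg x a2 = {}" using al1 SG a12 by blast
    ultimately have "path_image P1 \<inter> path_image P2 \<subseteq> {x,p}" unfolding i1 i2 using dis(1) int12 by blast
    then show ?thesis using mem by blast
  qed
  have be\<alpha>: "path_image \<alpha> \<inter> path_image \<beta> = {p}" using be(6) p_def by blast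
  have I13: "path_image P1 \<inter> path_image P3 = {x,p}"
  proof -
    have "seg x a1 \<inter> path_image \<beta> = {}" using beG SG a12 by blast
    moreover have "path_image ?\<alpha>1 \<inter> seg x a3 = {}" using al1 SG a12 by blast
    moreover have "path_image ?\<alpha>1 \<inter> path_image \<beta> \<subseteq> {p}" using sub12 be\<alpha> by blast
    ultimately have "path_image P1 \<inter> path_image P3 \<subseteq> {x,p}" unfolding i1 i3 using dis(2) by blast
    then show ?thesis using mem by blast
  qed
  have I23: "path_image P2 \<inter> path_image P3 = {x,p}"
  proof -
    have "seg x a2 \<inter> path_image \<beta> = {}" using beG SG a12 by blast
    moreover have "path_image ?\<alpha>2 \<inter> seg x a3 = {}" using al2 SG a12 by blast
    moreover have "path_image ?\<alpha>2 \<inter> path_image \<beta> \<subseteq> {p}" using sub12 be\<alpha> by blast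
    ultimately have "path_image P2 \<inter> path_image P3 \<subseteq> {x,p}" unfolding i2 i3 using dis(3) by blast
    then show ?thesis using mem by blast
  qed
  \<comment> \<open>\<open>s * F\<close> vanishes on the arms and is positive in \<open>G\<close>,
    so it is nonnegative on the theta curve, and no zero can lie inside any of its three Jordan
    curves. Yet \<open>theta_curve_arc_inside\<close> places one of the zeros \<open>a1\<close>,
    \<open>a2\<close>, \<open>a3\<close> inside.\<close>
  have seg0: "s * F z \<ge> 0" if "z \<in> seg x a1 \<union> seg x a2 \<union> seg x a3 \<union> (G \<union> {a1,a2,a3})" for z
  proof -
    have "F z = 0 \<or> z \<in> G" using that Fa seg_in_Z[OF l(1)] seg_in_Z[OF l(2)] seg_in_Z[OF l(3)] by blast
    then show ?thesis using G unfolding face_def by fastforce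
  qed
  have nn: "s * F z \<ge> 0" if "z \<in> path_image P1 \<union> path_image P2 \<union> path_image P3" for z
    by (rule seg0) (use that al1 al2 beG in \<open>unfold i1 i2 i3, blast\<close>)
  have comp: "compact (path_image P1)" "compact (path_image P2)" "compact (path_image P3)"
    using arcs compact_arc_image by blast+
  have no: "q \<notin> inside (path_image R \<union> path_image R')" if "F q = 0" "R \<in> {P1,P2,P3}" "R' \<in> {P1,P2,P3}" for q R R'
  proof
    assume "q \<in> inside (path_image R \<union> path_image R')"
    moreover have "compact (path_image R \<union> path_image R')" using that(2,3) comp by (intro compact_Un) auto
    ultimately show False using no_zero_inside[OF _ s nn] that by blast
  qed
  have am: "a1 \<in> path_image P1 - {x,p}" "a2 \<in> path_image P2 - {x,p}" "a3 \<in> path_image P3 - {x,p}"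
    unfolding i1 i2 i3 using ne pn \<open>p \<noteq> a3\<close> seg_ends by blast+
  show False
    using theta_curve_arc_inside[OF arcs st I12 I13 I23] no[OF Fa(1), of P2 P3] no[OF Fa(2), of P1 P3] no[OF Fa(3), of P1 P2] am
    by blast
qed

section \<open>Counting arms and faces at a point\<close>

lemma star_Z:
  assumes "star x B" "b \<in> B" shows "linked x b" "b \<noteq> x" "\<And>w. w \<in> seg x b - {x, b} \<Longrightarrow> regular w"
  using assms unfolding star_def by auto

text \<open>Double counting: each arm borders exactly one face of sign \<open>s\<close>, and each
  such face at \<open>x\<close> borders exactly two arms.\<close>

lemma card_star_faces:
  assumes Fx: "F x = 0" and st: "star x B" and s: "\<bar>s\<bar> = 1"
  shows "finite {G. face s G \<and> x \<in> closure G}" "card B = 2 * card {G. face s G \<and> x \<in> closure G}"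
proof -
  let ?FS = "{G. face s G \<and> x \<in> closure G}"
  define N where "N G = {b \<in> B. seg x b - {x, b} \<subseteq> closure G}" for G
  have fB: "finite B" using st unfolding star_def by blast
  have disB: "seg x b \<inter> seg x b' = {x}" if "b \<in> B" "b' \<in> B" "b \<noteq> b'" for b b' using st that unfolding star_def by blast
  have "\<exists>G. face s G \<and> seg x b - {x, b} \<subseteq> closure G \<and> x \<in> closure G \<and>
      (\<forall>H. face s H \<longrightarrow> seg x b - {x, b} \<subseteq> closure H \<longrightarrow> H = G)" if b: "b \<in> B" for b
  proof -
    have bl: "linked x b" "b \<noteq> x" "\<And>w. w \<in> seg x b - {x,b} \<Longrightarrow> regular w" using star_Z[OF st b] by blast+
    then have ne: "x \<noteq> b" by simp
    obtain w where w: "w \<in> seg x b - {x, b}"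
      using seg_point_near_start[OF star_Z(1)[OF st b] ne zero_less_one] by (metis Diff_iff insertE singletonD)
    obtain G where G: "face s G" "seg x b - {x, b} \<subseteq> closure G" "x \<in> closure G"
      "\<And>H w. face s H \<Longrightarrow> w \<in> seg x b - {x, b} \<Longrightarrow> w \<in> closure H \<Longrightarrow> H = G"
      using face_along_seg[OF bl s] by metis
    have "H = G" if "face s H" "seg x b - {x, b} \<subseteq> closure H" for H
      using G(4)[OF that(1) w] that(2) w by blast
    then show ?thesis using G(1-3) by blast
  qed
  then obtain gm where gm: "\<And>b. b \<in> B \<Longrightarrow> face s (gm b) \<and> seg x b - {x, b} \<subseteq> closure (gm b) \<and> x \<in> closure (gm b)"
    "\<And>b H. b \<in> B \<Longrightarrow> face s H \<Longrightarrow> seg x b - {x, b} \<subseteq> closure H \<Longrightarrow> H = gm b"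
    by metis
  have c2: "card (N G) = 2" if G: "G \<in> ?FS" for G
  proof -
    have Gf: "face s G" "x \<in> closure G" using G by auto
    obtain b1 where b1: "b1 \<in> B" "seg x b1 - {x, b1} \<subseteq> closure G"
      using face_at_least_two_branches[OF st s Gf Fx, of x] by blast
    obtain b2 where b2: "b2 \<in> B" "b2 \<noteq> b1" "seg x b2 - {x, b2} \<subseteq> closure G"
      using face_at_least_two_branches[OF st s Gf Fx, of b1] b1(1) by blast
    have "N G \<subseteq> {b1, b2}"
    proof (rule ccontr)
      assume "\<not> N G \<subseteq> {b1, b2}"
      then obtain b3 where b3: "b3 \<in> B" "seg x b3 - {x, b3} \<subseteq> closure G" "b3 \<noteq> b1" "b3 \<noteq> b2" unfolding N_def by blast
      \<comment> \<open>The arms are shortened to interior points, which are regular, as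
        \<open>face_at_most_two_branches\<close> needs regular ends.\<close>
      have pick: "\<exists>a. a \<in> seg x b \<and> a \<noteq> x \<and> linked x a \<and> seg x a \<subseteq> seg x b \<and> regular a \<and> a \<in> closure G"
        if b: "b \<in> B" "seg x b - {x, b} \<subseteq> closure G" for b
      proof -
        have ne: "x \<noteq> b" using star_Z[OF st b(1)] by simp
        obtain w where w: "w \<in> seg x b" "w \<noteq> x" "w \<noteq> b"
          using seg_point_near_start[OF star_Z(1)[OF st b(1)] ne zero_less_one] by metis
        then show ?thesis
          using b seg_linked(1)[OF star_Z(1)[OF st b(1)] w(1)] seg_subset(1)[OF star_Z(1)[OF st b(1)] w(1)] star_Z(3)[OF st b(1), of w]
          by (intro exI[of _ w]) auto
      qed
      obtain a1 where a1: "a1 \<noteq> x" "linked x a1" "seg x a1 \<subseteq> seg x b1" "regular a1" "a1 \<in> closure G" using pick[OF b1] by blast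
      obtain a2 where a2: "a2 \<noteq> x" "linked x a2" "seg x a2 \<subseteq> seg x b2" "regular a2" "a2 \<in> closure G" using pick[OF b2(1,3)] by blast
      obtain a3 where a3: "a3 \<noteq> x" "linked x a3" "seg x a3 \<subseteq> seg x b3" "regular a3" "a3 \<in> closure G" using pick[OF b3(1,2)] by blast
      have dd: "seg x b1 \<inter> seg x b2 = {x}" "seg x b1 \<inter> seg x b3 = {x}" "seg x b2 \<inter> seg x b3 = {x}"
        using disB b1 b2 b3 by auto
      have "seg x a1 \<inter> seg x a2 = {x}" "seg x a1 \<inter> seg x a3 = {x}" "seg x a2 \<inter> seg x a3 = {x}"
        using a1(3) a2(3) a3(3) dd seg_ends(1)[of x] by blast+
      then show False
        using face_at_most_two_branches[OF s Gf(1) a1(2) a2(2) a3(2) a1(1) a2(1) a3(1)] a1 a2 a3 by blast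
    qed
    moreover have "{b1, b2} \<subseteq> N G" unfolding N_def using b1 b2 by blast
    ultimately have "N G = {b1, b2}" by blast
    then show ?thesis using b2(2) by simp
  qed
  have "?FS \<subseteq> gm ` B"
  proof
    fix G assume G: "G \<in> ?FS"
    then have "N G \<noteq> {}" using c2[OF G] by auto
    then show "G \<in> gm ` B" using gm(2) G unfolding N_def by blast
  qed
  then show fin: "finite ?FS" using fB finite_subset by blast
  have "B = \<Union>(N ` ?FS)" using gm(1) unfolding N_def by blast
  moreover have "card (\<Union>(N ` ?FS)) = (\<Sum>G\<in>?FS. card (N G))"
  proof (rule card_UN_disjoint[OF fin])
    show "\<forall>G\<in>?FS. finite (N G)" unfolding N_def using fB by simp
    show "\<forall>i\<in>?FS. \<forall>j\<in>?FS. i \<noteq> j \<longrightarrow> N i \<inter> N j = {}" unfolding N_def using gm(2) by blast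
  qed
  moreover have "(\<Sum>G\<in>?FS. card (N G)) = (\<Sum>G\<in>?FS. 2)" by (rule sum.cong) (use c2 in auto)
  ultimately show "card B = 2 * card ?FS" by simp
qed

lemma face_at_point:
  assumes Fx: "F x = 0" and s: "\<bar>s\<bar> = 1"
  obtains G where "face s G" "x \<in> closure G"
proof -
  obtain q where q: "q \<noteq> x" "closed_segment x q \<subseteq> ball x 1" "\<And>y. y \<in> closed_segment x q \<Longrightarrow> y \<noteq> x \<Longrightarrow> s * F y > 0"
    using normal_segment[OF Fx zero_less_one s] by blast
  have "s * F q > 0" using q(1,3) by auto
  then obtain G where G: "face s G" "q \<in> G" using face_exists s by metis
  have os: "open_segment x q \<subseteq> - Z"
  proof
    fix y assume "y \<in> open_segment x q"
    then have "s * F y > 0" using q(3)[of y] by (auto simp: open_segment_def)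
    then show "y \<in> - Z" by auto
  qed
  have "connected (insert q (open_segment x q))"
  proof (rule connected_intermediate_closure)
    show "connected (open_segment x q)" by (intro convex_connected convex_open_segment)
    have "closure (open_segment x q) = closed_segment x q" using q(1) by (metis closure_open_segment)
    then show "insert q (open_segment x q) \<subseteq> closure (open_segment x q)"
      using segment_open_subset_closed[of x q] by simp
  qed auto
  moreover have "insert q (open_segment x q) \<subseteq> - Z" using os q(1) q(3)[of q] by auto
  ultimately have "open_segment x q \<subseteq> G" using components_maximal G unfolding face_def by blast
  then have "closure (open_segment x q) \<subseteq> closure G" by (rule closure_mono)
  then have "x \<in> closure G" using q(1) by (auto simp: closure_open_segment)
  then show ?thesis using that G by blast
qed

text \<open>Written exactly like \<open>branching_point\<close> with \<open>- Z\<close> as the set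
  of nonzeros, so that both agree by unfolding.\<close>

definition brp :: "real^2 \<Rightarrow> bool" where
  "brp x \<longleftrightarrow> (\<exists>A B C. A \<in> components (- Z) \<and> B \<in> components (- Z) \<and> C \<in> components (- Z) \<and>
      A \<noteq> B \<and> A \<noteq> C \<and> B \<noteq> C \<and> x \<in> closure A \<and> x \<in> closure B \<and> x \<in> closure C)"

lemma brp_Z: assumes "brp x" shows "F x = 0"
proof (rule ccontr)
  assume "F x \<noteq> 0"
  then have x: "x \<in> - Z" by simp
  let ?G = "connected_component_set (- Z) x"
  have G: "?G \<in> components (- Z)" "x \<in> ?G" using x by (auto simp: components_def connected_component_refl)
  have o: "open ?G" using open_components[OF _ G(1)] closed_Z by auto
  have "A = ?G" if A: "A \<in> components (- Z)" "x \<in> closure A" for A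
  proof -
    have "?G \<inter> A \<noteq> {}" using open_Int_closure_eq_empty[OF o, of A] G(2) A(2) by blast
    then show ?thesis using component_disjoint A(1) G(1) by blast
  qed
  then show False using assms unfolding brp_def by metis
qed

text \<open>The arms number twice the positive faces and twice the negative ones, hence as many as
  all faces together. This count is therefore even, and at least 2 because a positive face exists at
  every zero.\<close>

lemma card_star:
  assumes Fx: "F x = 0" and st: "star x B"
  shows "even (card B)" "card B \<ge> 2" "brp x \<longleftrightarrow> card B \<ge> 3"
proof -
  let ?FS = "\<lambda>s. {G. face s G \<and> x \<in> closure G}"
  have c: "finite (?FS 1)" "card B = 2 * card (?FS 1)" "finite (?FS (-1))" "card B = 2 * card (?FS (-1))"
    using card_star_faces[OF Fx st] by auto
  show "even (card B)" using c by simp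
  obtain G where "G \<in> ?FS 1" using face_at_point[OF Fx, of 1] by auto
  then have "card (?FS 1) > 0" using c(1) card_gt_0_iff by blast
  then show "card B \<ge> 2" using c(2) by linarith
  let ?T = "{G \<in> components (- Z). x \<in> closure G}"
  have T: "?T = ?FS 1 \<union> ?FS (-1)" using component_is_face unfolding face_def by auto
  have "G \<notin> ?FS (-1)" if "G \<in> ?FS 1" for G
  proof
    assume "G \<in> ?FS (-1)"
    moreover have "G \<noteq> {}" using that in_components_nonempty unfolding face_def by auto
    ultimately show False using that unfolding face_def by fastforce
  qed
  then have "?FS 1 \<inter> ?FS (-1) = {}" by blast
  then have cT: "card ?T = card B" "finite ?T" unfolding T using c card_Un_disjoint[of "?FS 1" "?FS (-1)"] by auto
  show "brp x \<longleftrightarrow> card B \<ge> 3"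
  proof
    assume "brp x"
    then obtain X Y W where "{X,Y,W} \<subseteq> ?T" "X \<noteq> Y" "X \<noteq> W" "Y \<noteq> W" unfolding brp_def by blast
    then show "card B \<ge> 3" using card_mono[OF cT(2), of "{X,Y,W}"] cT(1) by auto
  next
    assume "card B \<ge> 3"
    define FT where "FT = ?T"
    have "3 \<le> card FT" using cT(1) \<open>card B \<ge> 3\<close> unfolding FT_def by simp
    then obtain T where T: "T \<subseteq> FT" "card T = 3" by (metis obtain_subset_with_card_n)
    then obtain X Y W where d: "T = {X,Y,W}" "X \<noteq> Y" "X \<noteq> W" "Y \<noteq> W" by (auto simp: card_3_iff)
    have m: "A \<in> components (- Z)" "x \<in> closure A" if "A \<in> {X,Y,W}" for A
      using that T(1) d(1) unfolding FT_def by blast+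
    show "brp x" unfolding brp_def
      by (rule exI[of _ X], rule exI[of _ Y], rule exI[of _ W]) (simp add: m d)
  qed
qed

lemma regular_not_brp: "regular w \<Longrightarrow> \<not> brp w"
  unfolding brp_def using regular_not_branching by blast

text \<open>There are then exactly two arms, and since they meet only in \<open>x\<close>, the gate
  lemma puts \<open>x\<close> on the arc between their outer ends.\<close>

lemma not_brp_regular:
  assumes Fx: "F x = 0" and n: "\<not> brp x" shows "regular x"
proof -
  obtain B where B: "star x B" using star_exists[OF Fx zero_less_one] by metis
  have "card B = 2" using card_star[OF Fx B] n by linarith
  then obtain a b where ab: "B = {a,b}" "a \<noteq> b" by (auto simp: card_2_iff)
  have l: "linked x a" "linked x b" "a \<noteq> x" "b \<noteq> x" using star_Z[OF B] ab by auto
  have i: "seg x a \<inter> seg x b = {x}" using B ab unfolding star_def by blast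
  obtain r where r: "r > 0" "Z \<inter> ball x r \<subseteq> {x} \<union> (\<Union>b\<in>B. seg x b)" using B unfolding star_def by blast
  have lab: "linked a b" using linked_trans linked_sym l by blast
  obtain w where w: "w \<in> seg x a" "w \<in> seg x b" "seg x a \<inter> seg x b = seg x w" "w \<in> seg a b"
    using seg_gate[OF l(1,2)] .
  have wx: "w = x" using w(1,2) i by blast
  then have xab: "x \<in> seg a b" using w(4) by simp
  have "seg x a \<union> seg x b \<subseteq> seg a b" using seg_subset[OF lab xab] seg_sym by blast
  then have "Z \<inter> ball x r \<subseteq> seg a b" using r(2) ab(1) xab by auto
  then show ?thesis unfolding regular_def using lab xab l(3,4) r(1) by blast
qed

text \<open>In a star all interior points of the arms are regular, and the finitely many outer ends
  stay at distance \<open>d\<close>.\<close>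

lemma brp_isolated:
  assumes Fx: "F x = 0"
  obtains r where "r > 0" "\<And>w. dist w x < r \<Longrightarrow> w \<noteq> x \<Longrightarrow> \<not> brp w"
proof -
  obtain B where B: "star x B" using star_exists[OF Fx zero_less_one] by metis
  obtain r where r: "r > 0" "Z \<inter> ball x r \<subseteq> {x} \<union> (\<Union>b\<in>B. seg x b)" using B unfolding star_def by blast
  have fin: "finite B" using B unfolding star_def by blast
  obtain d where d: "d > 0" "\<And>b. b \<in> B \<Longrightarrow> d \<le> dist b x" using finite_avoid[OF fin, of x] star_Z[OF B] by blast
  have "\<not> brp w" if w: "dist w x < min r d" "w \<noteq> x" for w
  proof
    assume bw: "brp w"
    have "w \<in> Z \<inter> ball x r" using brp_Z[OF bw] w(1) by (simp add: dist_commute)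
    then obtain b where b: "b \<in> B" "w \<in> seg x b" using r(2) w(2) by blast
    have "w \<noteq> b" using d(2)[OF b(1)] w(1) by auto
    then have "regular w" using star_Z(3)[OF B b(1)] b(2) w(2) by blast
    then show False using regular_not_brp bw by blast
  qed
  then show ?thesis using that[of "min r d"] r(1) d(1) by auto
qed

lemma brp_no_islimpt: "\<not> x islimpt {b. brp b}"
proof
  assume l: "x islimpt {b. brp b}"
  have "{b. brp b} \<subseteq> Z" using brp_Z by auto
  then have "x islimpt Z" using l islimpt_subset by blast
  then have "x \<in> Z" using closed_Z closed_limpt by blast
  then have "F x = 0" by simp
  then obtain r where "r > 0" "\<And>w. dist w x < r \<Longrightarrow> w \<noteq> x \<Longrightarrow> \<not> brp w" using brp_isolated by blast
  then show False using l unfolding islimpt_approachable by blast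
qed

lemma closed_brp: "closed {b. brp b}"
  using brp_no_islimpt closed_limpt by blast

section \<open>Local models of the level set\<close>

lemma regular_locally_interval:
  assumes reg: "regular x"
  shows "\<exists>U. open U \<and> x \<in> U \<and> (\<exists>a b::real. a < b \<and> (Z \<inter> U) homeomorphic {a<..<b})"
proof -
  obtain a b r where r: "linked a b" "x \<in> seg a b" "x \<noteq> a" "x \<noteq> b" "r > 0" "Z \<inter> ball x r \<subseteq> seg a b"
    using reg unfolding regular_def by blast
  define l where "l = len a a"
  define m where "m = len a b"
  define t where "t = len a x"
  obtain k where k: "homeomorphism (seg a b) {l..m} (len a) k" using seg_param[OF r(1)] unfolding l_def m_def .
  have la: "linked a x" using seg_linked(1)[OF r(1,2)] .
  have lt: "l < t" "t < m" unfolding l_def t_def m_def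
    using len_less[OF la seg_ends(1) r(3)[symmetric]] len_less[OF r(1,2,4)] by auto
  have kx: "k t = x" "k t \<in> ball x r" using k r(2,5) unfolding homeomorphism_def t_def by auto
  have "continuous_on {l..m} k" using k unfolding homeomorphism_def by blast
  then obtain d where d: "d > 0" "\<And>s. s \<in> {l..m} \<Longrightarrow> dist s t < d \<Longrightarrow> dist (k s) x < r"
    using lt r(5) kx(1) unfolding continuous_on_iff by (metis atLeastAtMost_iff less_imp_le)
  define e where "e = min d (min (t - l) (m - t))"
  have e: "e > 0" "e \<le> d" "l \<le> t - e" "t + e \<le> m" using d(1) lt unfolding e_def by auto
  let ?I = "{t - e<..<t + e}"
  \<comment> \<open>The arc may come back to the ball away from \<open>x\<close>. Removing the
    compact image of the parameters not within \<open>e\<close> of \<open>t\<close> leaves just one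
    open piece.\<close>
  define T where "T = k ` ({l..t - e} \<union> {t + e..m})"
  define U where "U = ball x r - T"
  have "compact T" unfolding T_def
    by (rule compact_continuous_image) (use k e in \<open>auto simp: homeomorphism_def intro: continuous_on_subset\<close>)
  then have oU: "open U" unfolding U_def using compact_imp_closed open_Diff by blast
  have inj: "s = s'" if "s \<in> {l..m}" "s' \<in> {l..m}" "k s = k s'" for s s'
    using k that unfolding homeomorphism_def by metis
  have notT: "k s \<notin> T" if s: "s \<in> ?I" for s
  proof
    assume "k s \<in> T"
    then obtain s' where s': "s' \<in> {l..t - e} \<union> {t + e..m}" "k s = k s'" unfolding T_def by blast
    then have "s = s'" using inj[of s s'] s e by auto
    then show False using s s' by auto
  qed
  have "Z \<inter> U = k ` ?I"
  proof (intro subset_antisym subsetI)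
    fix z assume z: "z \<in> Z \<inter> U"
    then have zs: "z \<in> seg a b" using r(6) unfolding U_def by blast
    then have "k (len a z) = z" "len a z \<in> {l..m}" using k unfolding homeomorphism_def by auto
    moreover from this have "len a z \<notin> {l..t - e} \<union> {t + e..m}" using z unfolding U_def T_def by force
    ultimately show "z \<in> k ` ?I" by (intro image_eqI[of _ _ "len a z"]) auto
  next
    fix z assume "z \<in> k ` ?I"
    then obtain s where s: "s \<in> ?I" "z = k s" by blast
    then have sl: "s \<in> {l..m}" "dist s t < d" using e by (auto simp: dist_real_def)
    have "z \<in> seg a b" using k sl(1) s(2) unfolding homeomorphism_def by blast
    then have "F z = 0" using seg_in_Z[OF r(1)] by blast
    then show "z \<in> Z \<inter> U" using d(2)[OF sl] notT[OF s(1)] s(2) unfolding U_def by (auto simp: dist_commute)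
  qed
  moreover have "homeomorphism ?I (k ` ?I) k (len a)"
  proof (rule homeomorphism_of_subsets[OF homeomorphism_symD[OF k]])
    show sub: "?I \<subseteq> {l..m}" using e by auto
    show "k ` ?I \<subseteq> seg a b" using image_mono[OF sub, of k] k unfolding homeomorphism_def by simp
  qed simp
  ultimately have "(Z \<inter> U) homeomorphic ?I"
    using homeomorphic_def homeomorphic_sym by metis
  moreover have "x \<in> U" using kx notT[of t] e(1) r(5) unfolding U_def by auto
  moreover have "t - e < t + e" using e(1) by simp
  ultimately show ?thesis using oU by blast
qed

text \<open>As the number of arms is even, they can be matched with the rays of half as many lines
  through 0, each arm being laid along its ray by \<open>len\<close>. The argument applies at every
  zero.\<close>

lemma star_locally_segments:
  assumes Fx: "F x = 0"
  shows "\<exists>U. open U \<and> x \<in> U \<and>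
             (\<exists>(S :: (real^2) set set) p. finite S \<and> S \<noteq> {} \<and>
                (\<forall>s\<in>S. p \<in> s \<and> (\<exists>a b. s = open_segment a b)) \<and>
                (Z \<inter> U) homeomorphic \<Union>S)"
proof -
  obtain B where B: "star x B" using star_exists[OF Fx zero_less_one] by metis
  obtain r where r: "r > 0" "Z \<inter> ball x r \<subseteq> {x} \<union> (\<Union>b\<in>B. seg x b)" using B unfolding star_def by blast
  have fin: "finite B" using B unfolding star_def by blast
  have dis: "seg x b \<inter> seg x b' = {x}" if "b \<in> B" "b' \<in> B" "b \<noteq> b'" for b b' using B that unfolding star_def by blast
  note SB = star_Z(1,2)[OF B]
  obtain n where n: "card B = 2 * n" "n \<ge> 1" using card_star(1,2)[OF Fx B] by (elim evenE) auto
  define tau where "tau y = len x y - len x x" for y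
  have param: "\<exists>k. homeomorphism (seg x b) {len x x..len x b} (len x) k" if "b \<in> B" for b
    using seg_param[OF SB(1)[OF that]] by blast
  have tau_inj: "y = z" if "b \<in> B" "y \<in> seg x b" "z \<in> seg x b" "tau y = tau z" for b y z
    using len_inj[OF SB(1)[OF that(1)] that(2,3)] that(4) unfolding tau_def by simp
  have tau0: "tau x = 0" unfolding tau_def by simp
  have taupos: "0 < tau b" if "b \<in> B" for b
    using len_less[OF SB(1)[OF that] seg_ends(1)] SB(2)[OF that] unfolding tau_def by auto
  have tau_ge: "0 \<le> tau y" if "b \<in> B" "y \<in> seg x b" for b y
    using len_le[OF seg_linked(1)[OF SB(1)[OF that(1)] that(2)] seg_ends(1)] unfolding tau_def by simp
  have "\<exists>h>0. h \<le> tau b \<and> (\<forall>y\<in>seg x b. tau y < h \<longrightarrow> dist y x < r)" if b: "b \<in> B" for b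
  proof -
    obtain k where k: "homeomorphism (seg x b) {len x x..len x b} (len x) k" using param[OF b] by blast
    have "continuous_on {len x x..len x b} k" "len x x \<in> {len x x..len x b}" "k (len x x) = x"
      using k taupos[OF b] unfolding homeomorphism_def tau_def by auto
    then obtain d where d: "d > 0" "\<And>s. s \<in> {len x x..len x b} \<Longrightarrow> dist s (len x x) < d \<Longrightarrow> dist (k s) x < r"
      using r(1) unfolding continuous_on_iff by metis
    have "dist y x < r" if y: "y \<in> seg x b" "tau y < d" for y
    proof -
      have "len x y \<in> {len x x..len x b}" "k (len x y) = y" using k y(1) unfolding homeomorphism_def by auto
      then show ?thesis using d(2)[of "len x y"] y(2) unfolding tau_def by (auto simp: dist_real_def)
    qed
    then show ?thesis using d(1) taupos[OF b] by (intro exI[of _ "min d (tau b)"]) auto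
  qed
  then obtain hb where hb: "\<And>b. b \<in> B \<Longrightarrow> hb b > 0 \<and> hb b \<le> tau b \<and> (\<forall>y\<in>seg x b. tau y < hb b \<longrightarrow> dist y x < r)" by metis
  have Bne: "B \<noteq> {}" using n by auto
  \<comment> \<open>A common length: every arm is at least this long, and its points of smaller
    \<open>tau\<close> stay in \<open>ball x r\<close>.\<close>
  define h where "h = Min (hb ` B)"
  have h: "h > 0" "\<And>b. b \<in> B \<Longrightarrow> h \<le> tau b" "\<And>b y. b \<in> B \<Longrightarrow> y \<in> seg x b \<Longrightarrow> tau y < h \<Longrightarrow> dist y x < r"
  proof -
    have le: "h \<le> hb b" if "b \<in> B" for b unfolding h_def using fin that by simp
    show "h > 0" unfolding h_def using fin Bne hb by (subst Min_gr_iff) auto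
    show "h \<le> tau b" if "b \<in> B" for b using le[OF that] hb[OF that] by linarith
    show "dist y x < r" if "b \<in> B" "y \<in> seg x b" "tau y < h" for b y
      using le[OF that(1)] hb[OF that(1)] that(2,3) by fastforce
  qed
  let ?Y = "\<Union>b\<in>B. seg x b"
  have tc: "continuous_on (seg x b) tau" if "b \<in> B" for b
    unfolding tau_def by (intro continuous_intros len_continuous) (use seg_linked SB that in blast)
  define T where "T = (\<Union>b\<in>B. {y \<in> seg x b. h \<le> tau y})"
  have cs: "compact (seg x b)" if "b \<in> B" for b using continuum_seg[OF SB(1)[OF that]] unfolding continuum_def by blast
  have "closed {y \<in> seg x b. h \<le> tau y}" if "b \<in> B" for b
  proof -
    have "closed (seg x b \<inter> tau -` {h..})"
      using continuous_closed_preimage[OF tc[OF that] compact_imp_closed[OF cs[OF that]] closed_atLeast] .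
    moreover have "seg x b \<inter> tau -` {h..} = {y \<in> seg x b. h \<le> tau y}" by auto
    ultimately show ?thesis by simp
  qed
  then have "closed T" unfolding T_def using fin by blast
  define U where "U = ball x r - T"
  have oU: "open U" unfolding U_def using \<open>closed T\<close> by (simp add: open_Diff)
  have xU: "x \<in> U" using r(1) h(1) tau0 unfolding U_def T_def by auto
  have ZU: "Z \<inter> U = (\<Union>b\<in>B. {y \<in> seg x b. tau y < h})"
  proof (intro subset_antisym subsetI)
    fix z assume z: "z \<in> Z \<inter> U"
    have "x \<in> ?Y" using Bne by auto
    then have "z \<in> ?Y" using z r(2) unfolding U_def by blast
    then show "z \<in> (\<Union>b\<in>B. {y \<in> seg x b. tau y < h})" using z unfolding U_def T_def by force
  next
    fix z assume "z \<in> (\<Union>b\<in>B. {y \<in> seg x b. tau y < h})"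
    then obtain b where b: "b \<in> B" "z \<in> seg x b" "tau z < h" by blast
    then show "z \<in> Z \<inter> U" using seg_in_Z[OF SB(1)[OF b(1)] b(2)] h(3)[OF b] unfolding U_def T_def by (auto simp: dist_commute)
  qed
  \<comment> \<open>Different slopes give different lines, and the first coordinate tells
    \<open>v i\<close> from \<open>- v j\<close>; so there are \<open>2 * n\<close> distinct
    rays.\<close>
  define v where "v j = (vector [1, real j] :: real^2)" for j :: nat
  have v12: "v j $ 1 = 1" "v j $ 2 = real j" for j by (simp_all add: v_def)
  define D where "D = v ` {..<n} \<union> (\<lambda>j. - v j) ` {..<n}"
  have "inj v" by (rule injI) (metis v12(2) of_nat_eq_iff)
  moreover have "v ` {..<n} \<inter> (\<lambda>j. - v j) ` {..<n} = {}"
  proof (rule ccontr)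
    assume "\<not> ?thesis"
    then obtain i j where "v i = - v j" by blast
    then have "v i $ 1 = (- v j) $ 1" by simp
    then show False by (simp add: v12)
  qed
  moreover have "inj (\<lambda>j. - v j)" using \<open>inj v\<close> by (simp add: inj_def)
  ultimately have "card D = 2 * n" unfolding D_def
    by (simp add: card_Un_disjoint card_image inj_on_subset[OF _ subset_UNIV])
  then obtain \<sigma> where sg: "bij_betw \<sigma> B D"
    using n(1) fin finite_same_card_bij[of B D] unfolding D_def by auto
  have ray: "s = t \<and> (s = 0 \<or> d = d')" if d: "d \<in> D" "d' \<in> D" "s *\<^sub>R d = t *\<^sub>R d'" "s \<ge> 0" "t \<ge> 0" for d d' s t
  proof -
    have "d $ 1 = 1 \<or> d $ 1 = -1" "d' $ 1 = 1 \<or> d' $ 1 = -1" using d(1,2) v12(1) unfolding D_def by auto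
    moreover have "s * d $ 1 = t * d' $ 1" using arg_cong[OF d(3), of "\<lambda>z. z $ 1"] by simp
    ultimately have "s = t" using d(4,5) by auto
    then show ?thesis using d(3) by (metis scaleR_cancel_left)
  qed
  define \<beta> where "\<beta> y = (SOME b. b \<in> B \<and> y \<in> seg x b)" for y
  \<comment> \<open>Arms share only \<open>x\<close>, where \<open>tau\<close> is 0, so the choice
    of the arm made by \<open>\<beta>\<close> does not matter.\<close>
  define \<Phi> where "\<Phi> y = tau y *\<^sub>R \<sigma> (\<beta> y)" for y
  have Phi: "\<Phi> y = tau y *\<^sub>R \<sigma> b" if b: "b \<in> B" "y \<in> seg x b" for b y
  proof (cases "y = x")
    case True then show ?thesis unfolding \<Phi>_def using tau0 by simp
  next
    case False
    have "\<beta> y \<in> B \<and> y \<in> seg x (\<beta> y)" unfolding \<beta>_def by (rule someI[of _ b]) (use b in blast)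
    then have "\<beta> y = b" using dis[of "\<beta> y" b] b False by blast
    then show ?thesis unfolding \<Phi>_def by simp
  qed
  have "continuous_on ?Y \<Phi>"
  proof (rule continuous_on_closed_Union[OF fin])
    show "closed (seg x b)" if "b \<in> B" for b using cs[OF that] compact_imp_closed by blast
    show "continuous_on (seg x b) \<Phi>" if "b \<in> B" for b
    proof (rule continuous_on_eq)
      show "continuous_on (seg x b) (\<lambda>y. tau y *\<^sub>R \<sigma> b)" by (intro continuous_intros tc that)
    qed (use Phi that in simp)
  qed
  moreover have "compact ?Y" using fin cs by blast
  moreover have "inj_on \<Phi> ?Y"
  proof (rule inj_onI)
    fix y z assume yz: "y \<in> ?Y" "z \<in> ?Y" "\<Phi> y = \<Phi> z"
    then obtain b c where bc: "b \<in> B" "y \<in> seg x b" "c \<in> B" "z \<in> seg x c" by blast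
    have sD: "\<sigma> b \<in> D" "\<sigma> c \<in> D" using sg bc unfolding bij_betw_def by auto
    have e: "tau y *\<^sub>R \<sigma> b = tau z *\<^sub>R \<sigma> c" using yz(3) Phi[OF bc(1,2)] Phi[OF bc(3,4)] by simp
    have R: "tau y = tau z" "tau y = 0 \<or> \<sigma> b = \<sigma> c"
      using ray[OF sD e tau_ge[OF bc(1,2)] tau_ge[OF bc(3,4)]] by auto
    show "y = z"
    proof (cases "tau y = 0")
      case True
      then have "y = x" "z = x" using tau_inj[OF bc(1,2) seg_ends(1)] tau_inj[OF bc(3,4) seg_ends(1)] R tau0 by auto
      then show ?thesis by simp
    next
      case False
      then have "b = c" using R(2) sg bc(1,3) unfolding bij_betw_def inj_on_def by blast
      then show ?thesis using tau_inj[OF bc(1,2) _ R(1)] bc(4) by simp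
    qed
  qed
  ultimately obtain g where g: "homeomorphism ?Y (\<Phi> ` ?Y) \<Phi> g" using homeomorphism_compact by blast
  have "Z \<inter> U \<subseteq> ?Y" unfolding ZU by blast
  then have "homeomorphism (Z \<inter> U) (\<Phi> ` (Z \<inter> U)) \<Phi> g"
    by (intro homeomorphism_of_subsets[OF g]) auto
  then have hom: "(Z \<inter> U) homeomorphic (\<Phi> ` (Z \<inter> U))" unfolding homeomorphic_def by blast
  define S where "S = (\<lambda>j. open_segment (- (h *\<^sub>R v j)) (h *\<^sub>R v j)) ` {..<n}"
  have os: "open_segment (- (h *\<^sub>R w)) (h *\<^sub>R w) = {t *\<^sub>R w | t. - h < t \<and> t < h}" if w: "w \<noteq> 0" for w :: "real^2"
  proof -
    have ne: "- (h *\<^sub>R w) \<noteq> h *\<^sub>R w"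
    proof
      assume "- (h *\<^sub>R w) = h *\<^sub>R w"
      then have "(h + h) *\<^sub>R w = 0" by (metis add.left_inverse scaleR_left_distrib)
      then show False using w h(1) by simp
    qed
    have eq: "(1 - c) *\<^sub>R (- (h *\<^sub>R w)) + c *\<^sub>R (h *\<^sub>R w) = ((2 * c - 1) * h) *\<^sub>R w" for c
    proof -
      have "(1 - c) *\<^sub>R (- (h *\<^sub>R w)) + c *\<^sub>R (h *\<^sub>R w) = (- ((1 - c) * h) + c * h) *\<^sub>R w"
        by (simp only: scaleR_left_distrib scaleR_minus_left scaleR_minus_right scaleR_scaleR)
      also have "- ((1 - c) * h) + c * h = (2 * c - 1) * h" by (simp add: algebra_simps)
      finally show ?thesis .
    qed
    show ?thesis
    proof (intro subset_antisym subsetI)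
      fix y assume "y \<in> open_segment (- (h *\<^sub>R w)) (h *\<^sub>R w)"
      then obtain c where c: "0 < c" "c < 1" "y = ((2 * c - 1) * h) *\<^sub>R w" unfolding in_segment eq by blast
      have "- h < (2 * c - 1) * h" "(2 * c - 1) * h < h"
        using c h(1) mult_strict_right_mono[of "-1" "2*c-1" h] mult_strict_right_mono[of "2*c-1" 1 h] by auto
      then show "y \<in> {t *\<^sub>R w | t. - h < t \<and> t < h}" using c(3) by blast
    next
      fix y assume "y \<in> {t *\<^sub>R w | t. - h < t \<and> t < h}"
      then obtain t where t: "y = t *\<^sub>R w" "- h < t" "t < h" by blast
      define c where "c = (t / h + 1) / 2"
      have "0 < c" "c < 1" "(2 * c - 1) * h = t" using t h(1) unfolding c_def by (auto simp: field_simps)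
      then show "y \<in> open_segment (- (h *\<^sub>R w)) (h *\<^sub>R w)" unfolding in_segment eq using ne t(1) by blast
    qed
  qed
  have v0: "v j \<noteq> 0" for j using v12(1)[of j] by (metis zero_index zero_neq_one)
  have "\<Phi> ` (Z \<inter> U) = \<Union>S"
  proof (intro subset_antisym subsetI)
    fix p assume "p \<in> \<Phi> ` (Z \<inter> U)"
    then obtain b y where y: "b \<in> B" "y \<in> seg x b" "tau y < h" "p = \<Phi> y" unfolding ZU by blast
    have "\<sigma> b \<in> D" using sg y(1) unfolding bij_betw_def by blast
    then obtain j where j: "j < n" "\<sigma> b = v j \<or> \<sigma> b = - v j" unfolding D_def by blast
    have "p = tau y *\<^sub>R v j \<or> p = (- tau y) *\<^sub>R v j" using Phi[OF y(1,2)] y(4) j(2) by auto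
    moreover have "- h < tau y" "tau y < h" "- h < - tau y" "- tau y < h" using tau_ge[OF y(1,2)] y(3) h(1) by auto
    ultimately have "p \<in> open_segment (- (h *\<^sub>R v j)) (h *\<^sub>R v j)" unfolding os[OF v0] by blast
    then show "p \<in> \<Union>S" unfolding S_def using j(1) by blast
  next
    fix p assume "p \<in> \<Union>S"
    then obtain j where j: "j < n" "p \<in> open_segment (- (h *\<^sub>R v j)) (h *\<^sub>R v j)" unfolding S_def by blast
    then obtain t where t: "p = t *\<^sub>R v j" "- h < t" "t < h" unfolding os[OF v0] by blast
    define w where "w = (if t \<ge> 0 then v j else - v j)"
    have w: "w \<in> D" "p = \<bar>t\<bar> *\<^sub>R w" unfolding w_def D_def using j(1) t(1) by auto
    then obtain b where b: "b \<in> B" "\<sigma> b = w" using sg unfolding bij_betw_def by blast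
    obtain k where k: "homeomorphism (seg x b) {len x x..len x b} (len x) k" using param[OF b(1)] by blast
    have "\<bar>t\<bar> \<le> tau b" using t(2,3) h(2)[OF b(1)] by linarith
    then have "len x x + \<bar>t\<bar> \<in> {len x x..len x b}" unfolding tau_def by auto
    then obtain y where y: "y \<in> seg x b" "len x y = len x x + \<bar>t\<bar>" using k unfolding homeomorphism_def by (metis imageE)
    then have ty: "tau y = \<bar>t\<bar>" unfolding tau_def by simp
    then have "\<Phi> y = p" using Phi[OF b(1) y(1)] b(2) w(2) by simp
    moreover have "y \<in> Z \<inter> U" unfolding ZU using b(1) y(1) ty t(2,3) by auto
    ultimately show "p \<in> \<Phi> ` (Z \<inter> U)" by blast
  qed
  then have "(Z \<inter> U) homeomorphic \<Union>S" using hom by simp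
  moreover have "finite S" unfolding S_def by (intro finite_imageI finite_lessThan)
  moreover have "S \<noteq> {}"
  proof -
    have "0 \<in> {..<n}" using n(2) by simp
    then show ?thesis unfolding S_def by blast
  qed
  moreover have "\<forall>s\<in>S. 0 \<in> s \<and> (\<exists>a b. s = open_segment a b)"
  proof
    fix s assume "s \<in> S"
    then obtain j where j: "s = open_segment (- (h *\<^sub>R v j)) (h *\<^sub>R v j)" unfolding S_def by blast
    have "0 \<in> s" unfolding j os[OF v0] using h(1) by (auto intro!: exI[of _ 0])
    then show "0 \<in> s \<and> (\<exists>a b. s = open_segment a b)" using j by blast
  qed
  ultimately show ?thesis using oU xU by blast
qed

section \<open>Edges and their ends\<close>

definition edges :: "(real^2) set set" where "edges = components (Z - {b. brp b})"

text \<open>The second clause ties the parameter to the arcs \<open>seg\<close>: pieces of the edge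
  between two near points are then small, which gives the convergence at the ends.\<close>

definition edge_param :: "(real^2) set \<Rightarrow> (real \<Rightarrow> real^2) \<Rightarrow> bool" where
  "edge_param e \<phi> \<longleftrightarrow> (\<exists>\<psi>. homeomorphism {0<..<1} e \<phi> \<psi>) \<and>
     (\<forall>s t. 0 < s \<longrightarrow> s \<le> t \<longrightarrow> t < 1 \<longrightarrow> linked (\<phi> s) (\<phi> t) \<and> \<phi> ` {s..t} \<subseteq> seg (\<phi> s) (\<phi> t))"

lemma edge_basic:
  assumes "e \<in> edges"
  shows "connected e" "e \<subseteq> Z" "e \<noteq> {}" "\<And>x. x \<in> e \<Longrightarrow> \<not> brp x" "\<And>x. x \<in> e \<Longrightarrow> regular x"
proof -
  show c: "connected e" "e \<subseteq> Z" "e \<noteq> {}" using assms in_components_connected in_components_subset in_components_nonempty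
    unfolding edges_def by blast+
  show b: "\<not> brp x" if "x \<in> e" for x using assms in_components_subset that unfolding edges_def by blast
  show "regular x" if "x \<in> e" for x using not_brp_regular b[OF that] c(2) that by auto
qed

lemma edge_linked:
  assumes e: "e \<in> edges" and "x \<in> e" "y \<in> e"
  shows "linked x y" "seg x y \<subseteq> e"
proof -
  have U: "open (- {b. brp b})" "e \<subseteq> - {b. brp b}" using closed_brp edge_basic(4)[OF e] by auto
  note c = connected_imp_linked[OF edge_basic(1,2)[OF e] U assms(2,3)]
  show "linked x y" by (rule c)
  have "connected (seg x y)" "seg x y \<subseteq> Z - {b. brp b}" using continuum_seg[OF c(1)] c(2) unfolding continuum_def by auto
  moreover have "e \<inter> seg x y \<noteq> {}" using assms(2) seg_ends by blast
  ultimately show "seg x y \<subseteq> e" using components_maximal e unfolding edges_def by blast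
qed

lemma edge_open:
  assumes e: "e \<in> edges" and q: "q \<in> e"
  obtains r where "r > 0" "\<And>z. F z = 0 \<Longrightarrow> dist z q < r \<Longrightarrow> z \<in> e"
proof -
  have Fq: "F q = 0" using edge_basic(2)[OF e] q by auto
  have U: "open (- {b. brp b})" "q \<in> - {b. brp b}" using closed_brp edge_basic(4)[OF e q] by auto
  obtain d where d: "d > 0" "cball q d \<subseteq> - {b. brp b}" using U open_contains_cball by blast
  obtain \<delta> where \<delta>: "\<delta> > 0" "\<And>z. F z = 0 \<Longrightarrow> dist z q < \<delta> \<Longrightarrow> linked q z \<and> seg q z \<subseteq> cball q d"
    using local_seg[OF Fq d(1)] by blast
  have "z \<in> e" if z: "F z = 0" "dist z q < \<delta>" for z
  proof -
    have l: "linked q z" "seg q z \<subseteq> cball q d" using \<delta>(2)[OF z] by auto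
    have "connected (seg q z)" "seg q z \<subseteq> Z - {b. brp b}" using continuum_seg[OF l(1)] l(2) d(2) unfolding continuum_def by auto
    moreover have "e \<inter> seg q z \<noteq> {}" using q seg_ends by blast
    ultimately have "seg q z \<subseteq> e" using components_maximal e unfolding edges_def by blast
    then show ?thesis using seg_ends by blast
  qed
  then show ?thesis using that \<delta>(1) by blast
qed

lemma connected_real_open_interval:
  fixes S :: "real set"
  assumes c: "connected S" and ne: "S \<noteq> {}" and b: "bounded S"
    and up: "\<And>x. x \<in> S \<Longrightarrow> \<exists>y\<in>S. x < y" and dn: "\<And>x. x \<in> S \<Longrightarrow> \<exists>y\<in>S. y < x"
  shows "S = {Inf S<..<Sup S}"
proof -
  have bd: "bdd_above S" "bdd_below S" using b by (auto simp: bounded_imp_bdd_above bounded_imp_bdd_below)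
  show ?thesis
  proof (intro subset_antisym subsetI)
    fix x assume x: "x \<in> S"
    obtain y z where "y \<in> S" "x < y" "z \<in> S" "z < x" using up[OF x] dn[OF x] by blast
    then show "x \<in> {Inf S<..<Sup S}" using cSup_upper[OF _ bd(1), of y] cInf_lower[OF _ bd(2), of z] by auto
  next
    fix x assume x: "x \<in> {Inf S<..<Sup S}"
    then obtain y z where "y \<in> S" "x < y" "z \<in> S" "z < x"
      using less_cSup_iff[OF ne bd(1)] cInf_less_iff[OF ne bd(2)] by auto
    then show "x \<in> S" using connectedD_interval[OF c, of z y x] by auto
  qed
qed

text \<open>From a base point \<open>p\<close> the edge runs into two components of
  \<open>Z - {p}\<close>; the injection is the length from \<open>p\<close>, counted negatively in
  one of them. It has no extreme values because arcs can be continued by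
  \<open>seg_extend\<close>.\<close>

lemma edge_injection:
  assumes e: "e \<in> edges"
  obtains \<psi> :: "real^2 \<Rightarrow> real" where "continuous_on e \<psi>" "inj_on \<psi> e" "bounded (\<psi> ` e)"
    "\<And>y. y \<in> e \<Longrightarrow> \<exists>z\<in>e. \<psi> y < \<psi> z" "\<And>y. y \<in> e \<Longrightarrow> \<exists>z\<in>e. \<psi> z < \<psi> y"
proof -
  obtain p where p: "p \<in> e" using edge_basic(3)[OF e] by blast
  have Fp: "F p = 0" using edge_basic(2)[OF e] p by auto
  obtain a b r where r: "linked a b" "p \<in> seg a b" "p \<noteq> a" "p \<noteq> b" "r > 0" "Z \<inter> ball p r \<subseteq> seg a b"
    using edge_basic(5)[OF e p] unfolding regular_def by blast
  have lp: "linked p a" "linked p b" using seg_linked[OF r(1,2)] linked_sym by blast+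
  have nab: "a \<noteq> p" "b \<noteq> p" using r(3,4) by auto
  let ?C = "\<lambda>y. connected_component_set (Z - {p}) y"
  define Aa where "Aa = ?C a"
  define Bb where "Bb = ?C b"
  note Ca = component_of_linked[OF lp(1) nab(1), folded Aa_def]
    and Cb = component_of_linked[OF lp(2) nab(2), folded Bb_def]
  have AZ: "Aa \<subseteq> Z - {p}" "Bb \<subseteq> Z - {p}" "connected Aa"
    unfolding Aa_def Bb_def by (rule connected_component_subset connected_connected_component)+
  have "Aa \<noteq> Bb"
  proof
    assume eq: "Aa = Bb"
    have "b \<notin> Aa" by (rule seg_separates[OF r(2)]) (use Ca(4) AZ in auto)
    then show False using eq Cb(4) by simp
  qed
  then have disj: "Aa \<inter> Bb = {}" using component_disjoint[OF Ca(3) Cb(3)] by blast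
  have cov: "y \<in> Aa \<union> Bb" if y: "y \<in> e" "y \<noteq> p" for y
  proof -
    have py: "linked p y" using edge_linked[OF e p y(1)] by blast
    have ne: "p \<noteq> y" using y(2) by simp
    obtain z where z: "z \<in> seg p y" "z \<noteq> p" "dist z p < r" using seg_point_near_start[OF py ne r(5)] by metis
    have "z \<in> seg a b" using r(6) z seg_in_Z[OF py z(1)] by (auto simp: dist_commute)
    then have "z \<in> seg p a \<or> z \<in> seg p b" using seg_triangle[OF linked_sym[OF lp(1)] lp(2)] seg_sym[of a p] by blast
    then have z2: "z \<in> Aa \<or> z \<in> Bb" using Ca(1) Cb(1) z(2) by blast
    have z1: "z \<in> ?C y" using component_of_linked(1)[OF py y(2)] z by blast
    note Cy = component_of_linked(3,4)[OF py y(2)]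
    show ?thesis using z2 component_disjoint[OF Cy(1) Ca(3) z1] component_disjoint[OF Cy(1) Cb(3) z1] Cy(2) by blast
  qed
  have pC: "p \<notin> Aa" "p \<notin> Bb" using AZ by blast+
  define lam where "lam y = len p y - len p p" for y
  have lin: "linked p y" if "y \<in> e" for y using edge_linked[OF e p that] by blast
  have lam0: "lam p = 0" unfolding lam_def by simp
  have lampos: "lam y > 0" if "y \<in> e" "y \<noteq> p" for y
    using len_less[OF lin[OF that(1)] seg_ends(1)] that(2) unfolding lam_def by auto
  have lamc: "continuous_on S lam" if "S \<subseteq> e" for S
    unfolding lam_def by (intro continuous_intros len_continuous) (use lin that in blast)
  define \<psi> where "\<psi> y = (if y \<in> Aa then lam y else - lam y)" for y
  have E: "e = (e \<inter> (Aa \<union> {p})) \<union> (e \<inter> (Bb \<union> {p}))" using cov p by blast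
  have cl: "closed (Aa \<union> {p})" "closed (Bb \<union> {p})"
  proof -
    have "closure (Aa) = Aa \<union> {p}" using component_minus_point_closure(1)[OF Ca(3)] Ca(2) closure_subset by blast
    then show "closed (Aa \<union> {p})" by (metis closed_closure)
    have "closure (Bb) = Bb \<union> {p}" using component_minus_point_closure(1)[OF Cb(3)] Cb(2) closure_subset by blast
    then show "closed (Bb \<union> {p})" by (metis closed_closure)
  qed
  have "continuous_on ((e \<inter> (Aa \<union> {p})) \<union> (e \<inter> (Bb \<union> {p}))) \<psi>"
    unfolding \<psi>_def
  proof (rule continuous_on_cases_local)
    show "closedin (top_of_set (e \<inter> (Aa \<union> {p}) \<union> e \<inter> (Bb \<union> {p}))) (e \<inter> (Aa \<union> {p}))"
      unfolding E[symmetric] using cl(1) by (simp add: closedin_closed_Int)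
    show "closedin (top_of_set (e \<inter> (Aa \<union> {p}) \<union> e \<inter> (Bb \<union> {p}))) (e \<inter> (Bb \<union> {p}))"
      unfolding E[symmetric] using cl(2) by (simp add: closedin_closed_Int)
    show "continuous_on (e \<inter> (Aa \<union> {p})) lam" by (rule lamc) blast
    show "continuous_on (e \<inter> (Bb \<union> {p})) (\<lambda>x. - lam x)" by (intro continuous_on_minus lamc) blast
    fix x assume "x \<in> e \<inter> (Aa \<union> {p}) \<and> x \<notin> Aa \<or> x \<in> e \<inter> (Bb \<union> {p}) \<and> x \<in> Aa"
    then have "x = p" using disj by blast
    then show "lam x = - lam x" using lam0 by simp
  qed
  then have cont_psi: "continuous_on e \<psi>" using E by simp
  have psi_p: "\<psi> p = 0" unfolding \<psi>_def using lam0 by simp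
  have psi_a: "\<psi> y = lam y" if "y \<in> Aa" for y using that unfolding \<psi>_def by simp
  have psi_b: "\<psi> y = - lam y" if "y \<in> Bb" for y using that disj unfolding \<psi>_def by auto
  \<comment> \<open>If the arcs from \<open>p\<close> to \<open>y\<close> and to \<open>z\<close>
    parted before reaching either point, the gate would be a triod at a regular point. So one is an
    initial piece of the other, and equal length makes them equal.\<close>
  have same: "y = z" if yz: "y \<in> e" "z \<in> e" "y \<noteq> p" "z \<noteq> p" "lam y = lam z" "y \<in> ?C x" "z \<in> ?C x" for x y z
  proof -
    obtain w where w: "w \<in> seg p y" "w \<in> seg p z" "seg p y \<inter> seg p z = seg p w" "w \<in> seg y z"
      using seg_gate[OF lin[OF yz(1)] lin[OF yz(2)]] .
    have wp: "w \<noteq> p"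
    proof
      assume "w = p"
      then have "p \<in> seg y z" using w(4) by simp
      then have "z \<notin> ?C x"
        by (rule seg_separates) (use yz(6) connected_component_subset[of "Z - {p}" x] in auto)
      then show False using yz(7) by blast
    qed
    have we: "w \<in> e" using edge_linked(2)[OF e p yz(1)] w(1) by blast
    have "w = y \<or> w = z"
    proof (rule ccontr)
      assume n: "\<not> ?thesis"
      show False
        by (rule regular_no_triod[OF edge_basic(5)[OF e we], of p y z])
          (use edge_linked(1)[OF e we] p yz(1,2) n wp w(1,2,4) in auto)
    qed
    then show "y = z"
    proof
      assume "w = y"
      then show ?thesis using len_inj[OF lin[OF yz(2)], of y z] w(2) yz(5) seg_ends unfolding lam_def by auto
    next
      assume "w = z"
      then show ?thesis using len_inj[OF lin[OF yz(1)], of y z] w(1) yz(5) seg_ends unfolding lam_def by auto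
    qed
  qed
  have sgn_psi: "y = p \<and> \<psi> y = 0 \<or> y \<in> Aa \<and> \<psi> y = lam y \<and> lam y > 0 \<or> y \<in> Bb \<and> \<psi> y = - lam y \<and> lam y > 0" if y: "y \<in> e" for y
    using cov[OF y] lampos[OF y] psi_p psi_a psi_b by blast
  have inj: "inj_on \<psi> e"
  proof (rule inj_onI)
    fix y z assume yz: "y \<in> e" "z \<in> e" "\<psi> y = \<psi> z"
    have "y = p \<and> z = p \<or> (y \<in> Aa \<and> z \<in> Aa \<or> y \<in> Bb \<and> z \<in> Bb) \<and> lam y = lam z"
      using sgn_psi[OF yz(1)] sgn_psi[OF yz(2)] yz(3) by argo
    then show "y = z" using same[OF yz(1,2), of a, folded Aa_def] same[OF yz(1,2), of b, folded Bb_def] pC by metis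
  qed
  have ext: "\<exists>z\<in>e. z \<in> ?C x \<and> lam y < lam z" if y: "y \<in> e" "y \<in> ?C x" "?C x \<in> components (Z - {p})" for x y
  proof -
    obtain r1 where r1: "r1 > 0" "\<And>z. F z = 0 \<Longrightarrow> dist z y < r1 \<Longrightarrow> z \<in> e" using edge_open[OF e y(1)] by blast
    obtain r2 where r2: "r2 > 0" "\<And>z. F z = 0 \<Longrightarrow> dist z y < r2 \<Longrightarrow> z \<in> ?C x"
      using component_minus_point_open[OF y(3,2)] by blast
    have "min r1 r2 > 0" using r1(1) r2(1) by simp
    then obtain z where z: "F z = 0" "dist z y < min r1 r2" "z \<noteq> y" "linked p z" "y \<in> seg p z"
      using seg_extend[OF lin[OF y(1)]] by metis
    have "lam y < lam z" using len_less[OF z(4,5)] z(3) unfolding lam_def by simp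
    then show ?thesis using r1(2)[OF z(1)] r2(2)[OF z(1)] z(2) by auto
  qed
  have start: "\<exists>z\<in>e. z \<in> ?C x \<and> 0 < lam z" if x: "linked p x" "x \<noteq> p" for x
  proof -
    obtain r1 where r1: "r1 > 0" "\<And>z. F z = 0 \<Longrightarrow> dist z p < r1 \<Longrightarrow> z \<in> e" using edge_open[OF e p] by blast
    have ne: "p \<noteq> x" using x(2) by simp
    obtain z where z: "z \<in> seg p x" "z \<noteq> p" "dist z p < r1" using seg_point_near_start[OF x(1) ne r1(1)] by metis
    have "z \<in> e" using r1(2) seg_in_Z[OF x(1) z(1)] z(3) by blast
    then show ?thesis using lampos[of z] component_of_linked(1)[OF x] z by blast
  qed
  have up: "\<exists>z\<in>e. \<psi> y < \<psi> z" if y: "y \<in> e" for y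
    using sgn_psi[OF y]
  proof (elim disjE conjE)
    assume y0: "\<psi> y = 0"
    obtain z where "z \<in> e" "z \<in> Aa" "0 < lam z" using start[OF lp(1) nab(1), folded Aa_def] by blast
    then show ?thesis using y0 psi_a by force
  next
    assume ya: "y \<in> Aa" "\<psi> y = lam y"
    obtain z where "z \<in> e" "z \<in> Aa" "lam y < lam z" using ext[of y a, folded Aa_def, OF y ya(1) Ca(3)] by blast
    then show ?thesis using ya psi_a by force
  next
    assume "y \<in> Bb" "\<psi> y = - lam y" "lam y > 0" then show ?thesis using p psi_p by force
  qed
  have dn: "\<exists>z\<in>e. \<psi> z < \<psi> y" if y: "y \<in> e" for y
    using sgn_psi[OF y]
  proof (elim disjE conjE)
    assume y0: "\<psi> y = 0"
    obtain z where "z \<in> e" "z \<in> Bb" "0 < lam z" using start[OF lp(2) nab(2), folded Bb_def] by blast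
    then show ?thesis using y0 psi_b by force
  next
    assume yb: "y \<in> Bb" "\<psi> y = - lam y"
    obtain z where "z \<in> e" "z \<in> Bb" "lam y < lam z" using ext[of y b, folded Bb_def, OF y yb(1) Cb(3)] by blast
    then show ?thesis using yb psi_b by force
  next
    assume "y \<in> Aa" "\<psi> y = lam y" "lam y > 0" then show ?thesis using p psi_p by force
  qed
  show ?thesis
  \<comment> \<open>\<open>arctan\<close> makes the values bounded and keeps continuity, injectivity
    and strict inequalities.\<close>
  proof (rule that[of "\<lambda>y. arctan (\<psi> y)"])
    show "continuous_on e (\<lambda>y. arctan (\<psi> y))" using cont_psi by (intro continuous_intros)
    show "inj_on (\<lambda>y. arctan (\<psi> y)) e" using inj by (auto simp: inj_on_def arctan_eq_iff)
    show "bounded ((\<lambda>y. arctan (\<psi> y)) ` e)"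
    proof (rule boundedI)
      fix x assume "x \<in> (\<lambda>y. arctan (\<psi> y)) ` e"
      then obtain y where "x = arctan (\<psi> y)" by blast
      moreover have "\<bar>arctan (\<psi> y)\<bar> \<le> pi/2" using arctan_bounded[of "\<psi> y"] by linarith
      ultimately show "norm x \<le> pi/2" by (metis real_norm_def)
    qed
    show "\<exists>z\<in>e. arctan (\<psi> y) < arctan (\<psi> z)" if "y \<in> e" for y using up[OF that] by (simp add: arctan_less_iff)
    show "\<exists>z\<in>e. arctan (\<psi> z) < arctan (\<psi> y)" if "y \<in> e" for y using dn[OF that] by (simp add: arctan_less_iff)
  qed
qed

text \<open>The injection is rescaled to have image the open unit interval and then inverted. As the
  edge is not compact, continuity of the inverse is obtained on the compact subarcs
  \<open>seg (\<phi> s) (\<phi> t)\<close> and then patched together.\<close>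

lemma edge_param_exists:
  assumes e: "e \<in> edges"
  obtains \<phi> where "edge_param e \<phi>"
proof -
  obtain \<psi>0 :: "real^2 \<Rightarrow> real" where p0: "continuous_on e \<psi>0" "inj_on \<psi>0 e" "bounded (\<psi>0 ` e)"
    "\<And>y. y \<in> e \<Longrightarrow> \<exists>z\<in>e. \<psi>0 y < \<psi>0 z" "\<And>y. y \<in> e \<Longrightarrow> \<exists>z\<in>e. \<psi>0 z < \<psi>0 y"
    using edge_injection[OF e] by metis
  have c0: "connected (\<psi>0 ` e)" using connected_continuous_image[OF p0(1) edge_basic(1)[OF e]] .
  have ne: "\<psi>0 ` e \<noteq> {}" using edge_basic(3)[OF e] by simp
  define l where "l = Inf (\<psi>0 ` e)"
  define m where "m = Sup (\<psi>0 ` e)"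
  have im0: "\<psi>0 ` e = {l<..<m}" unfolding l_def m_def
    by (rule connected_real_open_interval[OF c0 ne p0(3)]) (use p0(4,5) in auto)
  then have lm: "l < m" using ne by (metis greaterThanLessThan_empty_iff not_le)
  define \<psi> where "\<psi> y = (\<psi>0 y - l) / (m - l)" for y
  have cpsi: "continuous_on e \<psi>" unfolding \<psi>_def using lm by (intro continuous_intros p0(1)) auto
  have ipsi: "inj_on \<psi> e" using p0(2) lm by (auto simp: inj_on_def \<psi>_def)
  have impsi: "\<psi> ` e = {0<..<1}"
  proof -
    have "\<psi> ` e = (\<lambda>t. (t - l) / (m - l)) ` {l<..<m}" unfolding im0[symmetric] \<psi>_def by (simp add: image_image)
    also have "\<dots> = {0<..<1}"
    proof (intro subset_antisym subsetI)
      fix t assume t: "t \<in> {0<..<1::real}"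
      have "t * (m - l) < 1 * (m - l)" "0 < t * (m - l)" using t lm by (intro mult_strict_right_mono mult_pos_pos; auto)+
      then have "l + t * (m - l) \<in> {l<..<m}" by auto
      moreover have "t = (l + t * (m - l) - l) / (m - l)" using lm by simp
      ultimately show "t \<in> (\<lambda>t. (t - l) / (m - l)) ` {l<..<m}" by blast
    qed (use lm in \<open>auto simp: field_simps\<close>)
    finally show ?thesis .
  qed
  define \<phi> where "\<phi> = the_inv_into e \<psi>"
  have phi: "\<phi> t \<in> e" "\<psi> (\<phi> t) = t" if "t \<in> {0<..<1}" for t
    using the_inv_into_into[OF ipsi, of t e] f_the_inv_into_f[OF ipsi, of t] that impsi unfolding \<phi>_def by auto
  have phi': "\<phi> (\<psi> y) = y" if "y \<in> e" for y using the_inv_into_f_f[OF ipsi that] unfolding \<phi>_def .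
  have arc: "\<phi> ` {s..t} \<subseteq> seg (\<phi> s) (\<phi> t) \<and> continuous_on {s..t} \<phi>" if st: "0 < s" "s \<le> t" "t < 1" for s t
  proof -
    let ?C = "seg (\<phi> s) (\<phi> t)"
    have ste: "\<phi> s \<in> e" "\<phi> t \<in> e" "\<psi> (\<phi> s) = s" "\<psi> (\<phi> t) = t" using phi st by auto
    have C: "compact ?C" "connected ?C" "?C \<subseteq> e"
      using edge_linked[OF e ste(1,2)] continuum_seg unfolding continuum_def by blast+
    have cC: "continuous_on ?C \<psi>" using cpsi C(3) continuous_on_subset by blast
    have "connected (\<psi> ` ?C)" using connected_continuous_image[OF cC C(2)] .
    then have sub: "{s..t} \<subseteq> \<psi> ` ?C"
      using connectedD_interval[of "\<psi> ` ?C" s t] ste(3,4) seg_ends(1)[of "\<phi> s" "\<phi> t"] seg_ends(2)[of "\<phi> t" "\<phi> s"]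
      by (metis atLeastAtMost_iff imageI subsetI)
    have "inj_on \<psi> ?C" using ipsi C(3) inj_on_subset by blast
    then obtain g where g: "homeomorphism ?C (\<psi> ` ?C) \<psi> g" using homeomorphism_compact[OF C(1) cC refl] by blast
    have eq: "g r = \<phi> r" if "r \<in> \<psi> ` ?C" for r
    proof -
      obtain y where y: "y \<in> ?C" "r = \<psi> y" using \<open>r \<in> \<psi> ` ?C\<close> by blast
      then show ?thesis using g phi'[of y] C(3) unfolding homeomorphism_def by auto
    qed
    have "continuous_on {s..t} g" 
      using continuous_on_subset[of "\<psi> ` ?C" g "{s..t}"] g sub unfolding homeomorphism_def by simp
    then have "continuous_on {s..t} \<phi>" by (rule continuous_on_eq) (use eq sub in blast)
    moreover have "\<phi> ` {s..t} \<subseteq> ?C" using sub eq g unfolding homeomorphism_def by force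
    ultimately show ?thesis by blast
  qed
  have "continuous_on {0<..<1} \<phi>"
  proof (rule continuous_at_imp_continuous_on, rule ballI)
    fix t :: real assume t: "t \<in> {0<..<1}"
    have "continuous_on {t/2<..<(t+1)/2} \<phi>" using arc[of "t/2" "(t+1)/2"] t
      by (auto intro: continuous_on_subset)
    then show "isCont \<phi> t" using t by (auto simp: continuous_on_eq_continuous_at)
  qed
  moreover have "\<phi> ` {0<..<1} = e"
  proof (intro subset_antisym subsetI)
    fix y assume "y \<in> e"
    moreover from this have "\<psi> y \<in> {0<..<1}" using impsi by blast
    ultimately show "y \<in> \<phi> ` {0<..<1}" using phi' by (metis imageI)
  qed (use phi(1) in blast)
  ultimately have "homeomorphism {0<..<1} e \<phi> \<psi>"
    unfolding homeomorphism_def using phi phi' impsi cpsi by auto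
  then have "edge_param e \<phi>" unfolding edge_param_def using arc edge_linked(1)[OF e] phi(1) by auto
  then show ?thesis by (rule that)
qed

end

section \<open>Ends of a curve in the plane or at infinity (\<open>None\<close>), and curves in the
  sphere\<close>

definition tends1 :: "(real \<Rightarrow> 'a::real_normed_vector) \<Rightarrow> 'a option \<Rightarrow> bool" where
  "tends1 \<phi> Q \<longleftrightarrow> (case Q of
      Some q \<Rightarrow> \<forall>\<epsilon>>0. \<exists>t\<in>{0<..<1}. \<forall>s. t \<le> s \<longrightarrow> s < 1 \<longrightarrow> dist (\<phi> s) q < \<epsilon>
    | None \<Rightarrow> \<forall>R. \<exists>t\<in>{0<..<1}. \<forall>s. t \<le> s \<longrightarrow> s < 1 \<longrightarrow> norm (\<phi> s) > R)"

lemma tends1_Some: "tends1 \<phi> (Some q) \<Longrightarrow> \<epsilon> > 0 \<Longrightarrow> \<exists>t\<in>{0<..<1}. \<forall>s. t \<le> s \<longrightarrow> s < 1 \<longrightarrow> dist (\<phi> s) q < \<epsilon>"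
  by (simp add: tends1_def)

lemma tends1_None: "tends1 \<phi> None \<Longrightarrow> \<exists>t\<in>{0<..<1}. \<forall>s. t \<le> s \<longrightarrow> s < 1 \<longrightarrow> norm (\<phi> s) > R"
  by (simp add: tends1_def)

lemma tends1_far:
  assumes "tends1 \<phi> Q" "Some y \<noteq> Q"
  obtains t \<epsilon> where "0 < t" "t < 1" "\<epsilon> > 0" "\<And>s. t \<le> s \<Longrightarrow> s < 1 \<Longrightarrow> \<epsilon> \<le> dist (\<phi> s) y"
proof (cases Q)
  case None
  then obtain t where t: "t\<in>{0<..<1}" "\<forall>s. t \<le> s \<longrightarrow> s < 1 \<longrightarrow> norm (\<phi> s) > norm y + 1"
    using tends1_None assms(1) by blast
  have "1 \<le> dist (\<phi> s) y" if "t \<le> s" "s < 1" for s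
    using t(2) that norm_triangle_ineq2[of "\<phi> s" y] by (force simp: dist_norm)
  then show ?thesis using that[of t 1] t(1) by auto
next
  case (Some q)
  define \<epsilon> where "\<epsilon> = dist q y / 2"
  have e: "\<epsilon> > 0" using assms(2) Some unfolding \<epsilon>_def by simp
  then obtain t where t: "t\<in>{0<..<1}" "\<forall>s. t \<le> s \<longrightarrow> s < 1 \<longrightarrow> dist (\<phi> s) q < \<epsilon>"
    using tends1_Some assms(1) Some by blast
  have "\<epsilon> \<le> dist (\<phi> s) y" if "t \<le> s" "s < 1" for s
  proof -
    have "dist (\<phi> s) q < \<epsilon>" using t(2) that by blast
    then show ?thesis using dist_triangle3[of q y "\<phi> s"] unfolding \<epsilon>_def by linarith
  qed
  then show ?thesis using that[of t \<epsilon>] t(1) e by auto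
qed

lemma openin_S2:
  assumes "openin S2 V"
  shows "open {x. Some x \<in> V}" "None \<in> V \<Longrightarrow> bounded {x. Some x \<notin> V}"
proof -
  consider U where "open U" "V = Some ` U" | C where "compact C" "closed C" "V = insert None (Some ` (- C))"
    using assms unfolding S2_def openin_Alexandroff_compactification by (auto simp: Compl_eq_Diff_UNIV)
  then have "open {x. Some x \<in> V} \<and> (None \<in> V \<longrightarrow> bounded {x. Some x \<notin> V})"
  proof cases
    case 1
    then have "{x. Some x \<in> V} = U" by auto
    then show ?thesis using 1 by auto
  next
    case 2
    then have "{x. Some x \<in> V} = - C" "{x. Some x \<notin> V} = C" by auto
    then show ?thesis using 2 compact_imp_bounded by auto
  qed
  then show "open {x. Some x \<in> V}" "None \<in> V \<Longrightarrow> bounded {x. Some x \<notin> V}" by auto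
qed

lemma topspace_S2 [simp]: "topspace S2 = UNIV"
proof -
  have "x \<in> topspace S2" for x :: "(real^2) option"
    unfolding S2_def by (cases x) auto
  then show ?thesis by blast
qed

definition extend :: "(real \<Rightarrow> 'a) \<Rightarrow> 'a option \<Rightarrow> 'a option \<Rightarrow> real \<Rightarrow> 'a option" where
  "extend \<phi> Q0 Q1 t = (if t \<le> 0 then Q0 else if 1 \<le> t then Q1 else Some (\<phi> t))"

lemma tends1_nbhd:
  fixes \<phi> :: "real \<Rightarrow> real^2"
  assumes Q: "tends1 \<phi> Q" and V: "openin S2 V" "Q \<in> V"
  obtains t where "0 < t" "t < 1" "\<And>s. t \<le> s \<Longrightarrow> s < 1 \<Longrightarrow> Some (\<phi> s) \<in> V"
proof (cases Q)
  case None
  obtain R where R: "\<And>x. Some x \<notin> V \<Longrightarrow> norm x \<le> R"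
    using openin_S2(2)[OF V(1)] V(2) None unfolding bounded_iff by auto
  obtain t where t: "t\<in>{0<..<1}" "\<forall>s. t \<le> s \<longrightarrow> s < 1 \<longrightarrow> norm (\<phi> s) > R" using tends1_None Q None by blast
  have "Some (\<phi> s) \<in> V" if "t \<le> s" "s < 1" for s using t(2) R[of "\<phi> s"] that by (meson not_le)
  then show ?thesis using that[of t] t(1) by auto
next
  case (Some q)
  then have "q \<in> {x. Some x \<in> V}" using V(2) by simp
  then obtain e where e: "e > 0" "ball q e \<subseteq> {x. Some x \<in> V}" using openin_S2(1)[OF V(1)] open_contains_ball by blast
  obtain t where t: "t\<in>{0<..<1}" "\<forall>s. t \<le> s \<longrightarrow> s < 1 \<longrightarrow> dist (\<phi> s) q < e" using tends1_Some Q Some e(1) by blast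
  have "Some (\<phi> s) \<in> V" if "t \<le> s" "s < 1" for s
  proof -
    have "\<phi> s \<in> ball q e" using t(2) that by (simp add: dist_commute)
    then show ?thesis using e(2) by blast
  qed
  then show ?thesis using that[of t] t(1) by auto
qed

lemma extend_continuous:
  fixes \<phi> :: "real \<Rightarrow> real^2"
  assumes c: "continuous_on {0<..<1} \<phi>" and Q1: "tends1 \<phi> Q1" and Q0: "tends1 (\<lambda>t. \<phi> (1 - t)) Q0"
  shows "continuous_map (top_of_set {0..1}) S2 (extend \<phi> Q0 Q1)"
  unfolding continuous_map_def
proof (intro conjI allI impI)
  fix V assume V: "openin S2 V"
  let ?X = "{t \<in> topspace (top_of_set {0..1}). extend \<phi> Q0 Q1 t \<in> V}"
  show "openin (top_of_set {0..1}) ?X"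
  proof (subst openin_euclidean_subtopology_iff, intro conjI ballI)
    fix t assume t: "t \<in> ?X"
    then have t01: "t \<in> {0..1}" "extend \<phi> Q0 Q1 t \<in> V" by auto
    have "\<exists>d>0. \<forall>s\<in>{0..1}. dist s t < d \<longrightarrow> extend \<phi> Q0 Q1 s \<in> V"
    proof -
      consider "t = 0" | "t = 1" | "0 < t" "t < 1" using t01(1) by fastforce
      then show ?thesis
      proof cases
        case 1
        then have q: "Q0 \<in> V" using t01(2) unfolding extend_def by simp
        obtain a where a: "0 < a" "a < 1" "\<And>s. a \<le> s \<Longrightarrow> s < 1 \<Longrightarrow> Some (\<phi> (1 - s)) \<in> V"
          using tends1_nbhd[OF Q0 V q] by blast
        have "extend \<phi> Q0 Q1 s \<in> V" if s: "s \<in> {0..1}" "dist s t < 1 - a" for s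
        proof (cases "s = 0")
          case True then show ?thesis using q unfolding extend_def by simp
        next
          case False
          then have "0 < s" "s < 1" "a \<le> 1 - s" using s 1 a by (auto simp: dist_real_def)
          then show ?thesis using a(3)[of "1 - s"] unfolding extend_def by simp
        qed
        then show ?thesis using a(2) by (intro exI[of _ "1 - a"]) auto
      next
        case 2
        then have q: "Q1 \<in> V" using t01(2) unfolding extend_def by simp
        obtain a where a: "0 < a" "a < 1" "\<And>s. a \<le> s \<Longrightarrow> s < 1 \<Longrightarrow> Some (\<phi> s) \<in> V"
          using tends1_nbhd[OF Q1 V q] by blast
        have "extend \<phi> Q0 Q1 s \<in> V" if s: "s \<in> {0..1}" "dist s t < 1 - a" for s
        proof (cases "s = 1")
          case True then show ?thesis using q unfolding extend_def by simp
        next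
          case False
          then have "0 < s" "s < 1" "a \<le> s" using s 2 a by (auto simp: dist_real_def)
          then show ?thesis using a(3)[of s] unfolding extend_def by simp
        qed
        then show ?thesis using a(2) by (intro exI[of _ "1 - a"]) auto
      next
        case 3
        then have "\<phi> t \<in> {x. Some x \<in> V}" using t01(2) unfolding extend_def by simp
        then obtain e where e: "e > 0" "ball (\<phi> t) e \<subseteq> {x. Some x \<in> V}" using openin_S2(1)[OF V] open_contains_ball by blast
        have "t \<in> {0<..<1}" using 3 by simp
        then obtain d where d: "d > 0" "\<And>s. s \<in> {0<..<1} \<Longrightarrow> dist s t < d \<Longrightarrow> dist (\<phi> s) (\<phi> t) < e"
          using c e(1) unfolding continuous_on_iff by metis
        have "extend \<phi> Q0 Q1 s \<in> V" if s: "dist s t < min d (min t (1 - t))" for s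
        proof -
          have s01: "0 < s" "s < 1" using s by (auto simp: dist_real_def)
          then have "\<phi> s \<in> ball (\<phi> t) e" using d(2)[of s] s by (simp add: dist_commute)
          then show ?thesis using e(2) s01 unfolding extend_def by auto
        qed
        then show ?thesis using d(1) 3 by (intro exI[of _ "min d (min t (1 - t))"]) auto
      qed
    qed
    then show "\<exists>e>0. \<forall>x'\<in>{0..1}. dist x' t < e \<longrightarrow> x' \<in> ?X" by auto
  qed auto
qed simp

lemma extend_image: "extend \<phi> Q0 Q1 ` {0..1} = {Q0, Q1} \<union> Some ` \<phi> ` {0<..<1}"
proof (intro subset_antisym subsetI)
  fix x assume "x \<in> extend \<phi> Q0 Q1 ` {0..1}"
  then obtain t where "t \<in> {0..1}" "x = extend \<phi> Q0 Q1 t" by blast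
  then show "x \<in> {Q0, Q1} \<union> Some ` \<phi> ` {0<..<1}" unfolding extend_def by (auto split: if_splits)
next
  fix x assume "x \<in> {Q0, Q1} \<union> Some ` \<phi> ` {0<..<1}"
  then consider "x = Q0" | "x = Q1" | t where "0 < t" "t < 1" "x = Some (\<phi> t)" by auto
  then show "x \<in> extend \<phi> Q0 Q1 ` {0..1}"
  proof cases
    case 1 then show ?thesis by (intro image_eqI[of _ _ 0]) (auto simp: extend_def)
  next
    case 2 then show ?thesis by (intro image_eqI[of _ _ 1]) (auto simp: extend_def)
  next
    case 3 then show ?thesis by (intro image_eqI[of _ _ t]) (auto simp: extend_def)
  qed
qed

lemma extend_inj:
  assumes "inj_on \<phi> {0<..<1}" "\<And>t. 0 < t \<Longrightarrow> t < 1 \<Longrightarrow> Some (\<phi> t) \<noteq> Q0 \<and> Some (\<phi> t) \<noteq> Q1"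
  shows "Q0 \<noteq> Q1 \<Longrightarrow> inj_on (extend \<phi> Q0 Q1) {0..1}" "inj_on (extend \<phi> Q0 Q1) {0..<1}"
proof -
  have i: "s = t" if "\<phi> s = \<phi> t" "0 < s" "s < 1" "0 < t" "t < 1" for s t using assms(1) that by (auto simp: inj_on_def)
  have key: "s = t" if st: "s \<in> {0..1}" "t \<in> {0..1}" "extend \<phi> Q0 Q1 s = extend \<phi> Q0 Q1 t"
    "Q0 \<noteq> Q1 \<or> s < 1 \<and> t < 1" for s t
  proof -
    have v: "extend \<phi> Q0 Q1 r = (if r = 0 then Q0 else if r = 1 then Q1 else Some (\<phi> r))" if "r \<in> {0..1}" for r
      using that unfolding extend_def by auto
    show ?thesis using st(3,4) assms(2)[of s] assms(2)[of t] i[of s t] st(1,2) v[OF st(1)] v[OF st(2)]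
      by (smt (verit) atLeastAtMost_iff option.inject)
  qed
  show "inj_on (extend \<phi> Q0 Q1) {0..<1}" by (rule inj_onI, rule key) auto
  show "inj_on (extend \<phi> Q0 Q1) {0..1}" if "Q0 \<noteq> Q1" by (rule inj_onI, rule key) (use that in auto)
qed

text \<open>The exponential wraps the compact interval onto the circle and is a quotient map, so the
  continuity of \<open>g\<close> passes to the circle.\<close>

lemma jordan_curve_from_loop:
  fixes g :: "real \<Rightarrow> 'b"
  assumes g: "continuous_map (top_of_set {0..1}) X g" and inj: "inj_on g {0..<1}" and loop: "g 0 = g 1"
  shows "jordan_curve_in X (g ` {0..1})"
proof -
  define f where "f t = exp (2 * of_real pi * \<i> * of_real t)" for t :: real
  define h where "h z = g (Arg2pi z / (2 * pi))" for z
  have fs: "f t \<in> sphere 0 1" for t unfolding f_def by (simp add: norm_exp_eq_Re)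
  have hf: "h (f t) = g t" if t: "t \<in> {0..1}" for t
  proof (cases "t = 1")
    case True
    have "f t = of_real 1" unfolding f_def True by simp
    then have "Arg2pi (f t) = 0" using Arg2pi_of_real[of 1] by simp
    then show ?thesis unfolding h_def using loop True by simp
  next
    case False
    have "Arg2pi (f t) = 2 * pi * t" unfolding f_def
      by (rule Arg2pi_unique[of 1]) (use t False in \<open>auto simp: algebra_simps\<close>)
    then show ?thesis unfolding h_def by simp
  qed
  have sur: "\<exists>t\<in>{0..<1}. z = f t \<and> h z = g t" if z: "z \<in> sphere 0 1" for z
  proof -
    define t where "t = Arg2pi z / (2 * pi)"
    have t: "t \<in> {0..<1}" unfolding t_def using Arg2pi[of z] by auto
    have "z = f t" unfolding f_def t_def using Arg2pi_eq[of z] z by (simp add: algebra_simps)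
    then show ?thesis using t unfolding h_def t_def by blast
  qed
  have cf: "continuous_on {0..1} f" unfolding f_def by (intro continuous_intros)
  have imf: "f ` {0..1} = sphere 0 1" using fs sur by force
  have "continuous_map (top_of_set (sphere 0 1)) X h"
    unfolding continuous_map_def
  proof (intro conjI allI impI)
    have "g t \<in> topspace X" if "t \<in> {0..1}" for t using g that unfolding continuous_map_def by auto
    then show "h \<in> topspace (top_of_set (sphere 0 1)) \<rightarrow> topspace X" using sur by fastforce
    fix V assume V: "openin X V"
    let ?U = "{z \<in> topspace (top_of_set (sphere 0 1)). h z \<in> V}"
    have "{0..1} \<inter> f -` ?U = {t \<in> topspace (top_of_set {0..1}). g t \<in> V}" using fs hf by auto
    then have "openin (top_of_set {0..1}) ({0..1} \<inter> f -` ?U)" using g V unfolding continuous_map_def by simp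
    moreover have sub: "?U \<subseteq> sphere 0 1" by auto
    ultimately show "openin (top_of_set (sphere 0 1)) ?U"
      using Abstract_Topology_2.continuous_imp_quotient_map[OF cf imf compact_Icc sub] by blast
  qed
  moreover have "inj_on h (sphere 0 1)"
  proof (rule inj_onI)
    fix z z' assume z: "z \<in> sphere 0 1" "z' \<in> sphere 0 1" "h z = h z'"
    obtain t t' where "t \<in> {0..<1}" "z = f t" "h z = g t" "t' \<in> {0..<1}" "z' = f t'" "h z' = g t'"
      using sur[OF z(1)] sur[OF z(2)] by blast
    moreover from this have "t = t'" using inj_onD[OF inj, of t t'] z(3) by auto
    ultimately show "z = z'" by simp
  qed
  moreover have "g ` {0..1} = h ` sphere 0 1" unfolding imf[symmetric] image_image using hf by auto
  ultimately show ?thesis unfolding jordan_curve_in_def by blast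
qed

context level
begin

lemma edge_paramD:
  assumes "edge_param e \<phi>"
  shows "continuous_on {0<..<1} \<phi>" "inj_on \<phi> {0<..<1}" "\<phi> ` {0<..<1} = e"
    "\<And>s t. 0 < s \<Longrightarrow> s \<le> t \<Longrightarrow> t < 1 \<Longrightarrow> linked (\<phi> s) (\<phi> t) \<and> \<phi> ` {s..t} \<subseteq> seg (\<phi> s) (\<phi> t)"
proof -
  obtain \<psi> where h: "homeomorphism {0<..<1} e \<phi> \<psi>" using assms unfolding edge_param_def by blast
  show "continuous_on {0<..<1} \<phi>" "\<phi> ` {0<..<1} = e" using h unfolding homeomorphism_def by auto
  show "inj_on \<phi> {0<..<1}" using h unfolding homeomorphism_def by (metis inj_onI)
  show "\<And>s t. 0 < s \<Longrightarrow> s \<le> t \<Longrightarrow> t < 1 \<Longrightarrow> linked (\<phi> s) (\<phi> t) \<and> \<phi> ` {s..t} \<subseteq> seg (\<phi> s) (\<phi> t)"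
    using assms unfolding edge_param_def by blast
qed

lemma edge_param_rev:
  assumes p: "edge_param e \<phi>" shows "edge_param e (\<lambda>t. \<phi> (1 - t))"
proof -
  obtain \<psi> where h: "homeomorphism {0<..<1} e \<phi> \<psi>" using p unfolding edge_param_def by blast
  have r: "homeomorphism {0<..<1} {0<..<1::real} (\<lambda>t. 1 - t) (\<lambda>t. 1 - t)"
    unfolding homeomorphism_def
  proof (intro conjI)
    show "(\<lambda>t. 1 - t) ` {0<..<1} = {0<..<1::real}"
    proof (intro subset_antisym subsetI)
      fix t :: real assume "t \<in> {0<..<1}" then show "t \<in> (\<lambda>t. 1 - t) ` {0<..<1}" by (intro image_eqI[of _ _ "1 - t"]) auto
    qed auto
    then show "(\<lambda>t. 1 - t) ` {0<..<1} = {0<..<1::real}" .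
  qed (auto intro!: continuous_intros)
  have "homeomorphism {0<..<1} e (\<phi> \<circ> (\<lambda>t. 1 - t)) ((\<lambda>t. 1 - t) \<circ> \<psi>)" using homeomorphism_compose[OF r h] .
  then have "\<exists>\<psi>. homeomorphism {0<..<1} e (\<lambda>t. \<phi> (1 - t)) \<psi>" by (auto simp: o_def)
  moreover have "linked (\<phi> (1 - s)) (\<phi> (1 - t)) \<and> (\<lambda>t. \<phi> (1 - t)) ` {s..t} \<subseteq> seg (\<phi> (1 - s)) (\<phi> (1 - t))"
    if st: "0 < s" "s \<le> t" "t < 1" for s t
  proof -
    have "(\<lambda>t. \<phi> (1 - t)) ` {s..t} \<subseteq> \<phi> ` {1 - t..1 - s}" by auto
    then show ?thesis using edge_paramD(4)[OF p, of "1 - t" "1 - s"] st linked_sym seg_sym by auto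
  qed
  ultimately show ?thesis unfolding edge_param_def by blast
qed

lemma closure_edge:
  assumes "e \<in> edges" shows "closure e \<subseteq> e \<union> {b. brp b}" "closure e \<subseteq> Z"
proof -
  obtain V where V: "closed V" "e = (Z - {b. brp b}) \<inter> V"
    using closedin_component assms unfolding edges_def by (auto simp: closedin_closed)
  have "closure e \<subseteq> Z \<inter> V" by (rule closure_minimal) (use V closed_Z in auto)
  then show "closure e \<subseteq> e \<union> {b. brp b}" "closure e \<subseteq> Z" using V by blast+
qed

text \<open>An edge that does not run to infinity returns to a bounded region at parameters tending
  to 1 and so accumulates at some \<open>q\<close>. This point is not on the edge, hence is a
  branching point, and the arcs between two late returns are short.\<close>

lemma edge_end:
  assumes e: "e \<in> edges" and p: "edge_param e \<phi>"
  obtains Q where "tends1 \<phi> Q" "\<And>q. Q = Some q \<Longrightarrow> brp q \<and> q \<in> closure e"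
proof (cases "tends1 \<phi> None")
  case True
  then show ?thesis using that[of None] by simp
next
  case False
  note P = edge_paramD[OF p]
  obtain \<psi> where h: "homeomorphism {0<..<1} e \<phi> \<psi>" using p unfolding edge_param_def by blast
  obtain R where nR: "\<not> (\<exists>t\<in>{0<..<1}. \<forall>s. t \<le> s \<longrightarrow> s < 1 \<longrightarrow> norm (\<phi> s) > R)"
    using False unfolding tends1_def option.case by blast
  have R: "\<exists>s. t \<le> s \<and> s < 1 \<and> norm (\<phi> s) \<le> R" if "t \<in> {0<..<1}" for t
    using nR that by (meson not_less)
  \<comment> \<open>The 2 keeps the lower bound strictly between 0 and 1 also for
    \<open>n = 0\<close>.\<close>
  have "\<exists>s. 1 - 1 / (real n + 2) \<le> s \<and> s < 1 \<and> norm (\<phi> s) \<le> R" for n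
    by (rule R) (auto simp: field_simps)
  then obtain s where s: "\<And>n. 1 - 1 / (real n + 2) \<le> s n" "\<And>n. s n < 1" "\<And>n. norm (\<phi> (s n)) \<le> R" by metis
  have s0: "0 < s n" for n
  proof -
    have "1 / (real n + 2) < 1" by (simp add: field_simps)
    then show ?thesis using s(1)[of n] by linarith
  qed
  have slim: "s \<longlonglongrightarrow> 1"
  proof (rule tendsto_sandwich[OF _ _ _ tendsto_const])
    have "(\<lambda>n. 1 / (real n + 2)) \<longlonglongrightarrow> 0" using LIMSEQ_ignore_initial_segment[OF lim_1_over_n, of 2] by (simp add: add.commute)
    from tendsto_diff[OF tendsto_const[of 1] this] show "(\<lambda>n. 1 - 1 / (real n + 2)) \<longlonglongrightarrow> 1" by simp
    show "\<forall>\<^sub>F n in sequentially. 1 - 1 / (real n + 2) \<le> s n" using s(1) by simp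
    show "\<forall>\<^sub>F n in sequentially. s n \<le> 1" using less_imp_le[OF s(2)] by simp
  qed
  have "\<And>n. \<phi> (s n) \<in> cball 0 R" using s(3) by simp
  then obtain q r where q: "strict_mono (r :: nat \<Rightarrow> nat)" "((\<lambda>n. \<phi> (s n)) \<circ> r) \<longlonglongrightarrow> q"
    using compact_cball[of "0::real^2" R] unfolding compact_def by metis
  have qe: "\<phi> (s n) \<in> e" for n using P(3) s0[of n] s(2)[of n] by auto
  have qc: "q \<in> closure e" unfolding closure_sequential
    by (rule exI[of _ "(\<lambda>n. \<phi> (s n)) \<circ> r"]) (use q(2) qe in auto)
  have sr: "(s \<circ> r) \<longlonglongrightarrow> 1" using LIMSEQ_subseq_LIMSEQ[OF slim q(1)] .
  \<comment> \<open>On the edge the inverse \<open>\<psi>\<close> would be continuous at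
    \<open>q\<close> with value the limit 1 of the parameters, outside the open interval.\<close>
  have "q \<notin> e"
  proof
    assume qe': "q \<in> e"
    have "continuous_on e \<psi>" using h unfolding homeomorphism_def by blast
    then have "(\<lambda>n. \<psi> (((\<lambda>n. \<phi> (s n)) \<circ> r) n)) \<longlonglongrightarrow> \<psi> q"
      using continuous_on_tendsto_compose[OF _ q(2) qe'] qe by auto
    moreover have "\<psi> (\<phi> (s n)) = s n" for n using h s0[of n] s(2)[of n] unfolding homeomorphism_def by auto
    ultimately have "(s \<circ> r) \<longlonglongrightarrow> \<psi> q" by (simp add: o_def)
    then have "\<psi> q = 1" using LIMSEQ_unique sr by blast
    moreover have "\<psi> q \<in> {0<..<1}" using h qe' unfolding homeomorphism_def by blast
    ultimately show False by simp
  qed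
  then have bq: "brp q" using closure_edge(1)[OF e] qc by blast
  have Fq: "F q = 0" using brp_Z[OF bq] .
  have "tends1 \<phi> (Some q)"
    unfolding tends1_def option.case
  proof (intro allI impI)
    fix \<epsilon> :: real assume eps: "\<epsilon> > 0"
    obtain \<delta> where \<delta>: "\<delta> > 0" "\<And>z. F z = 0 \<Longrightarrow> dist z q < \<delta> \<Longrightarrow> linked q z \<and> seg q z \<subseteq> cball q (\<epsilon>/2)"
      using local_seg[OF Fq, of "\<epsilon>/2"] eps by auto
    obtain N where N: "\<And>n. n \<ge> N \<Longrightarrow> dist (\<phi> (s (r n))) q < \<delta>" using q(2) \<delta>(1) unfolding lim_sequentially by auto
    have near: "linked q (\<phi> (s (r n))) \<and> seg q (\<phi> (s (r n))) \<subseteq> cball q (\<epsilon>/2)" if "n \<ge> N" for n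
    proof -
      have "\<phi> (s (r n)) \<in> Z" using qe[of "r n"] edge_basic(2)[OF e] by blast
      then show ?thesis using \<delta>(2)[OF _ N[OF that]] by simp
    qed
    let ?t = "s (r N)"
    have "dist (\<phi> c) q < \<epsilon>" if c: "?t \<le> c" "c < 1" for c
    proof -
      obtain M where M: "\<And>n. n \<ge> M \<Longrightarrow> dist (s (r n)) 1 < 1 - c" 
        using metric_LIMSEQ_D[OF sr, of "1 - c"] c(2) by auto
      define n where "n = max M N"
      have "c \<le> s (r n)" using M[of n] unfolding n_def by (auto simp: dist_real_def)
      then have cc: "?t \<le> s (r n)" "c \<in> {?t..s (r n)}" using c by auto
      \<comment> \<open>Any later point lies between two returns close to \<open>q\<close>, and the
        arc between these is covered by their two short arcs to \<open>q\<close>.\<close>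
      have "\<phi> c \<in> seg (\<phi> ?t) (\<phi> (s (r n)))" using P(4)[OF s0 cc(1) s(2)] cc(2) by blast
      also have "\<dots> \<subseteq> seg (\<phi> ?t) q \<union> seg q (\<phi> (s (r n)))"
        using seg_triangle near[of N] near[of n] linked_sym unfolding n_def by auto
      also have "\<dots> \<subseteq> cball q (\<epsilon>/2)" using near[of N] near[of n] seg_sym unfolding n_def by auto
      finally show ?thesis using eps by (simp add: dist_commute)
    qed
    then show "\<exists>t\<in>{0<..<1}. \<forall>s. t \<le> s \<longrightarrow> s < 1 \<longrightarrow> dist (\<phi> s) q < \<epsilon>"
      using s0[of "r N"] s(2)[of "r N"] by (intro bexI[of _ ?t]) auto
  qed
  then show ?thesis using that[of "Some q"] bq qc by simp
qed

text \<open>No loops: if both ends were \<open>q\<close>, the middle of the edge would lie on an arc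
  between two points near \<open>q\<close>, hence within half of its own distance from
  \<open>q\<close>.\<close>

lemma edge_ends_distinct:
  assumes e: "e \<in> edges" and p: "edge_param e \<phi>" and Q: "tends1 \<phi> (Some q)" "tends1 (\<lambda>t. \<phi> (1 - t)) (Some q)"
    and bq: "brp q"
  shows False
proof -
  note P = edge_paramD[OF p]
  let ?p = "\<phi> (1/2)"
  have pe: "?p \<in> e" using P(3) by auto
  have Fq: "F q = 0" using brp_Z[OF bq] .
  define \<epsilon> where "\<epsilon> = dist ?p q / 2"
  have eps: "\<epsilon> > 0" using edge_basic(4)[OF e pe] bq unfolding \<epsilon>_def by auto
  obtain \<delta> where \<delta>: "\<delta> > 0" "\<And>z. F z = 0 \<Longrightarrow> dist z q < \<delta> \<Longrightarrow> linked q z \<and> seg q z \<subseteq> cball q \<epsilon>"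
    using local_seg[OF Fq eps] by blast
  obtain t where t: "t\<in>{0<..<1}" "\<forall>s. t \<le> s \<longrightarrow> s < 1 \<longrightarrow> dist (\<phi> s) q < \<delta>" using tends1_Some[OF Q(1) \<delta>(1)] by blast
  obtain t' where t': "t'\<in>{0<..<1}" "\<forall>s. t' \<le> s \<longrightarrow> s < 1 \<longrightarrow> dist (\<phi> (1 - s)) q < \<delta>" using tends1_Some[OF Q(2) \<delta>(1)] by blast
  define b where "b = max t (1/2)"
  define a where "a = 1 - max t' (1/2)"
  have ab: "0 < a" "a \<le> b" "b < 1" "1/2 \<in> {a..b}" using t(1) t'(1) unfolding a_def b_def by auto
  have d: "dist (\<phi> b) q < \<delta>" "dist (\<phi> a) q < \<delta>"
    using t t' unfolding a_def b_def by auto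
  have "\<phi> a \<in> e" "\<phi> b \<in> e" using P(3) ab by auto
  then have "\<phi> a \<in> Z" "\<phi> b \<in> Z" using edge_basic(2)[OF e] by blast+
  then have near: "linked q (\<phi> a) \<and> seg q (\<phi> a) \<subseteq> cball q \<epsilon>" "linked q (\<phi> b) \<and> seg q (\<phi> b) \<subseteq> cball q \<epsilon>"
    using \<delta>(2) d by auto
  have "?p \<in> seg (\<phi> a) (\<phi> b)" using P(4)[OF ab(1-3)] ab(4) by blast
  then have "?p \<in> cball q \<epsilon>" using seg_triangle[OF linked_sym, of q "\<phi> a" "\<phi> b"] near seg_sym by blast
  then show False using eps unfolding \<epsilon>_def by (simp add: dist_commute)
qed


text \<open>Near the starting end the edge is away from \<open>y\<close> because it tends elsewhere;
  the remaining parameters form a compact interval.\<close>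

lemma edge_away:
  assumes p: "edge_param e \<phi>" and Q: "tends1 \<phi> Q1" "tends1 (\<lambda>t. \<phi> (1 - t)) Q0" and y: "Some y \<noteq> Q0"
    and t: "0 < t" "t < 1" and ye: "y \<notin> e"
  obtains r where "r > 0" "\<And>s. 0 < s \<Longrightarrow> s \<le> t \<Longrightarrow> r \<le> dist (\<phi> s) y"
proof -
  note P = edge_paramD[OF p]
  obtain t0 \<epsilon> where t0: "0 < t0" "t0 < 1" "\<epsilon> > 0" "\<And>s. t0 \<le> s \<Longrightarrow> s < 1 \<Longrightarrow> \<epsilon> \<le> dist (\<phi> (1 - s)) y"
    using tends1_far[OF Q(2) y] by blast
  have "compact (\<phi> ` {1 - t0..t})"
    by (rule compact_continuous_image) (use P(1) t0 t in \<open>auto intro: continuous_on_subset\<close>)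
  moreover have "\<phi> ` {1 - t0..t} \<subseteq> e" unfolding P(3)[symmetric] using t0 t by (intro image_mono) auto
  ultimately obtain d where d: "d > 0" "\<And>z. z \<in> \<phi> ` {1 - t0..t} \<Longrightarrow> d \<le> dist z y"
    using separate_compact_closed[of "\<phi> ` {1 - t0..t}" "{y}"] ye by auto
  have "min d \<epsilon> \<le> dist (\<phi> s) y" if s: "0 < s" "s \<le> t" for s
  proof (cases "1 - t0 \<le> s")
    case True then show ?thesis using d(2)[of "\<phi> s"] s by auto
  next
    case False then show ?thesis using t0(4)[of "1 - s"] s by auto
  qed
  then show ?thesis using that[of "min d \<epsilon>"] d(1) t0(3) by auto
qed

lemma edge_closure_ends:
  assumes e: "e \<in> edges" and p: "edge_param e \<phi>" and Q: "tends1 \<phi> Q1" "tends1 (\<lambda>t. \<phi> (1 - t)) Q0"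
    and y: "y \<in> closure e" "y \<notin> e"
  shows "Some y = Q0 \<or> Some y = Q1"
proof (rule ccontr)
  assume n: "\<not> ?thesis"
  note P = edge_paramD[OF p]
  obtain t \<epsilon> where t: "0 < t" "t < 1" "\<epsilon> > 0" "\<And>s. t \<le> s \<Longrightarrow> s < 1 \<Longrightarrow> \<epsilon> \<le> dist (\<phi> s) y"
    using tends1_far[OF Q(1), of y] n by metis
  have y0: "Some y \<noteq> Q0" using n by simp
  obtain r where r: "r > 0" "\<And>s. 0 < s \<Longrightarrow> s \<le> t \<Longrightarrow> r \<le> dist (\<phi> s) y"
    using edge_away[OF p Q y0 t(1,2) y(2)] by blast
  obtain z where z: "z \<in> e" "dist z y < min r \<epsilon>" using y(1) r(1) t(3) closure_approachable by (metis min_less_iff_conj)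
  then obtain s where s: "0 < s" "s < 1" "z = \<phi> s" using P(3) by auto
  show False using r(2)[of s] t(4)[of s] s z(2) by (cases "s \<le> t") auto
qed

section \<open>Tangents and half-tangents\<close>

lemma direction_limit:
  assumes Fx: "F x = 0" and w: "w = rot (u x) \<or> w = - rot (u x)"
    and s: "\<And>n. F (s n) = 0" "\<And>n. s n \<noteq> x" "s \<longlonglongrightarrow> x" "\<And>n. w \<bullet> (s n - x) > 0"
  shows "(\<lambda>n. sgn (s n - x)) \<longlonglongrightarrow> w"
proof -
  have nu: "norm (u x) = 1" using norm_u[OF Fx] .
  let ?v = "\<lambda>n. sgn (s n - x)"
  have nv: "norm (?v n) = 1" for n using s(2)[of n] by (simp add: norm_sgn)
  have ulim: "(\<lambda>n. u x \<bullet> ?v n) \<longlonglongrightarrow> 0"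
    unfolding lim_sequentially
  proof (intro allI impI)
    fix \<epsilon> :: real assume eps: "\<epsilon> > 0"
    obtain r where r: "r > 0" "\<And>z. F z = 0 \<Longrightarrow> z \<noteq> x \<Longrightarrow> dist z x < r \<Longrightarrow> \<bar>u x \<bullet> (z - x)\<bar> < \<epsilon> * norm (z - x)"
      using tangent_cone[OF Fx eps] by blast
    obtain N where N: "\<And>n. n \<ge> N \<Longrightarrow> dist (s n) x < r" using s(3) r(1) unfolding lim_sequentially by blast
    have "dist (u x \<bullet> ?v n) 0 < \<epsilon>" if "n \<ge> N" for n
    proof -
      have pos: "norm (s n - x) > 0" using s(2)[of n] by simp
      have "\<bar>u x \<bullet> ?v n\<bar> = \<bar>u x \<bullet> (s n - x)\<bar> / norm (s n - x)"
        by (simp add: sgn_div_norm abs_mult divide_inverse mult.commute)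
      also have "\<dots> < \<epsilon>" using r(2)[OF s(1,2) N[OF that]] pos by (simp add: pos_divide_less_eq)
      finally show ?thesis by simp
    qed
    then show "\<exists>N. \<forall>n\<ge>N. dist (u x \<bullet> ?v n) 0 < \<epsilon>" by blast
  qed
  have sq: "(rot (u x) \<bullet> ?v n)^2 = 1 - (u x \<bullet> ?v n)^2" for n
    using plane_norm_decomp[OF nu, of "?v n"] nv[of n] by simp
  have "w \<bullet> ?v n > 0" for n
    using s(4)[of n] s(2)[of n] by (simp add: sgn_div_norm)
  moreover have "(w \<bullet> ?v n)^2 = 1 - (u x \<bullet> ?v n)^2" for n using sq[of n] w by auto
  \<comment> \<open>The side condition fixes the sign of the tangential component, so Pythagoras
    determines it from the normal one, which tends to 0.\<close>
  ultimately have weq: "w \<bullet> ?v n = sqrt (1 - (u x \<bullet> ?v n)^2)" for n by (metis less_imp_le real_sqrt_unique)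
  have "(\<lambda>n. sqrt (1 - (u x \<bullet> ?v n)^2)) \<longlonglongrightarrow> sqrt (1 - 0^2)" by (intro tendsto_intros ulim)
  then have wlim: "(\<lambda>n. w \<bullet> ?v n) \<longlonglongrightarrow> 1" unfolding weq by simp
  have "?v n = (u x \<bullet> ?v n) *\<^sub>R u x + (w \<bullet> ?v n) *\<^sub>R w" for n
    using plane_decomp[OF nu, of "?v n"] w by auto
  moreover have "(\<lambda>n. (u x \<bullet> ?v n) *\<^sub>R u x + (w \<bullet> ?v n) *\<^sub>R w) \<longlonglongrightarrow> 0 *\<^sub>R u x + 1 *\<^sub>R w"
    by (intro tendsto_intros ulim wlim)
  ultimately show ?thesis by simp
qed

text \<open>By \<open>side_cone\<close> late points of the sequence lie strictly on one of the two
  sides; one side occurs infinitely often, and \<open>direction_limit\<close> applies to that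
  subsequence.\<close>

lemma direction_in_tangent:
  assumes Fx: "F x = 0" and s: "\<And>n. F (s n) = 0" "\<And>n. s n \<noteq> x" "s \<longlonglongrightarrow> x" "(\<lambda>n. sgn (s n - x)) \<longlonglongrightarrow> v"
  shows "v = rot (u x) \<or> v = - rot (u x)"
proof -
  let ?t = "rot (u x)"
  obtain r where r: "r > 0" "\<And>z. F z = 0 \<Longrightarrow> z \<noteq> x \<Longrightarrow> dist z x < r \<Longrightarrow> \<bar>?t \<bullet> (z - x)\<bar> > norm (z - x) / 2"
    using side_cone[OF Fx] by blast
  obtain N where N: "\<And>n. n \<ge> N \<Longrightarrow> dist (s n) x < r" using s(3) r(1) unfolding lim_sequentially by blast
  have nz: "?t \<bullet> (s n - x) > 0 \<or> - ?t \<bullet> (s n - x) > 0" if "n \<ge> N" for n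
  proof -
    have "norm (s n - x) > 0" using s(2)[of n] by simp
    then have "\<bar>?t \<bullet> (s n - x)\<bar> > 0" using r(2)[OF s(1,2) N[OF that]] by linarith
    then show ?thesis by auto
  qed
  have "\<exists>w. (w = ?t \<or> w = - ?t) \<and> infinite {n. n \<ge> N \<and> w \<bullet> (s n - x) > 0}"
  proof (rule ccontr)
    assume "\<not> ?thesis"
    then have "finite {n. n \<ge> N \<and> ?t \<bullet> (s n - x) > 0}" "finite {n. n \<ge> N \<and> - ?t \<bullet> (s n - x) > 0}" by blast+
    then have "finite ({n. n \<ge> N \<and> ?t \<bullet> (s n - x) > 0} \<union> {n. n \<ge> N \<and> - ?t \<bullet> (s n - x) > 0})" by blast
    then have "finite {N..}" by (rule finite_subset[rotated]) (use nz in auto)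
    then show False using infinite_Ici by blast
  qed
  then obtain w where w: "w = ?t \<or> w = - ?t" "infinite {n. n \<ge> N \<and> w \<bullet> (s n - x) > 0}" by blast
  obtain k :: "nat \<Rightarrow> nat" where k: "strict_mono k" "\<And>n. k n \<in> {n. n \<ge> N \<and> w \<bullet> (s n - x) > 0}"
    using infinite_enumerate[OF w(2)] by auto
  have "(\<lambda>n. sgn ((s \<circ> k) n - x)) \<longlonglongrightarrow> w"
  proof (rule direction_limit[OF Fx w(1)])
    show "F ((s \<circ> k) n) = 0" "(s \<circ> k) n \<noteq> x" for n using s(1,2) by simp_all
    show "(s \<circ> k) \<longlonglongrightarrow> x" using LIMSEQ_subseq_LIMSEQ[OF s(3) k(1)] .
    show "w \<bullet> ((s \<circ> k) n - x) > 0" for n using k(2)[of n] by simp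
  qed
  moreover have "(\<lambda>n. sgn ((s \<circ> k) n - x)) \<longlonglongrightarrow> v" using LIMSEQ_subseq_LIMSEQ[OF s(4) k(1)] by (simp add: o_def)
  ultimately have "v = w" using LIMSEQ_unique by blast
  then show ?thesis using w(1) by blast
qed

lemma norm_tangent:
  assumes "F x = 0" "w = rot (u x) \<or> w = - rot (u x)" shows "norm w = 1" "w \<bullet> u x = 0"
  using norm_u[OF assms(1)] assms(2) by auto

text \<open>Limit directions can only be the two tangent vectors, and \<open>two_sided\<close>
  provides zeros arriving along each of them.\<close>

lemma tangent_interior:
  assumes HZ: "H \<subseteq> Z" and x: "x \<in> H" and r: "r > 0" "\<And>z. F z = 0 \<Longrightarrow> dist z x < r \<Longrightarrow> z \<in> H"
  shows "has_tangent_at H x"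
proof -
  have Fx: "F x = 0" using HZ x by auto
  let ?t = "rot (u x)"
  have ex: "\<exists>s::nat \<Rightarrow> real^2. (\<forall>n. s n \<in> H \<and> s n \<noteq> x) \<and> s \<longlonglongrightarrow> x \<and> (\<lambda>n. sgn (s n - x)) \<longlonglongrightarrow> w"
    if w: "w = ?t \<or> w = - ?t" for w
  proof -
    have "\<exists>z. F z = 0 \<and> dist z x < min r (1 / real (Suc n)) \<and> w \<bullet> (z - x) > 0" for n
      by (rule two_sided[OF Fx norm_tangent(2,1)[OF Fx w]]) (use r in auto)
    then obtain s where s: "\<And>n. F (s n) = 0 \<and> dist (s n) x < min r (1 / real (Suc n)) \<and> w \<bullet> (s n - x) > 0" by metis
    have "s n \<noteq> x" for n using s[of n] by auto
    moreover have "s n \<in> H" for n using r(2)[of "s n"] s[of n] by auto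
    moreover have slim: "s \<longlonglongrightarrow> x"
    proof (rule metric_LIMSEQ_I)
      fix e :: real assume "e > 0"
      then obtain N where N: "1 / real (Suc N) < e" using nat_approx_posE by blast
      have "dist (s n) x < e" if "n \<ge> N" for n
      proof -
        have "1 / real (Suc n) \<le> 1 / real (Suc N)" using that by (simp add: field_simps)
        moreover have "dist (s n) x < 1 / real (Suc n)" using s[of n] by simp
        ultimately show ?thesis using N by linarith
      qed
      then show "\<exists>N. \<forall>n\<ge>N. dist (s n) x < e" by blast
    qed
    moreover have "(\<lambda>n. sgn (s n - x)) \<longlonglongrightarrow> w"
      by (rule direction_limit[OF Fx w]) (use s calculation in auto)
    ultimately show ?thesis by blast
  qed
  have "contingent H x = half_line x ?t \<union> half_line x (- ?t)"
  proof (intro subset_antisym subsetI)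
    fix y assume "y \<in> contingent H x"
    then obtain v and s :: "nat \<Rightarrow> real^2" where v: "y \<in> half_line x v" "\<And>n. s n \<in> H" "\<And>n. s n \<noteq> x" "s \<longlonglongrightarrow> x" "(\<lambda>n. sgn (s n - x)) \<longlonglongrightarrow> v"
      unfolding contingent_def by auto
    have "F (s n) = 0" for n using v(2)[of n] HZ by auto
    then have "v = ?t \<or> v = - ?t" using direction_in_tangent[OF Fx _ v(3,4,5)] by blast
    then show "y \<in> half_line x ?t \<union> half_line x (- ?t)" using v(1) by blast
  next
    fix y assume "y \<in> half_line x ?t \<union> half_line x (- ?t)"
    then obtain w where w: "w = ?t \<or> w = - ?t" "y \<in> half_line x w" by blast
    then show "y \<in> contingent H x" unfolding contingent_def using ex[OF w(1)] norm_tangent(1)[OF Fx w(1)] by blast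
  qed
  also have "\<dots> = {x + t *\<^sub>R ?t | t. True}"
  proof (intro subset_antisym subsetI)
    fix y assume "y \<in> half_line x ?t \<union> half_line x (- ?t)"
    then show "y \<in> {x + t *\<^sub>R ?t | t. True}" unfolding half_line_def by (auto intro: exI[of _ "- _"])
  next
    fix y assume "y \<in> {x + t *\<^sub>R ?t | t. True}"
    then obtain t where t: "y = x + t *\<^sub>R ?t" by blast
    show "y \<in> half_line x ?t \<union> half_line x (- ?t)"
    proof (cases "t \<ge> 0")
      case False
      then have "y = x + (- t) *\<^sub>R (- ?t)" "0 \<le> - t" using t by auto
      then show ?thesis unfolding half_line_def by blast
    qed (use t in \<open>auto simp: half_line_def\<close>)
  qed
  finally have "contingent H x = {x + t *\<^sub>R ?t | t. True}" .
  moreover have "?t \<noteq> 0" using norm_tangent(1)[OF Fx disjI1[OF refl]] by (metis norm_zero zero_neq_one)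
  ultimately show ?thesis unfolding has_tangent_at_def is_line_def by blast
qed

lemma half_tangent_end:
  assumes HZ: "H \<subseteq> Z" and Fq: "F q = 0" and w: "w = rot (u q) \<or> w = - rot (u q)"
    and r: "r > 0" "\<And>z. z \<in> H \<Longrightarrow> z \<noteq> q \<Longrightarrow> dist z q < r \<Longrightarrow> w \<bullet> (z - q) > 0"
    and lim: "q islimpt H"
  shows "has_half_tangent_at H q"
proof -
  have dir: "(\<lambda>n. sgn (s n - q)) \<longlonglongrightarrow> w" if s: "\<And>n. s n \<in> H" "\<And>n. s n \<noteq> q" "s \<longlonglongrightarrow> q" for s :: "nat \<Rightarrow> real^2"
  proof -
    obtain N where N: "\<And>n. n \<ge> N \<Longrightarrow> dist (s n) q < r" using s(3) r(1) unfolding lim_sequentially by blast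
    have "(\<lambda>n. sgn ((\<lambda>n. s (n + N)) n - q)) \<longlonglongrightarrow> w"
    proof (rule direction_limit[OF Fq w])
      show "F (s (n + N)) = 0" "s (n + N) \<noteq> q" for n using s(1)[of "n + N"] s(2)[of "n + N"] HZ by auto
      show "w \<bullet> (s (n + N) - q) > 0" for n using r(2)[OF s(1,2) N] by simp
      show "(\<lambda>n. s (n + N)) \<longlonglongrightarrow> q" using LIMSEQ_ignore_initial_segment[OF s(3)] .
    qed
    then show ?thesis using LIMSEQ_offset[of "\<lambda>n. sgn (s n - q)" N] by simp
  qed
  obtain s0 :: "nat \<Rightarrow> real^2" where s0: "\<And>n. s0 n \<in> H - {q}" "s0 \<longlonglongrightarrow> q"
    using lim unfolding islimpt_sequential by blast
  then have s0': "\<And>n. s0 n \<in> H" "\<And>n. s0 n \<noteq> q" by blast+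
  have "contingent H q = half_line q w"
  proof (intro subset_antisym subsetI)
    fix y assume "y \<in> contingent H q"
    then obtain v and s :: "nat \<Rightarrow> real^2" where v: "y \<in> half_line q v" "\<And>n. s n \<in> H" "\<And>n. s n \<noteq> q" "s \<longlonglongrightarrow> q" "(\<lambda>n. sgn (s n - q)) \<longlonglongrightarrow> v"
      unfolding contingent_def by auto
    then have "v = w" using LIMSEQ_unique dir[OF v(2-4)] by blast
    then show "y \<in> half_line q w" using v(1) by blast
  next
    fix y assume "y \<in> half_line q w"
    then show "y \<in> contingent H q" unfolding contingent_def using dir[OF s0' s0(2)] s0' s0(2) norm_tangent(1)[OF Fq w] by blast
  qed
  moreover have "w \<noteq> 0" using norm_tangent(1)[OF Fq w] by auto
  ultimately show ?thesis unfolding has_half_tangent_at_def is_half_line_def by blast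
qed

text \<open>Near the end the tangential coordinate relative to \<open>q\<close> is continuous and
  never 0, so the edge arrives from one side only; its earlier part and its other end keep a
  positive distance from \<open>q\<close>.\<close>

lemma edge_end_half_tangent:
  assumes e: "e \<in> edges" and p: "edge_param e \<phi>" and Q: "tends1 \<phi> (Some q)" "tends1 (\<lambda>t. \<phi> (1 - t)) Q0"
    and bq: "brp q" "q \<in> closure e" and ne: "Q0 \<noteq> Some q"
    and H: "H \<subseteq> Z" "e \<subseteq> H" "\<And>z. z \<in> H \<Longrightarrow> z \<in> e \<or> z = q \<or> Some z = Q0"
  shows "has_half_tangent_at H q"
proof -
  note P = edge_paramD[OF p]
  have Fq: "F q = 0" using brp_Z[OF bq(1)] .
  have qe: "q \<notin> e" using edge_basic(4)[OF e] bq(1) by blast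
  obtain r0 where r0: "r0 > 0" "\<And>z. F z = 0 \<Longrightarrow> z \<noteq> q \<Longrightarrow> dist z q < r0 \<Longrightarrow> \<bar>rot (u q) \<bullet> (z - q)\<bar> > norm (z - q) / 2"
    using side_cone[OF Fq] by blast
  obtain t where t: "t\<in>{0<..<1}" "\<forall>s. t \<le> s \<longrightarrow> s < 1 \<longrightarrow> dist (\<phi> s) q < r0" using tends1_Some[OF Q(1) r0(1)] by blast
  let ?T = "(\<lambda>s. rot (u q) \<bullet> (\<phi> s - q)) ` {t..<1}"
  have "continuous_on {t..<1} \<phi>" by (rule continuous_on_subset[OF P(1)]) (use t(1) in auto)
  then have con: "connected ?T" by (intro connected_continuous_image continuous_intros) auto
  have nz: "rot (u q) \<bullet> (\<phi> s - q) \<noteq> 0" if s: "t \<le> s" "s < 1" for s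
  proof -
    have se: "\<phi> s \<in> e" using P(3) s t(1) by auto
    then have "F (\<phi> s) = 0" "\<phi> s \<noteq> q" using edge_basic(2)[OF e] qe by auto
    then have "\<bar>rot (u q) \<bullet> (\<phi> s - q)\<bar> > norm (\<phi> s - q) / 2" using r0(2) t(2) s by blast
    then show ?thesis using norm_ge_zero[of "\<phi> s - q"] by linarith
  qed
  have "\<exists>w. (w = rot (u q) \<or> w = - rot (u q)) \<and> (\<forall>s. t \<le> s \<longrightarrow> s < 1 \<longrightarrow> w \<bullet> (\<phi> s - q) > 0)"
  proof (rule ccontr)
    assume n: "\<not> ?thesis"
    obtain s where s: "t \<le> s" "s < 1" "\<not> rot (u q) \<bullet> (\<phi> s - q) > 0" using n by blast
    obtain s' where s': "t \<le> s'" "s' < 1" "\<not> - rot (u q) \<bullet> (\<phi> s' - q) > 0" using n by blast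
    have "rot (u q) \<bullet> (\<phi> s - q) \<le> 0" "0 \<le> rot (u q) \<bullet> (\<phi> s' - q)" using s(3) s'(3) by auto
    then have "0 \<in> ?T" using connectedD_interval[OF con, of "rot (u q) \<bullet> (\<phi> s - q)" "rot (u q) \<bullet> (\<phi> s' - q)" 0] s s' by auto
    then show False using nz by auto
  qed
  then obtain w where w: "w = rot (u q) \<or> w = - rot (u q)" "\<And>s. t \<le> s \<Longrightarrow> s < 1 \<Longrightarrow> w \<bullet> (\<phi> s - q) > 0" by blast
  have ne': "Some q \<noteq> Q0" using ne by simp
  have t01: "0 < t" "t < 1" using t(1) by auto
  obtain r1 where r1: "r1 > 0" "\<And>s. 0 < s \<Longrightarrow> s \<le> t \<Longrightarrow> r1 \<le> dist (\<phi> s) q"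
    using edge_away[OF p Q ne' t01 qe] by blast
  obtain r2 where r2: "r2 > 0" "\<And>z. Some z = Q0 \<Longrightarrow> r2 \<le> dist z q"
  proof (cases Q0)
    case None then show ?thesis using that[of 1] by simp
  next
    case (Some a) then show ?thesis using that[of "dist a q"] ne by auto
  qed
  show ?thesis
  proof (rule half_tangent_end[OF H(1) Fq w(1)])
    show "min r1 r2 > 0" using r1 r2 by simp
    show "w \<bullet> (z - q) > 0" if z: "z \<in> H" "z \<noteq> q" "dist z q < min r1 r2" for z
    proof -
      have "Some z \<noteq> Q0" using r2(2)[of z] z(3) by auto
      then have "z \<in> e" using H(3)[OF z(1)] z(2) by blast
      then obtain s where s: "0 < s" "s < 1" "z = \<phi> s" using P(3) by auto
      then have "\<not> s \<le> t" using r1(2)[of s] z(3) by auto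
      then show ?thesis using w(2)[of s] s by simp
    qed
    have "q islimpt e" using bq(2) qe by (simp add: closure_def)
    then show "q islimpt H" using islimpt_subset H(2) by blast
  qed
qed

section \<open>Closed edges as nice curves\<close>

definition hull_edge :: "(real^2) set \<Rightarrow> (real^2) set" where
  "hull_edge e = e \<union> (closure e \<inter> {b. brp b})"

text \<open>Repeats \<open>nice_curve\<close> with \<open>brp\<close>, so that both agree by
  unfolding.\<close>

definition nice :: "(real^2) set \<Rightarrow> (real^2) set \<Rightarrow> bool" where
  "nice H E \<longleftrightarrow>
     ((\<exists>a b. brp a \<and> brp b \<and> arc_between euclidean H a b \<and> E = {a, b}) \<or>
      (\<exists>a \<gamma>. brp a \<and> arc_between S2 \<gamma> (Some a) None \<and> H = {y. Some y \<in> \<gamma>} \<and> E = {a}) \<or>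
      (\<exists>\<gamma>. jordan_curve_in S2 \<gamma> \<and> None \<in> \<gamma> \<and> H = {y. Some y \<in> \<gamma>} \<and> E = {})) \<and>
     (\<forall>x \<in> H - E. has_tangent_at H x) \<and> (\<forall>x \<in> E. has_half_tangent_at H x)"

text \<open>By \<open>closure_edge\<close> the hull is the closure of the edge. The three kinds of
  nice curves correspond to two, one or no ends in the plane, and the parametrisation is completed
  by its two limits.\<close>

lemma hull_edge_nice:
  assumes e: "e \<in> edges"
  shows "nice (hull_edge e) (hull_edge e \<inter> {b. brp b})"
proof -
  let ?H = "hull_edge e"
  let ?E = "?H \<inter> {b. brp b}"
  obtain \<phi> where p: "edge_param e \<phi>" using edge_param_exists[OF e] .
  note P = edge_paramD[OF p]
  have pr: "edge_param e (\<lambda>t. \<phi> (1 - t))" using edge_param_rev[OF p] .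
  obtain Q1 where Q1: "tends1 \<phi> Q1" "\<And>q. Q1 = Some q \<Longrightarrow> brp q \<and> q \<in> closure e" using edge_end[OF e p] by blast
  obtain Q0 where Q0: "tends1 (\<lambda>t. \<phi> (1 - t)) Q0" "\<And>q. Q0 = Some q \<Longrightarrow> brp q \<and> q \<in> closure e" using edge_end[OF e pr] by blast
  have rr: "(\<lambda>t. (\<lambda>t. \<phi> (1 - t)) (1 - t)) = \<phi>" by simp
  have eb: "e \<inter> {b. brp b} = {}" using edge_basic(4)[OF e] by blast
  have HZ: "?H \<subseteq> Z" using edge_basic(2)[OF e] closure_edge(2)[OF e] unfolding hull_edge_def by blast
  have HQ: "z \<in> e \<or> Some z = Q0 \<or> Some z = Q1" if "z \<in> ?H" for z
    using edge_closure_ends[OF e p Q1(1) Q0(1)] that unfolding hull_edge_def by blast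
  have QE: "z \<in> ?E" if "Some z = Q0 \<or> Some z = Q1" for z
    using that Q0(2)[of z] Q1(2)[of z] unfolding hull_edge_def by auto
  have EQ: "?E = {z. Some z = Q0 \<or> Some z = Q1}" using QE HQ eb by blast
  \<comment> \<open>The two ends can coincide only at infinity, which is the case of a Jordan
    curve.\<close>
  have ne: "Q0 \<noteq> Q1" if fin: "Q0 \<noteq> None \<or> Q1 \<noteq> None"
  proof
    assume eq: "Q0 = Q1"
    then obtain q where "Q1 = Some q" "Q0 = Some q" using fin by auto
    then show False using edge_ends_distinct[OF e p] Q1 Q0 by blast
  qed
  have tang: "has_tangent_at ?H x" if "x \<in> ?H - ?E" for x
  proof -
    have xe: "x \<in> e" using that unfolding hull_edge_def by blast
    obtain r where "r > 0" "\<And>z. F z = 0 \<Longrightarrow> dist z x < r \<Longrightarrow> z \<in> e" using edge_open[OF e xe] by blast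
    then show ?thesis using tangent_interior[OF HZ, of x r] that unfolding hull_edge_def by blast
  qed
  have eH: "e \<subseteq> ?H" unfolding hull_edge_def by blast
  have half: "has_half_tangent_at ?H q" if "q \<in> ?E" for q
  proof -
    have "Some q = Q0 \<or> Some q = Q1" using that EQ by blast
    then show ?thesis
    proof
      assume q: "Some q = Q1"
      show ?thesis
        by (rule edge_end_half_tangent[OF e p _ Q0(1) _ _ _ HZ eH]) (use q Q1 ne HQ in \<open>force+\<close>)
    next
      assume q: "Some q = Q0"
      have Q1r: "tends1 (\<lambda>t. (\<lambda>t. \<phi> (1 - t)) (1 - t)) Q1" using Q1(1) by simp
      show ?thesis
        by (rule edge_end_half_tangent[OF e pr _ Q1r _ _ _ HZ eH]) (use q Q0 ne HQ in \<open>force+\<close>)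
    qed
  qed
  have notQ: "Some (\<phi> t) \<noteq> Q0 \<and> Some (\<phi> t) \<noteq> Q1" if "0 < t" "t < 1" for t
  proof -
    have "\<phi> t \<in> e" using P(3) that by auto
    then show ?thesis using QE eb by blast
  qed
  have gam: "{y. Some y \<in> {Q0, Q1} \<union> Some ` e} = ?H" using HQ QE eH by auto
  have ext: "continuous_map (top_of_set {0..1}) S2 (extend \<phi> Q0 Q1)" using extend_continuous[OF P(1) Q1(1) Q0(1)] .
  have extim: "extend \<phi> Q0 Q1 ` {0..1} = {Q0, Q1} \<union> Some ` e" using extend_image[of \<phi> Q0 Q1] P(3) by simp
  have ends: "extend \<phi> Q0 Q1 0 = Q0" "extend \<phi> Q0 Q1 1 = Q1" by (simp_all add: extend_def)
  have "(\<exists>a b. brp a \<and> brp b \<and> arc_between euclidean ?H a b \<and> ?E = {a, b}) \<or>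
      (\<exists>a \<gamma>. brp a \<and> arc_between S2 \<gamma> (Some a) None \<and> ?H = {y. Some y \<in> \<gamma>} \<and> ?E = {a}) \<or>
      (\<exists>\<gamma>. jordan_curve_in S2 \<gamma> \<and> None \<in> \<gamma> \<and> ?H = {y. Some y \<in> \<gamma>} \<and> ?E = {})"
  proof -
    consider a b where "Q0 = Some a" "Q1 = Some b" | a where "Q0 = Some a" "Q1 = None"
      | b where "Q0 = None" "Q1 = Some b" | "Q0 = None" "Q1 = None" by (cases Q0; cases Q1) auto
    then show ?thesis
    proof cases
      case 1
      define g where "g t = the (extend \<phi> Q0 Q1 t)" for t
      have gS: "extend \<phi> Q0 Q1 t = Some (g t)" for t unfolding g_def using 1 by (auto simp: extend_def)
      have inj: "inj_on (extend \<phi> Q0 Q1) {0..1}" using extend_inj(1)[OF P(2) notQ] ne 1 by blast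
      have "pathin euclidean g"
        unfolding pathin_def continuous_map_def
      proof (intro conjI allI impI)
        fix U :: "(real^2) set" assume "openin euclidean U"
        then have "openin S2 (Some ` U)" unfolding S2_def by simp
        then have "openin (top_of_set {0..1}) {t \<in> topspace (top_of_set {0..1}). extend \<phi> Q0 Q1 t \<in> Some ` U}"
          using ext unfolding continuous_map_def by blast
        moreover have "{t \<in> topspace (top_of_set {0..1}). extend \<phi> Q0 Q1 t \<in> Some ` U} = {t \<in> topspace (top_of_set {0..1}). g t \<in> U}"
          unfolding gS by auto
        ultimately show "openin (top_of_set {0..1}) {t \<in> topspace (top_of_set {0..1}). g t \<in> U}" by simp
      qed auto
      moreover have "inj_on g {0..1}" using inj unfolding gS inj_on_def by simp
      moreover have "?H = g ` {0..1}"
      proof -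
        have "Some ` g ` {0..1} = {Q0, Q1} \<union> Some ` e" unfolding extim[symmetric] image_image gS by simp
        then show ?thesis using gam by (metis (no_types, lifting) Collect_cong Collect_mem_eq inj_Some inj_image_mem_iff)
      qed
      moreover have "g 0 = a" "g 1 = b" using gS[of 0] gS[of 1] ends 1 by auto
      ultimately have "arc_between euclidean ?H a b" unfolding arc_between_def by blast
      moreover have "?E = {a, b}" unfolding EQ using 1 by auto
      ultimately show ?thesis using Q0(2)[OF 1(1)] Q1(2)[OF 1(2)]
        by (intro disjI1 exI[of _ a] exI[of _ b]) simp
    next
      case 2
      have inj: "inj_on (extend \<phi> Q0 Q1) {0..1}" using extend_inj(1)[OF P(2) notQ] ne 2 by blast
      have "arc_between S2 ({Q0, Q1} \<union> Some ` e) (Some a) None"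
        unfolding arc_between_def pathin_def
        by (rule exI[of _ "extend \<phi> Q0 Q1"]) (use ext inj extim ends 2 in simp)
      moreover have "?E = {a}" unfolding EQ using 2 by auto
      ultimately show ?thesis using Q0(2)[OF 2(1)] gam
        by (intro disjI2 disjI1 exI[of _ a] exI[of _ "{Q0, Q1} \<union> Some ` e"]) (simp only: simp_thms)
    next
      case 3
      note Pr = edge_paramD[OF pr]
      have Q1r: "tends1 (\<lambda>t. (\<lambda>t. \<phi> (1 - t)) (1 - t)) Q1" using Q1(1) by simp
      \<comment> \<open>The edge is run backwards, since the arc has to start at the branching point
        and end at infinity.\<close>
      let ?g = "extend (\<lambda>t. \<phi> (1 - t)) Q1 Q0"
      have "inj_on ?g {0..1}"
        by (rule extend_inj(1)[OF Pr(2)]) (use notQ ne 3 in auto)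
      moreover have "continuous_map (top_of_set {0..1}) S2 ?g" using extend_continuous[OF Pr(1) Q0(1) Q1r] .
      moreover have "{Q0, Q1} \<union> Some ` e = ?g ` {0..1}" using extend_image[of "\<lambda>t. \<phi> (1 - t)" Q1 Q0] Pr(3) by auto
      moreover have "?g 0 = Some b" "?g 1 = None" using 3 by (simp_all add: extend_def)
      ultimately have "arc_between S2 ({Q0, Q1} \<union> Some ` e) (Some b) None"
        unfolding arc_between_def pathin_def by blast
      moreover have "?E = {b}" unfolding EQ using 3 by auto
      ultimately show ?thesis using Q1(2)[OF 3(2)] gam
        by (intro disjI2 disjI1 exI[of _ b] exI[of _ "{Q0, Q1} \<union> Some ` e"]) (simp only: simp_thms)
    next
      case 4
      have loop: "extend \<phi> Q0 Q1 0 = extend \<phi> Q0 Q1 1" unfolding ends using 4 by simp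
      have inj: "inj_on (extend \<phi> Q0 Q1) {0..<1}" using extend_inj(2)[OF P(2) notQ] .
      have "jordan_curve_in S2 (extend \<phi> Q0 Q1 ` {0..1})"
        using jordan_curve_from_loop[OF ext inj loop] .
      then have "jordan_curve_in S2 ({Q0, Q1} \<union> Some ` e)" unfolding extim .
      moreover have "?E = {}" unfolding EQ using 4 by auto
      moreover have "None \<in> {Q0, Q1} \<union> Some ` e" using 4 by simp
      ultimately show ?thesis using gam
        by (intro disjI2 exI[of _ "{Q0, Q1} \<union> Some ` e"]) (simp only: simp_thms)
    qed
  qed
  then show ?thesis unfolding nice_def using tang half by blast
qed

text \<open>Only branching points need an argument: such a point \<open>z\<close> is isolated among
  them, so a short arc of \<open>Z\<close> leaving \<open>z\<close> lies, apart from
  \<open>z\<close>, in a single edge, and \<open>z\<close> is adherent to it.\<close>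

lemma Z_Union_edges: "Z = \<Union>(hull_edge ` edges)"
proof (intro subset_antisym subsetI)
  fix z assume zZ: "z \<in> Z"
  show "z \<in> \<Union>(hull_edge ` edges)"
  proof (cases "brp z")
    case False
    then have "z \<in> Z - {b. brp b}" using zZ by blast
    then obtain e where "e \<in> edges" "z \<in> e" unfolding edges_def using Union_components by blast
    then show ?thesis unfolding hull_edge_def by blast
  next
    case True
    have Fz: "F z = 0" using zZ by simp
    obtain r where r: "r > 0" "\<And>w. dist w z < r \<Longrightarrow> w \<noteq> z \<Longrightarrow> \<not> brp w" using brp_isolated[OF Fz] by blast
    obtain \<delta> where \<delta>: "\<delta> > 0" "\<And>y. F y = 0 \<Longrightarrow> dist y z < \<delta> \<Longrightarrow> linked z y \<and> seg z y \<subseteq> cball z (r/2)"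
      using local_seg[OF Fz, of "r/2"] r(1) by auto
    obtain y where y: "F y = 0" "dist y z < \<delta>" "y \<noteq> z" using seg_extend[OF linked_refl[OF Fz] \<delta>(1)] by metis
    then have ly: "linked z y" "seg z y \<subseteq> cball z (r/2)" using \<delta>(2) by blast+
    have sub: "seg z y - {z} \<subseteq> Z - {b. brp b}"
    proof
      fix w assume w: "w \<in> seg z y - {z}"
      then have "dist w z \<le> r/2" using ly(2) by (force simp: dist_commute)
      then have "\<not> brp w" using r w by auto
      then show "w \<in> Z - {b. brp b}" using seg_in_Z[OF ly(1), of w] w by simp
    qed
    have yin: "y \<in> seg z y - {z}" using y(3) by simp
    let ?e = "connected_component_set (Z - {b. brp b}) y"
    have e: "?e \<in> edges" unfolding edges_def components_def using sub yin by blast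
    have se: "seg z y - {z} \<subseteq> ?e" using connected_component_maximal[OF yin connected_seg_minus_start[OF ly(1)] sub] .
    have "z \<in> closure ?e"
      unfolding closure_approachable
    proof (intro allI impI)
      fix d :: real assume d: "d > 0"
      have "z \<noteq> y" using y(3) by simp
      obtain w where "w \<in> seg z y" "w \<noteq> z" "dist w z < d" using seg_point_near_start[OF ly(1) \<open>z \<noteq> y\<close> d] by metis
      then show "\<exists>w\<in>?e. dist w z < d" using se by blast
    qed
    then show ?thesis using e True unfolding hull_edge_def by blast
  qed
next
  fix z assume "z \<in> \<Union>(hull_edge ` edges)"
  then obtain e where "e \<in> edges" "z \<in> hull_edge e" by blast
  then show "z \<in> Z" using edge_basic(2) closure_edge(2) unfolding hull_edge_def by blast
qed

lemma hull_edges_meet: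
  assumes "e \<in> edges" "e' \<in> edges" "hull_edge e \<noteq> hull_edge e'"
  shows "hull_edge e \<inter> hull_edge e' \<subseteq> {b. brp b}"
proof
  fix z assume z: "z \<in> hull_edge e \<inter> hull_edge e'"
  show "z \<in> {b. brp b}"
  proof (rule ccontr)
    assume "z \<notin> {b. brp b}"
    then have "z \<in> e" "z \<in> e'" using z unfolding hull_edge_def by blast+
    then have "e = e'" using component_disjoint assms(1,2) unfolding edges_def by blast
    then show False using assms(3) by simp
  qed
qed

end

section \<open>From the differentiable function to the locale\<close>

lemma gderiv_exists:
  fixes f :: "'a::euclidean_space \<Rightarrow> real"
  assumes "f differentiable (at x)" obtains D where "GDERIV f x :> D"
proof -
  obtain f' where f': "(f has_derivative f') (at x)" using assms unfolding differentiable_def by blast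
  have "linear f'" using has_derivative_linear[OF f'] .
  then have "f' = (\<lambda>h. h \<bullet> adjoint f' 1)" using adjoint_works[of f' _ 1] by (intro ext) simp
  then have "GDERIV f x :> adjoint f' 1" unfolding gderiv_def using f' by simp
  then show ?thesis by (rule that)
qed

text \<open>A local extremum would make the gradient vanish, and the cone condition is the
  definition of the derivative at one point.\<close>

lemma level_gradient:
  fixes f :: "real^2 \<Rightarrow> real" and c :: real
  assumes diff: "\<And>x. f differentiable (at x)" and nz: "\<And>x D. GDERIV f x :> D \<Longrightarrow> D \<noteq> 0"
  shows "\<exists>u. level (\<lambda>x. f x - c) u"
proof -
  have "\<exists>D. GDERIV f x :> D" for x using gderiv_exists[OF diff] by metis
  then obtain D where D: "\<And>x. GDERIV f x :> D x" by metis
  have D0: "D x \<noteq> 0" for x using nz D by blast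
  have der: "(f has_derivative (\<lambda>h. h \<bullet> D x)) (at x)" for x using D unfolding gderiv_def by blast
  have no_ext: False if "e > 0" "(\<forall>y\<in>ball x e. f y \<le> f x) \<or> (\<forall>y\<in>ball x e. f x \<le> f y)" for x e
  proof -
    have "(\<lambda>h. h \<bullet> D x) = (\<lambda>v. 0)" using differential_zero_maxmin[OF _ open_ball der that(2)] that(1) by simp
    then have "D x \<bullet> D x = 0" by metis
    then show False using D0[of x] by simp
  qed
  have "level (\<lambda>x. f x - c) (\<lambda>x. D x /\<^sub>R norm (D x))"
  proof
    have "continuous_on UNIV f"
      using diff differentiable_imp_continuous_within by (auto simp: continuous_on_eq_continuous_within)
    then show "continuous_on UNIV (\<lambda>x. f x - c)" by (intro continuous_intros)
    show "\<exists>y. dist y x < e \<and> f y - c > f x - c" if "0 < e" for e x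
      using no_ext[OF that, of x] by (force simp: dist_commute not_le[symmetric])
    show "\<exists>y. dist y x < e \<and> f y - c < f x - c" if "0 < e" for e x
      using no_ext[OF that, of x] by (force simp: dist_commute not_le[symmetric])
    show "norm (D x /\<^sub>R norm (D x)) = 1" for x using D0[of x] by simp
    fix x and \<epsilon> :: real assume x: "f x - c = 0" and e: "0 < \<epsilon>"
    have nD: "norm (D x) > 0" using D0 by simp
    define \<eta> where "\<eta> = \<epsilon> * norm (D x) / 2"
    have eta: "\<eta> > 0" using e nD unfolding \<eta>_def by simp
    obtain d where d: "d > 0" "\<And>y. norm (y - x) < d \<Longrightarrow> norm (f y - f x - (y - x) \<bullet> D x) \<le> \<eta> * norm (y - x)"
      using der[of x] eta unfolding has_derivative_at_alt by blast
    have "(\<epsilon> * norm h \<le> (D x /\<^sub>R norm (D x)) \<bullet> h \<longrightarrow> f (x + h) - c > 0) \<and>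
          ((D x /\<^sub>R norm (D x)) \<bullet> h \<le> - \<epsilon> * norm h \<longrightarrow> f (x + h) - c < 0)" if h: "h \<noteq> 0" "norm h < d" for h
    proof -
      have b: "\<bar>f (x + h) - c - h \<bullet> D x\<bar> \<le> \<eta> * norm h" using d(2)[of "x + h"] h(2) x by simp
      have eq: "(D x /\<^sub>R norm (D x)) \<bullet> h = (h \<bullet> D x) / norm (D x)" by (simp add: inner_commute divide_inverse mult.commute)
      have pos: "\<eta> * norm h > 0" "\<epsilon> * norm h * norm (D x) = 2 * (\<eta> * norm h)" using eta h(1) unfolding \<eta>_def by auto
      show ?thesis
      proof (intro conjI impI)
        assume "\<epsilon> * norm h \<le> (D x /\<^sub>R norm (D x)) \<bullet> h"
        then have "\<epsilon> * norm h * norm (D x) \<le> h \<bullet> D x" unfolding eq using nD by (simp add: pos_le_divide_eq)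
        then show "f (x + h) - c > 0" using b pos by linarith
      next
        assume "(D x /\<^sub>R norm (D x)) \<bullet> h \<le> - \<epsilon> * norm h"
        then have "h \<bullet> D x \<le> - \<epsilon> * norm h * norm (D x)" unfolding eq using nD by (simp add: pos_divide_le_eq)
        then show "f (x + h) - c < 0" using b pos by linarith
      qed
    qed
    then show "\<exists>\<delta>>0. \<forall>h. h \<noteq> 0 \<longrightarrow> norm h < \<delta> \<longrightarrow>
        (\<epsilon> * norm h \<le> (D x /\<^sub>R norm (D x)) \<bullet> h \<longrightarrow> f (x + h) - c > 0) \<and>
        ((D x /\<^sub>R norm (D x)) \<bullet> h \<le> - \<epsilon> * norm h \<longrightarrow> f (x + h) - c < 0)"
      using d(1) by blast
  qed
  then show ?thesis by blast
qed

theorem theorem1p2: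
  fixes f :: "real^2 \<Rightarrow> real" and c :: real
  assumes "\<And>x. f differentiable (at x)"
    and "\<And>x D. GDERIV f x :> D \<Longrightarrow> D \<noteq> 0"
  shows "(\<nexists>x. x islimpt {b. branching_point f c b})
    \<and> (\<exists>\<H> E. (\<forall>H\<in>\<H>. nice_curve f c H (E H)) \<and> {y. f y = c} = \<Union>\<H>
          \<and> (\<forall>H\<in>\<H>. \<forall>K\<in>\<H>. H \<noteq> K \<longrightarrow> H \<inter> K \<subseteq> E H \<inter> E K))
    \<and> (\<forall>x. f x = c \<and> \<not> branching_point f c x \<longrightarrow>
          (\<exists>U. open U \<and> x \<in> U \<and>
             (\<exists>a b::real. a < b \<and> ({y. f y = c} \<inter> U) homeomorphic {a<..<b})))
    \<and> (\<forall>x. branching_point f c x \<longrightarrow>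
          (\<exists>U. open U \<and> x \<in> U \<and>
             (\<exists>(S :: (real^2) set set) p. finite S \<and> S \<noteq> {} \<and>
                (\<forall>s\<in>S. p \<in> s \<and> (\<exists>a b. s = open_segment a b)) \<and>
                ({y. f y = c} \<inter> U) homeomorphic \<Union>S)))"
proof -
  obtain u where "level (\<lambda>x. f x - c) u" using level_gradient[of f c] assms by blast
  then interpret level "\<lambda>x. f x - c" u .
  have Z: "{y. f y = c} = Z" "{y. f y \<noteq> c} = - Z" unfolding Z_def by auto
  have br: "branching_point f c = brp" unfolding branching_point_def brp_def Z by (rule refl)
  have nc: "nice_curve f c = nice" unfolding nice_curve_def nice_def br by (intro ext) (rule refl)
  have 1: "\<nexists>x. x islimpt {b. branching_point f c b}" unfolding br using brp_no_islimpt by blast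
  \<comment> \<open>The family consists of the closed edges. Their endpoints in the plane are
    exactly the branching points they contain, so \<open>E\<close> depends on the set
    \<open>H\<close> alone.\<close>
  have 2: "\<exists>\<H> E. (\<forall>H\<in>\<H>. nice_curve f c H (E H)) \<and> {y. f y = c} = \<Union>\<H>
          \<and> (\<forall>H\<in>\<H>. \<forall>K\<in>\<H>. H \<noteq> K \<longrightarrow> H \<inter> K \<subseteq> E H \<inter> E K)"
    unfolding nc Z
    by (rule exI[of _ "hull_edge ` edges"], rule exI[of _ "\<lambda>H. H \<inter> {b. brp b}"])
      (use hull_edge_nice Z_Union_edges hull_edges_meet in blast)
  have 3: "\<exists>U. open U \<and> x \<in> U \<and> (\<exists>a b::real. a < b \<and> ({y. f y = c} \<inter> U) homeomorphic {a<..<b})"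
    if "f x = c" "\<not> branching_point f c x" for x
    unfolding Z using regular_locally_interval not_brp_regular that unfolding br by simp
  have 4: "\<exists>U. open U \<and> x \<in> U \<and>
             (\<exists>(S :: (real^2) set set) p. finite S \<and> S \<noteq> {} \<and>
                (\<forall>s\<in>S. p \<in> s \<and> (\<exists>a b. s = open_segment a b)) \<and>
                ({y. f y = c} \<inter> U) homeomorphic \<Union>S)"
    if "branching_point f c x" for x
    unfolding Z using star_locally_segments[OF brp_Z] that unfolding br by blast
  show ?thesis
  proof (rule conjI[OF 1 conjI[OF 2]], intro conjI allI impI)
    fix x assume "f x = c \<and> \<not> branching_point f c x"
    then show "\<exists>U. open U \<and> x \<in> U \<and> (\<exists>a b::real. a < b \<and> ({y. f y = c} \<inter> U) homeomorphic {a<..<b})"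
      using 3 by blast
  qed (rule 4)
qed

end
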